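(* Let $D$ be a regular connection on $\pi^{-1}(TM)$ whose (h)hv-torsion tensor $T$ satisfies $T(X,\eta)=0$ for all $\pi$-vector fields $X$. Then for all $\pi$-vector fields $X,Y,Z$: (a) $S(X,Y)Z=(D_{\gamma Y}T)(X,Z)-(D_{\gamma X}T)(Y,Z)+T(X,T(Y,Z))-T(Y,T(X,Z))+T(\widehat S(X,Y),Z)$; (b) $P(X,Y)Z-P(Z,Y)X=(D_{\beta Z}T)(Y,X)-(D_{\beta X}T)(Y,Z)+(D_{\gamma Y}Q)(X,Z)-T(Y,Q(X,Z))-T(\widehat P(Z,Y),X)+T(\widehat P(X,Y),Z)-Q(Z,T(Y,X))+Q(X,T(Y,Z))$; (c) $\mathfrak S_{X,Y,Z}\{R(X,Y)Z-T(\widehat R(X,Y),Z)\}=\mathfrak S_{X,Y,Z}\{Q(X,Q(Y,Z))-(D_{\beta X}Q)(Y,Z)\}$.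
   Context: $M$ is a real paracompact $C^\infty$ manifold of finite dimension, $\mathcal TM\subset TM$ is the set of nonzero tangent vectors, $\pi:\mathcal TM\to M$ the projection, $\pi^{-1}(TM)\to\mathcal TM$ the pullback of $TM$ by $\pi$; everything is $C^\infty$. Sections of $\pi^{-1}(TM)$ are called $\pi$-vector fields. $\eta$ is the $\pi$-vector field $\eta(u)=(u,u)$. $\rho:T(\mathcal TM)\to\pi^{-1}(TM)$ is $\rho(A)=(u,d\pi(A))$ for $A\in T_u(\mathcal TM)$, and $\gamma:\pi^{-1}(TM)\to T(\mathcal TM)$ is the vertical lift $\gamma(u,v)=\frac{d}{dt}|_{t=0}(u+tv)$; the image of $\gamma$ is the vertical bundle $V=\ker\rho$. For a linear connection $D$ on the vector bundle $\pi^{-1}(TM)$, put $K(A)=D_A\eta$ for $A\in T(\mathcal TM)$ and $H_u=\{A\in T_u(\mathcal TM):K(A)=0\}$. $D$ is regular if $T_u(\mathcal TM)=V_u\oplus H_u$ for all $u$; then $\beta:=(\rho|_H)^{-1}:\pi^{-1}(TM)\to H$ is the horizontal map. For vector fields $A,B,C$ on $\mathcal TM$: torsion $\mathbf T(A,B)=D_A\rho B-D_B\rho A-\rho[A,B]$; curvature (note the sign) $\mathbf K(A,B)\rho C=-D_AD_B\rho C+D_BD_A\rho C+D_{[A,B]}\rho C$. For $\pi$-vector fields: $Q(X,Y)=\mathbf T(\beta X,\beta Y)$ ((h)h-torsion), $T(X,Y)=\mathbf T(\gamma X,\beta Y)$ ((h)hv-torsion), $R(X,Y)Z=\mathbf K(\beta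 X,\beta Y)Z$, $P(X,Y)Z=\mathbf K(\beta X,\gamma Y)Z$, $S(X,Y)Z=\mathbf K(\gamma X,\gamma Y)Z$, and $\widehat R(X,Y)=R(X,Y)\eta$, $\widehat P(X,Y)=P(X,Y)\eta$, $\widehat S(X,Y)=S(X,Y)\eta$. $(D_AT)(X,Y)=D_A(T(X,Y))-T(D_AX,Y)-T(X,D_AY)$ and similarly for $Q$. $\mathfrak S_{X,Y,Z}$ denotes the cyclic sum over $X,Y,Z$. *)

theory Defs
  imports "HOL-Analysis.Analysis" "HOL-Library.Function_Algebras"
begin

section \<open>Smooth maps between open subsets of Euclidean spaces\<close>

text \<open>The definitions of this section are meant for open sets \<open>S\<close>. In finite dimension, \<open>C\<close>-\<open>k\<close>
  regularity may be tested on the directional derivatives in all fixed directions.\<close>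

primrec Ck_on :: "nat \<Rightarrow> 'e::real_normed_vector set \<Rightarrow> ('e \<Rightarrow> 'f::real_normed_vector) \<Rightarrow> bool" where
  "Ck_on 0 S f \<longleftrightarrow> continuous_on S f"
| "Ck_on (Suc k) S f \<longleftrightarrow>
     (\<forall>x\<in>S. f differentiable (at x)) \<and> (\<forall>v. Ck_on k S (\<lambda>x. frechet_derivative f (at x) v))"

definition smooth_on :: "'e::real_normed_vector set \<Rightarrow> ('e \<Rightarrow> 'f::real_normed_vector) \<Rightarrow> bool" where
  "smooth_on S f \<longleftrightarrow> (\<forall>k. Ck_on k S f)"


section \<open>Smooth manifolds\<close>

text \<open>A chart is a pair of a domain and a coordinate map; only the values of the map on the domain
  matter. An atlas is a set of charts.\<close>

type_synonym ('a, 'e) chart = "'a set \<times> ('a \<Rightarrow> 'e)"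

definition pts :: "('a, 'e) chart set \<Rightarrow> 'a set" where
  "pts \<A> = \<Union> (fst ` \<A>)"

definition charts_at :: "('a, 'e) chart set \<Rightarrow> 'a \<Rightarrow> ('a, 'e) chart set" where
  "charts_at \<A> p = {c \<in> \<A>. p \<in> fst c}"

definition chart_inv :: "('a, 'e) chart \<Rightarrow> 'e \<Rightarrow> 'a" where
  "chart_inv c = inv_into (fst c) (snd c)"

definition paracompact_space :: "'a topology \<Rightarrow> bool" where
  "paracompact_space X \<longleftrightarrow>
     (\<forall>\<U>. (\<forall>U\<in>\<U>. openin X U) \<and> \<Union>\<U> = topspace X \<longrightarrow>
       (\<exists>\<V>. (\<forall>V\<in>\<V>. openin X V) \<and> \<Union>\<V> = topspace X \<and>
            (\<forall>V\<in>\<V>. \<exists>U\<in>\<U>. V \<subseteq> U) \<and> locally_finite_in X \<V>))"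

definition smooth_manifold :: "'a topology \<Rightarrow> ('a, 'e::euclidean_space) chart set \<Rightarrow> bool" where
  "smooth_manifold M \<A> \<longleftrightarrow>
     Hausdorff_space M \<and> paracompact_space M \<and> pts \<A> = topspace M \<and>
     (\<forall>c\<in>\<A>. openin M (fst c) \<and> open (snd c ` fst c) \<and>
        homeomorphic_map (subtopology M (fst c)) (top_of_set (snd c ` fst c)) (snd c)) \<and>
     (\<forall>c\<in>\<A>. \<forall>d\<in>\<A>. smooth_on (snd c ` (fst c \<inter> fst d)) (snd d \<circ> chart_inv c))"

definition smooth_map ::
  "('a, 'e::euclidean_space) chart set \<Rightarrow> ('b, 'f::euclidean_space) chart set \<Rightarrow> ('a \<Rightarrow> 'b) \<Rightarrow> bool" where
  "smooth_map \<A> \<B> F \<longleftrightarrow>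
     (\<forall>p\<in>pts \<A>. \<exists>c\<in>charts_at \<A> p. \<exists>d\<in>charts_at \<B> (F p). \<exists>W.
        open W \<and> snd c p \<in> W \<and> W \<subseteq> snd c ` fst c \<and> F ` chart_inv c ` W \<subseteq> fst d \<and>
        smooth_on W (snd d \<circ> F \<circ> chart_inv c))"

definition smooth_fun :: "('a, 'e::euclidean_space) chart set \<Rightarrow> ('a \<Rightarrow> real) \<Rightarrow> bool" where
  "smooth_fun \<A> f \<longleftrightarrow> smooth_map \<A> {(UNIV, id)} f"


section \<open>Tangent vectors and vector fields\<close>

text \<open>A tangent vector at \<open>p\<close> is the family of its coordinate vectors in the charts at \<open>p\<close>, which
  transform into each other by the derivatives of the coordinate changes. It is set to \<open>0\<close> at all
  charts not containing \<open>p\<close>, so that equality of tangent vectors is equality of functions, and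
  addition and zero are the pointwise ones.\<close>

type_synonym ('a, 'e) tvec = "('a, 'e) chart \<Rightarrow> 'e"

definition tangent_space :: "('a, 'e::euclidean_space) chart set \<Rightarrow> 'a \<Rightarrow> ('a, 'e) tvec set" where
  "tangent_space \<A> p = {v.
     (\<forall>c. c \<notin> charts_at \<A> p \<longrightarrow> v c = 0) \<and>
     (\<forall>c\<in>charts_at \<A> p. \<forall>d\<in>charts_at \<A> p.
        v d = frechet_derivative (snd d \<circ> chart_inv c) (at (snd c p)) (v c))}"

definition tscale :: "real \<Rightarrow> ('a, 'e::euclidean_space) tvec \<Rightarrow> ('a, 'e) tvec" where
  "tscale r v = (\<lambda>c. r *\<^sub>R v c)"

text \<open>The derivative of a (vector-valued) function \<open>g\<close>, smooth near \<open>p\<close>, along a tangent vector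
  \<open>v\<close> at \<open>p\<close>. By the chain rule the choice of the chart is irrelevant.\<close>

definition tderiv ::
  "('a, 'e::euclidean_space) chart set \<Rightarrow> 'a \<Rightarrow> ('a, 'e) tvec \<Rightarrow> ('a \<Rightarrow> 'f::real_normed_vector) \<Rightarrow> 'f" where
  "tderiv \<A> p v g =
     (let c = (SOME c. c \<in> charts_at \<A> p)
      in frechet_derivative (g \<circ> chart_inv c) (at (snd c p)) (v c))"

definition differential ::
  "('a, 'e::euclidean_space) chart set \<Rightarrow> ('b, 'f::euclidean_space) chart set \<Rightarrow> ('a \<Rightarrow> 'b)
    \<Rightarrow> 'a \<Rightarrow> ('a, 'e) tvec \<Rightarrow> ('b, 'f) tvec" where
  "differential \<A> \<B> F p v =
     (\<lambda>d. if d \<in> charts_at \<B> (F p) then tderiv \<A> p v (snd d \<circ> F) else 0)"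

text \<open>Velocity of a curve at parameter \<open>0\<close>.\<close>

definition velocity :: "('a, 'e::euclidean_space) chart set \<Rightarrow> (real \<Rightarrow> 'a) \<Rightarrow> ('a, 'e) tvec" where
  "velocity \<A> \<sigma> =
     (\<lambda>c. if c \<in> charts_at \<A> (\<sigma> 0) then vector_derivative (snd c \<circ> \<sigma>) (at 0) else 0)"

type_synonym ('a, 'e) tpoint = "'a \<times> ('a, 'e) tvec"

definition tangent_atlas ::
  "('a, 'e::euclidean_space) chart set \<Rightarrow> (('a, 'e) tpoint, 'e \<times> 'e) chart set" where
  "tangent_atlas \<A> =
     (\<lambda>c. ({(p, v). p \<in> fst c \<and> v \<in> tangent_space \<A> p}, \<lambda>(p, v). (snd c p, v c))) ` \<A>"

definition vector_field ::
  "('a, 'e::euclidean_space) chart set \<Rightarrow> ('a \<Rightarrow> ('a, 'e) tvec) \<Rightarrow> bool" where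
  "vector_field \<A> A \<longleftrightarrow>
     (\<forall>p\<in>pts \<A>. A p \<in> tangent_space \<A> p) \<and> smooth_map \<A> (tangent_atlas \<A>) (\<lambda>p. (p, A p))"

text \<open>The coordinate vector of a tangent vector \<open>v\<close> in a chart is the derivative of the chart map
  along \<open>v\<close>. Hence the identity \<open>[A,B]f = A(Bf) - B(Af)\<close>, applied to the chart maps \<open>f\<close>, gives the
  coordinates of the Lie bracket.\<close>

definition lie_bracket ::
  "('a, 'e::euclidean_space) chart set \<Rightarrow> ('a \<Rightarrow> ('a, 'e) tvec) \<Rightarrow> ('a \<Rightarrow> ('a, 'e) tvec)
    \<Rightarrow> ('a \<Rightarrow> ('a, 'e) tvec)" where
  "lie_bracket \<A> A B = (\<lambda>p c.
     if c \<in> charts_at \<A> p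
     then tderiv \<A> p (A p) (\<lambda>q. tderiv \<A> q (B q) (snd c))
        - tderiv \<A> p (B p) (\<lambda>q. tderiv \<A> q (A q) (snd c))
     else 0)"


section \<open>The slit tangent bundle and the pullback bundle\<close>

text \<open>The manifold of nonzero tangent vectors, given by its charts. Its points are pairs
  \<open>u = (p, w)\<close> with a nonzero tangent vector \<open>w\<close> at \<open>p\<close>, and the projection to the base is \<open>fst\<close>.\<close>

type_synonym ('a, 'e) stvec = "(('a, 'e) tpoint, 'e \<times> 'e) tvec"

definition slit_atlas ::
  "('a, 'e::euclidean_space) chart set \<Rightarrow> (('a, 'e) tpoint, 'e \<times> 'e) chart set" where
  "slit_atlas \<A> = (\<lambda>(U, \<phi>). ({u \<in> U. snd u \<noteq> 0}, \<phi>)) ` tangent_atlas \<A>"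

abbreviation slit :: "('a, 'e::euclidean_space) chart set \<Rightarrow> ('a, 'e) tpoint set" where
  "slit \<A> \<equiv> pts (slit_atlas \<A>)"

text \<open>An element \<open>(u, v)\<close> of the fibre of the pullback bundle over \<open>u\<close> is represented by \<open>v\<close>, a
  tangent vector of the base at \<open>fst u\<close>. A section is thus a smooth map into the tangent bundle
  over the projection. Sections are total functions: statements about them refer to their values
  on the slit tangent bundle only.\<close>

type_synonym ('a, 'e) psec = "('a, 'e) tpoint \<Rightarrow> ('a, 'e) tvec"

definition pi_field :: "('a, 'e::euclidean_space) chart set \<Rightarrow> ('a, 'e) psec \<Rightarrow> bool" where
  "pi_field \<A> X \<longleftrightarrow>
     (\<forall>u\<in>slit \<A>. X u \<in> tangent_space \<A> (fst u)) \<and>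
     smooth_map (slit_atlas \<A>) (tangent_atlas \<A>) (\<lambda>u. (fst u, X u))"

definition eta :: "('a, 'e::euclidean_space) psec" where
  "eta u = snd u"

definition rho ::
  "('a, 'e::euclidean_space) chart set \<Rightarrow> ('a, 'e) tpoint \<Rightarrow> ('a, 'e) stvec \<Rightarrow> ('a, 'e) tvec" where
  "rho \<A> u A = differential (slit_atlas \<A>) \<A> fst u A"

definition vlift ::
  "('a, 'e::euclidean_space) chart set \<Rightarrow> ('a, 'e) tpoint \<Rightarrow> ('a, 'e) tvec \<Rightarrow> ('a, 'e) stvec" where
  "vlift \<A> u v = velocity (slit_atlas \<A>) (\<lambda>t. (fst u, snd u + tscale t v))"


section \<open>Regular connections\<close>

text \<open>\<open>D u A X\<close> is the covariant derivative of the section \<open>X\<close> along the vector \<open>A\<close> tangent to the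
  slit tangent bundle at \<open>u\<close>. Smoothness: for every section \<open>X\<close>, the covariant differential of \<open>X\<close> is
  a smooth section of the bundle of homomorphisms from the tangent bundle of the slit tangent
  bundle to the pullback bundle, that is, \<open>A \<mapsto> D u A X\<close> is a smooth bundle morphism.\<close>

type_synonym ('a, 'e) conn =
  "('a, 'e) tpoint \<Rightarrow> ('a, 'e) stvec \<Rightarrow> ('a, 'e) psec \<Rightarrow> ('a, 'e) tvec"

definition linear_connection ::
  "('a, 'e::euclidean_space) chart set \<Rightarrow> ('a, 'e) conn \<Rightarrow> bool" where
  "linear_connection \<A> D \<longleftrightarrow>
     (\<forall>X. pi_field \<A> X \<longrightarrow>
       (\<forall>u\<in>slit \<A>. \<forall>A\<in>tangent_space (slit_atlas \<A>) u.
          D u A X \<in> tangent_space \<A> (fst u) \<and>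
          (\<forall>B\<in>tangent_space (slit_atlas \<A>) u. D u (A + B) X = D u A X + D u B X) \<and>
          (\<forall>r. D u (tscale r A) X = tscale r (D u A X)) \<and>
          (\<forall>Y. pi_field \<A> Y \<longrightarrow> D u A (X + Y) = D u A X + D u A Y) \<and>
          (\<forall>f. smooth_fun (slit_atlas \<A>) f \<longrightarrow>
             D u A (\<lambda>w. tscale (f w) (X w)) =
               tscale (tderiv (slit_atlas \<A>) u A f) (X u) + tscale (f u) (D u A X))) \<and>
       smooth_map (tangent_atlas (slit_atlas \<A>)) (tangent_atlas \<A>) (\<lambda>(u, A). (fst u, D u A X)))"

definition vert_space ::
  "('a, 'e::euclidean_space) chart set \<Rightarrow> ('a, 'e) tpoint \<Rightarrow> ('a, 'e) stvec set" where
  "vert_space \<A> u = {A \<in> tangent_space (slit_atlas \<A>) u. rho \<A> u A = 0}"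

definition hor_space ::
  "('a, 'e::euclidean_space) chart set \<Rightarrow> ('a, 'e) conn \<Rightarrow> ('a, 'e) tpoint \<Rightarrow> ('a, 'e) stvec set" where
  "hor_space \<A> D u = {A \<in> tangent_space (slit_atlas \<A>) u. D u A eta = 0}"

definition regular_connection ::
  "('a, 'e::euclidean_space) chart set \<Rightarrow> ('a, 'e) conn \<Rightarrow> bool" where
  "regular_connection \<A> D \<longleftrightarrow> linear_connection \<A> D \<and>
     (\<forall>u\<in>slit \<A>.
        tangent_space (slit_atlas \<A>) u = {A + B |A B. A \<in> vert_space \<A> u \<and> B \<in> hor_space \<A> D u} \<and>
        vert_space \<A> u \<inter> hor_space \<A> D u = {0})"

definition hlift ::
  "('a, 'e::euclidean_space) chart set \<Rightarrow> ('a, 'e) conn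
    \<Rightarrow> ('a, 'e) tpoint \<Rightarrow> ('a, 'e) tvec \<Rightarrow> ('a, 'e) stvec" where
  "hlift \<A> D u = inv_into (hor_space \<A> D u) (rho \<A> u)"


section \<open>Torsion and curvature\<close>

type_synonym ('a, 'e) svfield = "('a, 'e) tpoint \<Rightarrow> ('a, 'e) stvec"

definition rho_f :: "('a, 'e::euclidean_space) chart set \<Rightarrow> ('a, 'e) svfield \<Rightarrow> ('a, 'e) psec" where
  "rho_f \<A> A = (\<lambda>u. rho \<A> u (A u))"

definition gamma_f :: "('a, 'e::euclidean_space) chart set \<Rightarrow> ('a, 'e) psec \<Rightarrow> ('a, 'e) svfield" where
  "gamma_f \<A> X = (\<lambda>u. vlift \<A> u (X u))"

definition beta_f ::
  "('a, 'e::euclidean_space) chart set \<Rightarrow> ('a, 'e) conn \<Rightarrow> ('a, 'e) psec \<Rightarrow> ('a, 'e) svfield" where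
  "beta_f \<A> D X = (\<lambda>u. hlift \<A> D u (X u))"

definition cov :: "('a, 'e) conn \<Rightarrow> ('a, 'e) svfield \<Rightarrow> ('a, 'e) psec \<Rightarrow> ('a, 'e) psec" where
  "cov D A X = (\<lambda>u. D u (A u) X)"

definition torsion ::
  "('a, 'e::euclidean_space) chart set \<Rightarrow> ('a, 'e) conn
    \<Rightarrow> ('a, 'e) svfield \<Rightarrow> ('a, 'e) svfield \<Rightarrow> ('a, 'e) psec" where
  "torsion \<A> D A B =
     cov D A (rho_f \<A> B) - cov D B (rho_f \<A> A) - rho_f \<A> (lie_bracket (slit_atlas \<A>) A B)"

text \<open>Note the sign of the curvature. Its last argument is a section of the pullback bundle; every
  such section is of the form \<open>rho C\<close>.\<close>

definition curvature ::
  "('a, 'e::euclidean_space) chart set \<Rightarrow> ('a, 'e) conn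
    \<Rightarrow> ('a, 'e) svfield \<Rightarrow> ('a, 'e) svfield \<Rightarrow> ('a, 'e) psec \<Rightarrow> ('a, 'e) psec" where
  "curvature \<A> D A B Z =
     - cov D A (cov D B Z) + cov D B (cov D A Z) + cov D (lie_bracket (slit_atlas \<A>) A B) Z"

definition Q_tor ::
  "('a, 'e::euclidean_space) chart set \<Rightarrow> ('a, 'e) conn
    \<Rightarrow> ('a, 'e) psec \<Rightarrow> ('a, 'e) psec \<Rightarrow> ('a, 'e) psec" where
  "Q_tor \<A> D X Y = torsion \<A> D (beta_f \<A> D X) (beta_f \<A> D Y)"

definition T_tor ::
  "('a, 'e::euclidean_space) chart set \<Rightarrow> ('a, 'e) conn
    \<Rightarrow> ('a, 'e) psec \<Rightarrow> ('a, 'e) psec \<Rightarrow> ('a, 'e) psec" where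
  "T_tor \<A> D X Y = torsion \<A> D (gamma_f \<A> X) (beta_f \<A> D Y)"

definition R_curv ::
  "('a, 'e::euclidean_space) chart set \<Rightarrow> ('a, 'e) conn
    \<Rightarrow> ('a, 'e) psec \<Rightarrow> ('a, 'e) psec \<Rightarrow> ('a, 'e) psec \<Rightarrow> ('a, 'e) psec" where
  "R_curv \<A> D X Y Z = curvature \<A> D (beta_f \<A> D X) (beta_f \<A> D Y) Z"

definition P_curv ::
  "('a, 'e::euclidean_space) chart set \<Rightarrow> ('a, 'e) conn
    \<Rightarrow> ('a, 'e) psec \<Rightarrow> ('a, 'e) psec \<Rightarrow> ('a, 'e) psec \<Rightarrow> ('a, 'e) psec" where
  "P_curv \<A> D X Y Z = curvature \<A> D (beta_f \<A> D X) (gamma_f \<A> Y) Z"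

definition S_curv ::
  "('a, 'e::euclidean_space) chart set \<Rightarrow> ('a, 'e) conn
    \<Rightarrow> ('a, 'e) psec \<Rightarrow> ('a, 'e) psec \<Rightarrow> ('a, 'e) psec \<Rightarrow> ('a, 'e) psec" where
  "S_curv \<A> D X Y Z = curvature \<A> D (gamma_f \<A> X) (gamma_f \<A> Y) Z"

definition R_hat ::
  "('a, 'e::euclidean_space) chart set \<Rightarrow> ('a, 'e) conn
    \<Rightarrow> ('a, 'e) psec \<Rightarrow> ('a, 'e) psec \<Rightarrow> ('a, 'e) psec" where
  "R_hat \<A> D X Y = R_curv \<A> D X Y eta"

definition P_hat ::
  "('a, 'e::euclidean_space) chart set \<Rightarrow> ('a, 'e) conn
    \<Rightarrow> ('a, 'e) psec \<Rightarrow> ('a, 'e) psec \<Rightarrow> ('a, 'e) psec" where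
  "P_hat \<A> D X Y = P_curv \<A> D X Y eta"

definition S_hat ::
  "('a, 'e::euclidean_space) chart set \<Rightarrow> ('a, 'e) conn
    \<Rightarrow> ('a, 'e) psec \<Rightarrow> ('a, 'e) psec \<Rightarrow> ('a, 'e) psec" where
  "S_hat \<A> D X Y = S_curv \<A> D X Y eta"

definition cov2 ::
  "('a, 'e) conn \<Rightarrow> ('a, 'e) svfield \<Rightarrow> (('a, 'e) psec \<Rightarrow> ('a, 'e) psec \<Rightarrow> ('a, 'e::euclidean_space) psec)
    \<Rightarrow> ('a, 'e) psec \<Rightarrow> ('a, 'e) psec \<Rightarrow> ('a, 'e) psec" where
  "cov2 D A W X Y = cov D A (W X Y) - W (cov D A X) Y - W X (cov D A Y)"

definition cyclic_sum :: "('s \<Rightarrow> 's \<Rightarrow> 's \<Rightarrow> 't::plus) \<Rightarrow> 's \<Rightarrow> 's \<Rightarrow> 's \<Rightarrow> 't" where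
  "cyclic_sum F X Y Z = F X Y Z + F Y Z X + F Z X Y"

end

theory Submission
  imports Defs
begin

text \<open>Everything follows from the first Bianchi identity
  \<open>\<SS> {K(A,B)\<rho>C + D\<^sub>A(T(B,C)) + T(A,[B,C])} = 0\<close>, a consequence of the Jacobi identity, applied to
  horizontal and vertical lifts. The brackets \<open>[B,C]\<close> are split into their horizontal and vertical parts:
  the horizontal part is the lift of \<open>\<rho>[B,C]\<close>, given by the torsion, and the vertical part is the lift of
  \<open>D\<^bsub>[B,C]\<^esub>\<eta>\<close>, given by the curvature evaluated at \<open>\<eta>\<close>. The latter uses \<open>D\<^bsub>\<gamma>X\<^esub>\<eta> = X\<close>, which is
  what the hypothesis \<open>T(X,\<eta>) = 0\<close> says, because \<open>\<rho>[\<gamma>X,\<beta>\<eta>] = X\<close>.\<close>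

section \<open>Calculus of smooth maps\<close>

text \<open>Sections and fields are total functions, and \<open>D u A X\<close> receives the whole
  of \<open>X\<close>, whereas everything known concerns the slit bundle. Sections that agree there
  cannot simply be exchanged: \<open>conn_cong\<close> and the congruence rules for brackets,
  torsion and curvature do this, and they occur at nearly every step because
  \<open>\<rho> (\<beta> X)\<close> is known to equal \<open>X\<close> only on the slit bundle.
  Brackets are split as global fields and not vector by vector, so that additivity of the torsion
  carries the argument. For this the lifts must themselves be smooth fields. For
  \<open>\<gamma> X\<close> this is visible in coordinates; \<open>\<beta> X\<close> is defined by a
  choice from an inverse image, and its smoothness is where determinants come in. The relation
  \<rho>[\<gamma>X,\<beta>\<eta>] = X is a coordinate fact: in bundle coordinates (x, y) the base
  part of \<beta>\<eta> is y, and \<gamma>X = (0, X) differentiates it to X. The chart calculus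
  rests on the symmetry of second derivatives, which makes the bracket a tangent vector and gives
  the Jacobi identity.\<close>

abbreviation fd :: "('e::real_normed_vector \<Rightarrow> 'f::real_normed_vector) \<Rightarrow> 'e \<Rightarrow> 'e \<Rightarrow> 'f" where
  "fd f x \<equiv> frechet_derivative f (at x)"

lemma fd_eqI: "(f has_derivative f') (at x) \<Longrightarrow> fd f x = f'"
  using frechet_derivative_at by metis

lemma fd_has_derivative: "f differentiable (at x) \<Longrightarrow> (f has_derivative fd f x) (at x)"
  using frechet_derivative_works by blast

text \<open>\<open>frechet_derivative\<close> chooses from the set of derivatives at the point.
  Functions agreeing near \<open>x\<close> have the same such set, so the chosen values coincide
  even where no derivative exists.\<close>

lemma fd_cong_open:
  assumes "open S" "x \<in> S" "\<And>y. y \<in> S \<Longrightarrow> f y = g y"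
  shows "fd f x = fd g x"
proof -
  have "(f has_derivative f') (at x) \<longleftrightarrow> (g has_derivative f') (at x)" for f'
    using assms has_derivative_transform_within_open by (metis (no_types, lifting))
  then show ?thesis unfolding frechet_derivative_def by simp
qed

lemma differentiable_cong_open:
  assumes "open S" "x \<in> S" "\<And>y. y \<in> S \<Longrightarrow> f y = g y" "f differentiable (at x)"
  shows "g differentiable (at x)"
  using assms has_derivative_transform_within_open unfolding differentiable_def by (metis (no_types, lifting))

lemma fd_compose:
  assumes "g differentiable (at x)" "f differentiable (at (g x))"
  shows "fd (\<lambda>x. f (g x)) x = (\<lambda>v. fd f (g x) (fd g x v))"
  using diff_chain_at[OF fd_has_derivative[OF assms(1)] fd_has_derivative[OF assms(2)]]
  by (intro fd_eqI) (simp add: o_def)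

lemma differentiable_compose_at:
  assumes "g differentiable (at x)" "f differentiable (at (g x))"
  shows "(\<lambda>x. f (g x)) differentiable (at x)"
  using differentiable_chain_at[OF assms] by (simp add: o_def)

lemma fd_linear: "f differentiable (at x) \<Longrightarrow> linear (fd f x)"
  by (rule linear_frechet_derivative)

lemma fd_add:
  assumes "f differentiable (at x)" "g differentiable (at x)"
  shows "fd (\<lambda>x. f x + g x) x = (\<lambda>v. fd f x v + fd g x v)"
  by (intro fd_eqI has_derivative_add fd_has_derivative assms)

lemma fd_diff:
  assumes "f differentiable (at x)" "g differentiable (at x)"
  shows "fd (\<lambda>x. f x - g x) x = (\<lambda>v. fd f x v - fd g x v)"
  by (intro fd_eqI has_derivative_diff fd_has_derivative assms)

lemma fd_bounded_linear:
  assumes "bounded_linear L" "f differentiable (at x)"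
  shows "fd (\<lambda>x. L (f x)) x = (\<lambda>v. L (fd f x v))"
  by (intro fd_eqI bounded_linear.has_derivative[OF assms(1)] fd_has_derivative assms)

lemma differentiable_bounded_linear:
  assumes "bounded_linear L" "f differentiable (at x)"
  shows "(\<lambda>x. L (f x)) differentiable (at x)"
  using bounded_linear.has_derivative[OF assms(1) fd_has_derivative[OF assms(2)]]
  by (rule differentiableI)

section \<open>Calculus of C^k maps\<close>

lemma Ck_on_cong:
  assumes "open S" "\<And>x. x \<in> S \<Longrightarrow> f x = g x" "Ck_on k S f"
  shows "Ck_on k S g"
  using assms(2,3)
proof (induction k arbitrary: f g)
  case 0
  then show ?case using continuous_on_cong by fastforce
next
  case (Suc k)
  have "g differentiable (at x)" if "x \<in> S" for x
    using differentiable_cong_open[OF assms(1) that, of f g] Suc.prems that by auto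
  moreover have "Ck_on k S (\<lambda>x. fd g x v)" for v
  proof (rule Suc.IH)
    show "fd f x v = fd g x v" if "x \<in> S" for x
      using fd_cong_open[OF assms(1) that, of f g] Suc.prems(1) by simp
    show "Ck_on k S (\<lambda>x. fd f x v)" using Suc.prems by simp
  qed
  ultimately show ?case by simp
qed

lemma Ck_on_subset: "Ck_on k S f \<Longrightarrow> T \<subseteq> S \<Longrightarrow> Ck_on k T f"
proof (induction k arbitrary: f)
  case 0
  then show ?case using continuous_on_subset by auto
next
  case (Suc k)
  then show ?case by auto
qed

lemma Ck_on_local:
  assumes "\<And>x. x \<in> S \<Longrightarrow> \<exists>U. open U \<and> x \<in> U \<and> Ck_on k U f"
  shows "Ck_on k S f"
  using assms
proof (induction k arbitrary: f)
  case 0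
  then show ?case
    by (metis Ck_on.simps(1) continuous_at_imp_continuous_on continuous_on_eq_continuous_at)
next
  case (Suc k)
  have "f differentiable (at x)" if "x \<in> S" for x
    using Suc.prems[OF that] by auto
  moreover have "Ck_on k S (\<lambda>x. fd f x v)" for v
    using Suc.prems by (intro Suc.IH) fastforce
  ultimately show ?case by simp
qed

lemma Ck_on_continuous: "Ck_on k S f \<Longrightarrow> continuous_on S f"
  by (cases k) (auto intro!: differentiable_imp_continuous_on differentiable_at_imp_differentiable_on)

lemma Ck_on_Suc_imp: "Ck_on (Suc k) S f \<Longrightarrow> Ck_on k S f"
proof (induction k arbitrary: f)
  case 0
  then show ?case using Ck_on_continuous by fastforce
next
  case (Suc k)
  have "Ck_on k S (\<lambda>x. fd f x v)" for v
    using Suc.prems Ck_on.simps(2) by (intro Suc.IH) blast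
  then show ?case using Suc.prems by simp
qed

lemma Ck_on_const: "Ck_on k S (\<lambda>x. c)"
  by (induction k arbitrary: c) (auto simp: frechet_derivative_const)

lemma Ck_on_bounded_linear:
  assumes "open S" "bounded_linear L" "Ck_on k S f"
  shows "Ck_on k S (\<lambda>x. L (f x))"
  using assms(3)
proof (induction k arbitrary: f)
  case 0
  then show ?case using bounded_linear.continuous_on[OF assms(2)] by auto
next
  case (Suc k)
  have "Ck_on k S (\<lambda>x. fd (\<lambda>x. L (f x)) x v)" for v
  proof (rule Ck_on_cong[OF assms(1)])
    show "Ck_on k S (\<lambda>x. L (fd f x v))" using Suc by simp
    show "L (fd f x v) = fd (\<lambda>x. L (f x)) x v" if "x \<in> S" for x
      using Suc.prems that by (simp add: fd_bounded_linear[OF assms(2)])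
  qed
  then show ?case using Suc.prems by (auto intro: differentiable_bounded_linear[OF assms(2)])
qed

lemma Ck_on_ident: "open S \<Longrightarrow> Ck_on k S (\<lambda>x. x)"
  by (cases k) (auto simp: Ck_on_const intro: continuous_intros)

lemma Ck_on_add:
  assumes "open S" "Ck_on k S f" "Ck_on k S g"
  shows "Ck_on k S (\<lambda>x. f x + g x)"
  using assms(2,3)
proof (induction k arbitrary: f g)
  case 0
  then show ?case by (auto intro: continuous_intros)
next
  case (Suc k)
  have "Ck_on k S (\<lambda>x. fd (\<lambda>x. f x + g x) x v)" for v
  proof (rule Ck_on_cong[OF assms(1)])
    show "Ck_on k S (\<lambda>x. fd f x v + fd g x v)" using Suc by simp
    show "fd f x v + fd g x v = fd (\<lambda>x. f x + g x) x v" if "x \<in> S" for x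
      using Suc.prems that by (simp add: fd_add)
  qed
  then show ?case using Suc.prems by (auto intro: differentiable_add)
qed

text \<open>The Leibniz rule pairs each factor with a derivative of the other, so the induction step
  uses both the factors (via \<open>Ck_on_Suc_imp\<close>) and their derivatives in class
  \<open>k\<close>.\<close>

lemma Ck_on_bilinear:
  assumes "open S" "bounded_bilinear h" "Ck_on k S f" "Ck_on k S g"
  shows "Ck_on k S (\<lambda>x. h (f x) (g x))"
  using assms(3,4)
proof (induction k arbitrary: f g)
  case 0
  then show ?case using bounded_bilinear.continuous_on[OF assms(2)] by auto
next
  case (Suc k)
  have d: "((\<lambda>x. h (f x) (g x)) has_derivative (\<lambda>v. h (f x) (fd g x v) + h (fd f x v) (g x))) (at x)"
    if "x \<in> S" for x
    using Suc.prems that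
    by (intro bounded_bilinear.FDERIV[OF assms(2)] fd_has_derivative) auto
  have "Ck_on k S (\<lambda>x. fd (\<lambda>x. h (f x) (g x)) x v)" for v
  proof (rule Ck_on_cong[OF assms(1)])
    show "Ck_on k S (\<lambda>x. h (f x) (fd g x v) + h (fd f x v) (g x))"
    proof (intro Ck_on_add assms(1) Suc.IH)
      show "Ck_on k S f" "Ck_on k S g" using Suc.prems Ck_on_Suc_imp by blast+
    qed (use Suc.prems in auto)
    show "h (f x) (fd g x v) + h (fd f x v) (g x) = fd (\<lambda>x. h (f x) (g x)) x v" if "x \<in> S" for x
      by (simp add: fd_eqI[OF d[OF that]])
  qed
  moreover have "(\<lambda>x. h (f x) (g x)) differentiable (at x)" if "x \<in> S" for x
    using d[OF that] by (rule differentiableI)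
  ultimately show ?case by simp
qed

lemma Ck_on_sum:
  assumes "open S" "\<And>i. i \<in> I \<Longrightarrow> Ck_on k S (f i)"
  shows "Ck_on k S (\<lambda>x. \<Sum>i\<in>I. f i x)"
proof (cases "finite I")
  case True
  then show ?thesis using assms(2)
    by (induction I rule: finite_induct) (auto simp: Ck_on_const intro!: Ck_on_add[OF assms(1)])
qed (simp add: Ck_on_const)

lemma Ck_on_prod:
  fixes f :: "'i \<Rightarrow> 'e::real_normed_vector \<Rightarrow> real"
  assumes "open S" "\<And>i. i \<in> I \<Longrightarrow> Ck_on k S (f i)"
  shows "Ck_on k S (\<lambda>x. \<Prod>i\<in>I. f i x)"
proof (cases "finite I")
  case True
  then show ?thesis using assms(2)
    by (induction I rule: finite_induct)
      (auto simp: Ck_on_const intro!: Ck_on_bilinear[OF assms(1) bounded_bilinear_mult])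
qed (simp add: Ck_on_const)

text \<open>\<open>Ck_on\<close> speaks of derivatives in fixed directions only. This expansion
  reduces a derivative in a direction that varies with the point to finitely many fixed
  ones.\<close>

lemma linear_euclidean_expand:
  fixes L :: "'e::euclidean_space \<Rightarrow> 'f::real_vector"
  assumes "linear L"
  shows "L v = (\<Sum>b\<in>Basis. (v \<bullet> b) *\<^sub>R L b)"
proof -
  have "L v = L (\<Sum>b\<in>Basis. (v \<bullet> b) *\<^sub>R b)"
    by (simp only: euclidean_representation)
  also have "\<dots> = (\<Sum>b\<in>Basis. (v \<bullet> b) *\<^sub>R L b)"
    by (simp only: linear_sum[OF assms] linear_cmul[OF assms])
  finally show ?thesis .
qed

text \<open>The chain rule produces the derivative of \<open>f\<close> in the moving direction
  \<open>fd g x v\<close>. Expanded in the basis it becomes a sum of products. The induction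
  hypothesis is used for the partial derivatives of \<open>f\<close>; hence \<open>f\<close> is
  arbitrary in the induction.\<close>

lemma Ck_on_compose:
  fixes f :: "'f::euclidean_space \<Rightarrow> 'g::real_normed_vector"
  assumes "open S" "open T" "g ` S \<subseteq> T" "Ck_on k T f" "Ck_on k S g"
  shows "Ck_on k S (\<lambda>x. f (g x))"
  using assms(4,5)
proof (induction k arbitrary: f)
  case 0
  then show ?case using assms(3) by (auto intro: continuous_on_compose2)
next
  case (Suc k)
  have diff: "g differentiable (at x)" "f differentiable (at (g x))" if "x \<in> S" for x
    using Suc.prems that assms(3) by auto
  have "Ck_on k S (\<lambda>x. fd (\<lambda>x. f (g x)) x v)" for v
  proof (rule Ck_on_cong[OF assms(1)])
    show "Ck_on k S (\<lambda>x. \<Sum>b\<in>Basis. (fd g x v \<bullet> b) *\<^sub>R fd f (g x) b)"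
    proof (intro Ck_on_sum assms(1) Ck_on_bilinear[OF assms(1) bounded_bilinear_scaleR])
      fix b :: 'f
      show "Ck_on k S (\<lambda>x. fd g x v \<bullet> b)"
        using Suc.prems by (intro Ck_on_bounded_linear[OF assms(1) bounded_linear_inner_left]) simp
      show "Ck_on k S (\<lambda>x. fd f (g x) b)"
        using Suc.prems Ck_on_Suc_imp[OF Suc.prems(2)] by (intro Suc.IH[of "\<lambda>y. fd f y b"]) auto
    qed
    show "(\<Sum>b\<in>Basis. (fd g x v \<bullet> b) *\<^sub>R fd f (g x) b) = fd (\<lambda>x. f (g x)) x v" if "x \<in> S" for x
      using diff[OF that]
      by (simp add: fd_compose linear_euclidean_expand[OF fd_linear, of f "g x" "fd g x v"])
  qed
  then show ?case using diff differentiable_compose_at[of g _ f] by auto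
qed

text \<open>The derivative of the reciprocal contains the reciprocal again, which is of class
  \<open>k\<close> by the induction hypothesis.\<close>

lemma Ck_on_inverse:
  fixes f :: "'e::real_normed_vector \<Rightarrow> real"
  assumes "open S" "\<And>x. x \<in> S \<Longrightarrow> f x \<noteq> 0" "Ck_on k S f"
  shows "Ck_on k S (\<lambda>x. inverse (f x))"
  using assms(3)
proof (induction k)
  case 0
  then show ?case using assms(2) by (auto intro: continuous_on_inverse)
next
  case (Suc k)
  have d: "((\<lambda>x. inverse (f x)) has_derivative (\<lambda>v. - (inverse (f x) * fd f x v * inverse (f x)))) (at x)"
    if "x \<in> S" for x
    using Suc.prems that assms(2) by (intro Deriv.has_derivative_inverse fd_has_derivative) auto
  have IH: "Ck_on k S (\<lambda>x. inverse (f x))" using Suc Ck_on_Suc_imp by blast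
  have "Ck_on k S (\<lambda>x. fd (\<lambda>x. inverse (f x)) x v)" for v
  proof (rule Ck_on_cong[OF assms(1)])
    show "Ck_on k S (\<lambda>x. - (inverse (f x) * fd f x v * inverse (f x)))"
      by (intro Ck_on_bounded_linear[OF assms(1) bounded_linear_minus[OF bounded_linear_ident]]
          Ck_on_bilinear[OF assms(1) bounded_bilinear_mult] IH) (use Suc.prems in auto)
    show "- (inverse (f x) * fd f x v * inverse (f x)) = fd (\<lambda>x. inverse (f x)) x v" if "x \<in> S" for x
      by (simp add: fd_eqI[OF d[OF that]])
  qed
  moreover have "(\<lambda>x. inverse (f x)) differentiable (at x)" if "x \<in> S" for x
    using d[OF that] by (rule differentiableI)
  ultimately show ?case by simp
qed

section \<open>Closure rules for smooth maps\<close>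

lemma smooth_on_cong:
  "open S \<Longrightarrow> (\<And>x. x \<in> S \<Longrightarrow> f x = g x) \<Longrightarrow> smooth_on S f \<Longrightarrow> smooth_on S g"
  unfolding smooth_on_def using Ck_on_cong by blast

lemma smooth_on_subset: "smooth_on S f \<Longrightarrow> T \<subseteq> S \<Longrightarrow> smooth_on T f"
  unfolding smooth_on_def using Ck_on_subset by blast

lemma smooth_on_local:
  "(\<And>x. x \<in> S \<Longrightarrow> \<exists>U. open U \<and> x \<in> U \<and> smooth_on U f) \<Longrightarrow> smooth_on S f"
  unfolding smooth_on_def using Ck_on_local by metis

lemma smooth_on_continuous: "smooth_on S f \<Longrightarrow> continuous_on S f"
  unfolding smooth_on_def using Ck_on_continuous by blast

lemma smooth_on_differentiable: "smooth_on S f \<Longrightarrow> x \<in> S \<Longrightarrow> f differentiable (at x)"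
  unfolding smooth_on_def using Ck_on.simps(2) by blast

lemma smooth_on_fd: "smooth_on S f \<Longrightarrow> smooth_on S (\<lambda>x. fd f x v)"
  unfolding smooth_on_def using Ck_on.simps(2) by blast

lemma smooth_on_const: "smooth_on S (\<lambda>x. c)"
  unfolding smooth_on_def using Ck_on_const by blast

lemma smooth_on_ident: "open S \<Longrightarrow> smooth_on S (\<lambda>x. x)"
  unfolding smooth_on_def using Ck_on_ident by blast

lemma smooth_on_bounded_linear:
  "open S \<Longrightarrow> bounded_linear L \<Longrightarrow> smooth_on S f \<Longrightarrow> smooth_on S (\<lambda>x. L (f x))"
  by (simp add: smooth_on_def Ck_on_bounded_linear)

lemma smooth_on_add:
  "open S \<Longrightarrow> smooth_on S f \<Longrightarrow> smooth_on S g \<Longrightarrow> smooth_on S (\<lambda>x. f x + g x)"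
  by (simp add: smooth_on_def Ck_on_add)

lemma smooth_on_uminus: "open S \<Longrightarrow> smooth_on S f \<Longrightarrow> smooth_on S (\<lambda>x. - f x)"
  by (rule smooth_on_bounded_linear[OF _ bounded_linear_minus[OF bounded_linear_ident]])

lemma smooth_on_diff:
  "open S \<Longrightarrow> smooth_on S f \<Longrightarrow> smooth_on S g \<Longrightarrow> smooth_on S (\<lambda>x. f x - g x)"
  using smooth_on_add[OF _ _ smooth_on_uminus, of S f g] by simp

lemma smooth_on_sum:
  "open S \<Longrightarrow> (\<And>i. i \<in> I \<Longrightarrow> smooth_on S (f i)) \<Longrightarrow> smooth_on S (\<lambda>x. \<Sum>i\<in>I. f i x)"
  by (simp add: smooth_on_def Ck_on_sum)

lemma smooth_on_prod:
  fixes f :: "'i \<Rightarrow> 'e::real_normed_vector \<Rightarrow> real"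
  shows "open S \<Longrightarrow> (\<And>i. i \<in> I \<Longrightarrow> smooth_on S (f i)) \<Longrightarrow> smooth_on S (\<lambda>x. \<Prod>i\<in>I. f i x)"
  by (simp add: smooth_on_def Ck_on_prod)

lemma smooth_on_bilinear:
  "open S \<Longrightarrow> bounded_bilinear h \<Longrightarrow> smooth_on S f \<Longrightarrow> smooth_on S g \<Longrightarrow> smooth_on S (\<lambda>x. h (f x) (g x))"
  by (simp add: smooth_on_def Ck_on_bilinear)

lemmas smooth_on_mult = smooth_on_bilinear[OF _ bounded_bilinear_mult]
lemmas smooth_on_scaleR = smooth_on_bilinear[OF _ bounded_bilinear_scaleR]

lemma smooth_on_inverse:
  fixes f :: "'e::real_normed_vector \<Rightarrow> real"
  shows "open S \<Longrightarrow> (\<And>x. x \<in> S \<Longrightarrow> f x \<noteq> 0) \<Longrightarrow> smooth_on S f \<Longrightarrow> smooth_on S (\<lambda>x. inverse (f x))"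
  by (simp add: smooth_on_def Ck_on_inverse)

lemma smooth_on_compose:
  fixes f :: "'f::euclidean_space \<Rightarrow> 'g::real_normed_vector"
  shows "open S \<Longrightarrow> open T \<Longrightarrow> g ` S \<subseteq> T \<Longrightarrow> smooth_on T f \<Longrightarrow> smooth_on S g \<Longrightarrow> smooth_on S (\<lambda>x. f (g x))"
  by (simp add: smooth_on_def Ck_on_compose)

lemma smooth_on_fst: "open S \<Longrightarrow> smooth_on S f \<Longrightarrow> smooth_on S (\<lambda>x. fst (f x))"
  by (rule smooth_on_bounded_linear[OF _ bounded_linear_fst])

lemma smooth_on_snd: "open S \<Longrightarrow> smooth_on S f \<Longrightarrow> smooth_on S (\<lambda>x. snd (f x))"
  by (rule smooth_on_bounded_linear[OF _ bounded_linear_snd])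

lemma smooth_on_Pair:
  assumes "open S" "smooth_on S f" "smooth_on S g"
  shows "smooth_on S (\<lambda>x. (f x, g x))"
proof -
  have "bounded_linear (\<lambda>y. (y, 0))" "bounded_linear (\<lambda>y. (0, y))"
    by (simp_all add: bounded_linear_Pair bounded_linear_ident bounded_linear_zero)
  then have "smooth_on S (\<lambda>x. (f x, 0))" "smooth_on S (\<lambda>x. (0, g x))"
    using assms(2,3) by (auto intro: smooth_on_bounded_linear[OF assms(1)])
  from smooth_on_add[OF assms(1) this] show ?thesis by simp
qed

text \<open>A derivative whose base point and direction both vary is the shape of bracket components
  and of the fibre part of a bundle transition.\<close>

lemma smooth_on_fd_apply:
  fixes f :: "'f::euclidean_space \<Rightarrow> 'g::real_normed_vector"
  assumes "open S" "open T" "g ` S \<subseteq> T" "smooth_on T f" "smooth_on S g" "smooth_on S h"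
  shows "smooth_on S (\<lambda>x. fd f (g x) (h x))"
proof (rule smooth_on_cong[OF assms(1)])
  show "smooth_on S (\<lambda>x. \<Sum>b\<in>Basis. (h x \<bullet> b) *\<^sub>R fd f (g x) b)"
    by (intro smooth_on_sum smooth_on_scaleR assms(1,6)
        smooth_on_bounded_linear[OF assms(1) bounded_linear_inner_left]
        smooth_on_compose[OF assms(1-3) smooth_on_fd[OF assms(4)] assms(5)])
  show "(\<Sum>b\<in>Basis. (h x \<bullet> b) *\<^sub>R fd f (g x) b) = fd f (g x) (h x)" if "x \<in> S" for x
    using that assms(3) by (subst linear_euclidean_expand[OF fd_linear])
      (auto intro!: smooth_on_differentiable[OF assms(4)])
qed

section \<open>Symmetry of second derivatives\<close>

text \<open>The mean value theorem is used twice: along \<open>v\<close> for the increment of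
  \<open>g\<close> in the direction \<open>w\<close>, then along \<open>w\<close> for the derivative
  of \<open>g\<close> in the direction \<open>v\<close>. The second difference is symmetric in
  \<open>v\<close> and \<open>w\<close>, the right-hand side is not; this gives Schwarz's
  theorem.\<close>

lemma second_difference_mvt:
  fixes g :: "'e::real_normed_vector \<Rightarrow> real"
  assumes B: "Ck_on 2 (ball x \<delta>) g" and t: "0 < t" "t * (norm v + norm w) < \<delta>"
  shows "\<exists>p\<in>ball x \<delta>. g (x + t *\<^sub>R v + t *\<^sub>R w) - g (x + t *\<^sub>R v) - g (x + t *\<^sub>R w) + g x
    = t\<^sup>2 * fd (\<lambda>y. fd g y v) p w"
proof -
  let ?B = "ball x \<delta>"
  have inB: "x + s *\<^sub>R v + r *\<^sub>R w \<in> ?B" if "0 \<le> s" "s \<le> t" "0 \<le> r" "r \<le> t" for s r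
  proof -
    have "norm (s *\<^sub>R v + r *\<^sub>R w) \<le> t * (norm v + norm w)"
      using that by (intro norm_triangle_le) (auto simp: distrib_left intro!: add_mono mult_right_mono)
    moreover have "dist x (x + s *\<^sub>R v + r *\<^sub>R w) = norm (s *\<^sub>R v + r *\<^sub>R w)"
      by (metis add.assoc add_diff_cancel_left' dist_commute dist_norm)
    ultimately show ?thesis using t by simp
  qed
  have dg: "(g has_derivative fd g y) (at y)" if "y \<in> ?B" for y
    using B that by (auto simp: numeral_2_eq_2 intro: fd_has_derivative)
  have dgv: "((\<lambda>y. fd g y v) has_derivative fd (\<lambda>y. fd g y v) y) (at y)" if "y \<in> ?B" for y
    using B that by (auto simp: numeral_2_eq_2 intro: fd_has_derivative)
  have lin: "linear (fd g y)" "linear (fd (\<lambda>y. fd g y v) y)" if "y \<in> ?B" for y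
    using has_derivative_linear dg dgv that by blast+
  have d1: "((\<lambda>s. g (x + s *\<^sub>R v + r *\<^sub>R w)) has_real_derivative fd g (x + s *\<^sub>R v + r *\<^sub>R w) v) (at s)"
    if "0 \<le> s" "s \<le> t" "0 \<le> r" "r \<le> t" for s r
  proof -
    have "((\<lambda>s. x + s *\<^sub>R v + r *\<^sub>R w) has_derivative (\<lambda>h. h *\<^sub>R v)) (at s)"
      by (auto intro!: derivative_eq_intros)
    from diff_chain_at[OF this dg[OF inB[OF that]], unfolded o_def] show ?thesis
      by (rule has_derivative_imp_has_field_derivative)
        (simp add: linear_cmul[OF lin(1)[OF inB[OF that]]])
  qed
  have d2: "((\<lambda>r. fd g (x + s *\<^sub>R v + r *\<^sub>R w) v) has_real_derivative
      fd (\<lambda>y. fd g y v) (x + s *\<^sub>R v + r *\<^sub>R w) w) (at r)"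
    if "0 \<le> s" "s \<le> t" "0 \<le> r" "r \<le> t" for s r
  proof -
    have "((\<lambda>r. x + s *\<^sub>R v + r *\<^sub>R w) has_derivative (\<lambda>h. h *\<^sub>R w)) (at r)"
      by (auto intro!: derivative_eq_intros)
    from diff_chain_at[OF this dgv[OF inB[OF that]], unfolded o_def] show ?thesis
      by (rule has_derivative_imp_has_field_derivative)
        (simp add: linear_cmul[OF lin(2)[OF inB[OF that]]])
  qed
  \<comment> \<open>The terms with factor 0 bring all four values of \<open>g\<close> into the shape
    covered by \<open>d1\<close>, with \<open>r = t\<close> and \<open>r = 0\<close>.\<close>
  have "\<exists>s. 0 < s \<and> s < t \<and> (g (x + t *\<^sub>R v + t *\<^sub>R w) - g (x + t *\<^sub>R v + 0 *\<^sub>R w))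
      - (g (x + 0 *\<^sub>R v + t *\<^sub>R w) - g (x + 0 *\<^sub>R v + 0 *\<^sub>R w))
      = (t - 0) * (fd g (x + s *\<^sub>R v + t *\<^sub>R w) v - fd g (x + s *\<^sub>R v + 0 *\<^sub>R w) v)"
    using t(1) by (intro MVT2 DERIV_diff d1) auto
  then obtain s where s: "0 < s" "s < t" "g (x + t *\<^sub>R v + t *\<^sub>R w) - g (x + t *\<^sub>R v) - g (x + t *\<^sub>R w) + g x
      = t * (fd g (x + s *\<^sub>R v + t *\<^sub>R w) v - fd g (x + s *\<^sub>R v + 0 *\<^sub>R w) v)"
    by auto
  have "\<exists>r. 0 < r \<and> r < t \<and> fd g (x + s *\<^sub>R v + t *\<^sub>R w) v - fd g (x + s *\<^sub>R v + 0 *\<^sub>R w) v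
      = (t - 0) * fd (\<lambda>y. fd g y v) (x + s *\<^sub>R v + r *\<^sub>R w) w"
    using t(1) s by (intro MVT2 d2) auto
  then obtain r where r: "0 < r" "r < t" "fd g (x + s *\<^sub>R v + t *\<^sub>R w) v - fd g (x + s *\<^sub>R v + 0 *\<^sub>R w) v
      = t * fd (\<lambda>y. fd g y v) (x + s *\<^sub>R v + r *\<^sub>R w) w"
    by auto
  show ?thesis
    using s r inB[of s r] by (intro bexI[of _ "x + s *\<^sub>R v + r *\<^sub>R w"]) (auto simp: power2_eq_square)
qed

text \<open>The two mixed derivatives, taken at points \<open>p\<close> and \<open>q\<close> near
  \<open>x\<close>, equal the same second difference divided by the square of \<open>t\<close>.
  Continuity at \<open>x\<close> then rules out a gap between them.\<close>

lemma fd_fd_sym_real: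
  fixes g :: "'e::real_normed_vector \<Rightarrow> real"
  assumes "open S" "x \<in> S" "Ck_on 2 S g"
  shows "fd (\<lambda>y. fd g y v) x w = fd (\<lambda>y. fd g y w) x v"
proof (rule ccontr)
  let ?a = "\<lambda>y. fd (\<lambda>y. fd g y v) y w" and ?b = "\<lambda>y. fd (\<lambda>y. fd g y w) y v"
  assume ne: "?a x \<noteq> ?b x"
  \<comment> \<open>Half of the assumed gap: the common value \<open>?a p = ?b q\<close> lies within
    less than \<epsilon> of both \<open>?a x\<close> and \<open>?b x\<close>, so the gap would be
    smaller than itself.\<close>
  define \<epsilon> where "\<epsilon> = \<bar>?a x - ?b x\<bar> / 2"
  have \<epsilon>: "\<epsilon> > 0" using ne by (simp add: \<epsilon>_def)
  have "continuous_on S ?a" "continuous_on S ?b"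
    using assms(3) by (auto simp: numeral_2_eq_2)
  then have "isCont ?a x" "isCont ?b x"
    using assms(1,2) continuous_on_eq_continuous_at by blast+
  then obtain d1 d2 where d: "d1 > 0" "\<And>y. dist y x < d1 \<Longrightarrow> dist (?a y) (?a x) < \<epsilon>"
    "d2 > 0" "\<And>y. dist y x < d2 \<Longrightarrow> dist (?b y) (?b x) < \<epsilon>"
    unfolding continuous_at_eps_delta using \<epsilon> by blast
  obtain d3 where d3: "d3 > 0" "ball x d3 \<subseteq> S" using assms openE by blast
  define \<delta> where "\<delta> = min d1 (min d2 d3)"
  have \<delta>: "\<delta> > 0" "Ck_on 2 (ball x \<delta>) g"
    using d d3 by (auto simp: \<delta>_def intro!: Ck_on_subset[OF assms(3)])
  \<comment> \<open>The summand 1 prevents division by 0 if \<open>v\<close> and \<open>w\<close>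
    vanish and makes the bound of \<open>second_difference_mvt\<close> strict.\<close>
  define t where "t = \<delta> / (norm v + norm w + 1)"
  have pos: "norm v + norm w + 1 > 0" by (simp add: add_nonneg_pos)
  have t: "t > 0" using \<delta> pos by (simp add: t_def)
  have "t * (norm v + norm w + 1) = \<delta>" using pos by (simp add: t_def)
  then have t': "t * (norm v + norm w) < \<delta>" "t * (norm w + norm v) < \<delta>"
    using t by (auto simp: algebra_simps)
  obtain p where p: "p \<in> ball x \<delta>"
    "g (x + t *\<^sub>R v + t *\<^sub>R w) - g (x + t *\<^sub>R v) - g (x + t *\<^sub>R w) + g x = t\<^sup>2 * ?a p"
    using second_difference_mvt[OF \<delta>(2) t t'(1)] by blast
  obtain q where q: "q \<in> ball x \<delta>"
    "g (x + t *\<^sub>R w + t *\<^sub>R v) - g (x + t *\<^sub>R w) - g (x + t *\<^sub>R v) + g x = t\<^sup>2 * ?b q"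
    using second_difference_mvt[OF \<delta>(2) t t'(2)] by blast
  have "t\<^sup>2 * ?a p = t\<^sup>2 * ?b q" using p(2) q(2) by (simp add: algebra_simps)
  then have "?a p = ?b q" using t by simp
  moreover have "dist (?a p) (?a x) < \<epsilon>" "dist (?b q) (?b x) < \<epsilon>"
    using p(1) q(1) d by (auto simp: \<delta>_def dist_commute)
  ultimately show False unfolding \<epsilon>_def dist_real_def by (simp add: abs_if split: if_splits)
qed

lemma fd_fd_sym:
  fixes f :: "'e::real_normed_vector \<Rightarrow> 'f::euclidean_space"
  assumes "open S" "x \<in> S" "smooth_on S f"
  shows "fd (\<lambda>y. fd f y v) x w = fd (\<lambda>y. fd f y w) x v"
proof (rule euclidean_eqI)
  fix b :: 'f
  note bl = bounded_linear_inner_left[of b]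
  have *: "fd (\<lambda>y. fd f y v) x w \<bullet> b = fd (\<lambda>y. fd (\<lambda>y. f y \<bullet> b) y v) x w" for v w
  proof -
    have "fd (\<lambda>y. fd f y v) x w \<bullet> b = fd (\<lambda>y. fd f y v \<bullet> b) x w"
      using fd_bounded_linear[OF bl smooth_on_differentiable[OF smooth_on_fd[OF assms(3)] assms(2)]]
      by metis
    also have "fd (\<lambda>y. fd f y v \<bullet> b) x = fd (\<lambda>y. fd (\<lambda>y. f y \<bullet> b) y v) x"
      using fd_bounded_linear[OF bl smooth_on_differentiable[OF assms(3)]]
      by (intro fd_cong_open[OF assms(1,2)]) metis
    finally show ?thesis .
  qed
  have "Ck_on 2 S (\<lambda>y. f y \<bullet> b)"
    using smooth_on_bounded_linear[OF assms(1) bl assms(3)] by (simp add: smooth_on_def)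
  then show "fd (\<lambda>y. fd f y v) x w \<bullet> b = fd (\<lambda>y. fd f y w) x v \<bullet> b"
    using * fd_fd_sym_real[OF assms(1,2)] by metis
qed

text \<open>Product rule for the pairing of the derivative of \<open>f\<close> with a moving
  direction, obtained from the basis expansion. The first summand freezes the direction at
  \<open>g x\<close> and is a second derivative of \<open>f\<close>, so \<open>fd_fd_sym\<close>
  applies to it.\<close>

lemma fd_fd_apply:
  fixes f :: "'e::euclidean_space \<Rightarrow> 'f::real_normed_vector"
  assumes "open S" "x \<in> S" "smooth_on S f" "g differentiable (at x)"
  shows "(\<lambda>y. fd f y (g y)) differentiable (at x)" (is ?d)
    and "fd (\<lambda>y. fd f y (g y)) x v = fd (\<lambda>y. fd f y (g x)) x v + fd f x (fd g x v)"
proof -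
  let ?h = "\<lambda>y. \<Sum>b\<in>Basis. (g y \<bullet> b) *\<^sub>R fd f y b"
  have ex: "fd f y u = (\<Sum>b\<in>Basis. (u \<bullet> b) *\<^sub>R fd f y b)" if "y \<in> S" for y u
    using that by (intro linear_euclidean_expand fd_linear smooth_on_differentiable[OF assms(3)])
  have d: "((\<lambda>y. fd f y b) has_derivative fd (\<lambda>y. fd f y b) x) (at x)" for b
    by (intro fd_has_derivative smooth_on_differentiable[OF smooth_on_fd[OF assms(3)] assms(2)])
  have h: "(?h has_derivative (\<lambda>v. \<Sum>b\<in>Basis. (g x \<bullet> b) *\<^sub>R fd (\<lambda>y. fd f y b) x v
      + (fd g x v \<bullet> b) *\<^sub>R fd f x b)) (at x)"
    by (intro has_derivative_sum has_derivative_scaleR d has_derivative_inner_left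
        fd_has_derivative assms(4))
  then have h': "((\<lambda>y. fd f y (g y)) has_derivative (\<lambda>v. \<Sum>b\<in>Basis. (g x \<bullet> b) *\<^sub>R fd (\<lambda>y. fd f y b) x v
      + (fd g x v \<bullet> b) *\<^sub>R fd f x b)) (at x)"
    using has_derivative_transform_within_open[OF h assms(1,2), of "\<lambda>y. fd f y (g y)"] ex by metis
  then show ?d by (rule differentiableI)
  have c: "((\<lambda>y. \<Sum>b\<in>Basis. (g x \<bullet> b) *\<^sub>R fd f y b) has_derivative
      (\<lambda>v. \<Sum>b\<in>Basis. (g x \<bullet> b) *\<^sub>R fd (\<lambda>y. fd f y b) x v)) (at x)"
    by (intro has_derivative_sum has_derivative_scaleR_right d)
  have "fd (\<lambda>y. fd f y (g x)) x = fd (\<lambda>y. \<Sum>b\<in>Basis. (g x \<bullet> b) *\<^sub>R fd f y b) x"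
    using ex by (intro fd_cong_open[OF assms(1,2)]) metis
  with fd_eqI[OF c] have "fd (\<lambda>y. fd f y (g x)) x = (\<lambda>v. \<Sum>b\<in>Basis. (g x \<bullet> b) *\<^sub>R fd (\<lambda>y. fd f y b) x v)"
    by metis
  then show "fd (\<lambda>y. fd f y (g y)) x v = fd (\<lambda>y. fd f y (g x)) x v + fd f x (fd g x v)"
    using fd_eqI[OF h'] ex[OF assms(2), of "fd g x v"] by (simp add: sum.distrib)
qed

section \<open>Smooth atlases\<close>

text \<open>Compatibility of charts, without a topology on the points. The base, its tangent bundle
  and its slit bundle are all given by charts, so each is an instance and the calculus of fields is
  developed once.\<close>

locale smooth_atlas =
  fixes N :: "('a, 'e::euclidean_space) chart set"
  assumes chart_inj: "c \<in> N \<Longrightarrow> inj_on (snd c) (fst c)"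
    and overlap_open: "c \<in> N \<Longrightarrow> d \<in> N \<Longrightarrow> open (snd c ` (fst c \<inter> fst d))"
    and trans_smooth: "c \<in> N \<Longrightarrow> d \<in> N \<Longrightarrow> smooth_on (snd c ` (fst c \<inter> fst d)) (snd d \<circ> chart_inv c)"

lemma charts_at_iff: "c \<in> charts_at N p \<longleftrightarrow> c \<in> N \<and> p \<in> fst c"
  by (auto simp: charts_at_def)

lemma pts_iff: "p \<in> pts N \<longleftrightarrow> (\<exists>c. c \<in> charts_at N p)"
  unfolding pts_def charts_at_def by blast

lemma charts_at_pts: "c \<in> charts_at N p \<Longrightarrow> p \<in> pts N"
  unfolding pts_iff by blast

lemma chart_inv_in: "x \<in> snd c ` S \<Longrightarrow> S \<subseteq> fst c \<Longrightarrow> chart_inv c x \<in> fst c"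
  unfolding chart_inv_def by (rule inv_into_into) auto

lemma snd_chart_inv: "x \<in> snd c ` S \<Longrightarrow> S \<subseteq> fst c \<Longrightarrow> snd c (chart_inv c x) = x"
  unfolding chart_inv_def by (rule f_inv_into_f) auto

text \<open>\<open>c\<close> is the chart in which components are read, \<open>d\<close> the chart
  that provides the coordinates. They differ for a \<pi>-vector field, whose values are tangent to
  the base while its argument runs through the slit bundle.\<close>

abbreviation coords :: "('a, 'e) chart \<Rightarrow> ('b \<Rightarrow> ('a, 'e) chart \<Rightarrow> 'f) \<Rightarrow> ('b, 'g) chart \<Rightarrow> 'g \<Rightarrow> 'f" where
  "coords c A d \<equiv> \<lambda>x. A (chart_inv d x) c"

text \<open>Smoothness is demanded on the whole image of every chart, so that a bracket can be
  computed in whichever chart is at hand.\<close>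

definition smooth_vf :: "('a, 'e::euclidean_space) chart set \<Rightarrow> ('a \<Rightarrow> ('a, 'e) tvec) \<Rightarrow> bool" where
  "smooth_vf N A \<longleftrightarrow> (\<forall>p\<in>pts N. A p \<in> tangent_space N p) \<and>
     (\<forall>c\<in>N. smooth_on (snd c ` fst c) (coords c A c))"

context smooth_atlas
begin

lemma image_open: "c \<in> N \<Longrightarrow> open (snd c ` fst c)"
  using overlap_open[of c c] by simp

lemma chart_inv_snd: "c \<in> N \<Longrightarrow> p \<in> fst c \<Longrightarrow> chart_inv c (snd c p) = p"
  unfolding chart_inv_def by (simp add: chart_inj)

lemma chart_inv_overlap:
  assumes "c \<in> N" "x \<in> snd c ` (fst c \<inter> fst d)"
  shows "chart_inv c x \<in> fst c \<inter> fst d"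
  using assms by (auto simp: chart_inv_snd)

lemma trans_overlap:
  assumes "c \<in> N" "d \<in> N" "x \<in> snd c ` (fst c \<inter> fst d)"
  shows "snd d (chart_inv c x) \<in> snd d ` (fst d \<inter> fst c)"
    and "chart_inv d (snd d (chart_inv c x)) = chart_inv c x"
  using chart_inv_overlap[OF assms(1,3)] chart_inv_snd[OF assms(2)] by auto

lemma trans_differentiable:
  assumes "c \<in> charts_at N p" "d \<in> charts_at N p"
  shows "(snd d \<circ> chart_inv c) differentiable (at (snd c p))"
  using assms by (intro smooth_on_differentiable[OF trans_smooth]) (auto simp: charts_at_iff)

text \<open>Over the overlap \<open>g \<circ> chart_inv c\<close> factors through the coordinate
  change. The factorization may fail elsewhere, so the chain rule is transferred on the open image
  of the overlap.\<close>

lemma fd_chart_change: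
  assumes c: "c \<in> charts_at N p" and d: "d \<in> charts_at N p"
    and g: "(g \<circ> chart_inv d) differentiable (at (snd d p))"
  shows "(g \<circ> chart_inv c) differentiable (at (snd c p))"
    and "fd (g \<circ> chart_inv c) (snd c p) v =
      fd (g \<circ> chart_inv d) (snd d p) (fd (snd d \<circ> chart_inv c) (snd c p) v)"
proof -
  have cd: "c \<in> N" "d \<in> N" "p \<in> fst c" "p \<in> fst d" using c d by (auto simp: charts_at_iff)
  let ?O = "snd c ` (fst c \<inter> fst d)"
  have O: "open ?O" "snd c p \<in> ?O" using cd overlap_open by auto
  have p: "snd d p = (snd d \<circ> chart_inv c) (snd c p)" using cd by (simp add: chart_inv_snd)
  have eq: "(g \<circ> chart_inv d) ((snd d \<circ> chart_inv c) x) = (g \<circ> chart_inv c) x" if "x \<in> ?O" for x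
    using trans_overlap(2)[OF cd(1,2) that] by simp
  note g' = g[unfolded p]
  note tr = trans_differentiable[OF c d]
  show "(g \<circ> chart_inv c) differentiable (at (snd c p))"
    by (rule differentiable_cong_open[OF O eq differentiable_compose_at[OF tr g']])
  show "fd (g \<circ> chart_inv c) (snd c p) v =
      fd (g \<circ> chart_inv d) (snd d p) (fd (snd d \<circ> chart_inv c) (snd c p) v)"
    unfolding p by (rule trans[OF fun_cong[OF fd_cong_open[OF O eq[symmetric]]] fun_cong[OF fd_compose[OF tr g']]])
qed

lemma fd_trans_self:
  assumes "c \<in> charts_at N p"
  shows "fd (snd c \<circ> chart_inv c) (snd c p) v = v"
proof -
  have cd: "c \<in> N" "p \<in> fst c" using assms by (auto simp: charts_at_iff)
  have "fd (snd c \<circ> chart_inv c) (snd c p) = fd (\<lambda>x. x) (snd c p)"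
    using cd by (intro fd_cong_open[OF image_open[OF cd(1)]]) (auto simp: chart_inv_snd)
  then show ?thesis by simp
qed

lemma fd_trans_trans:
  assumes "c \<in> charts_at N p" "d \<in> charts_at N p" "e \<in> charts_at N p"
  shows "fd (snd e \<circ> chart_inv c) (snd c p) v =
    fd (snd e \<circ> chart_inv d) (snd d p) (fd (snd d \<circ> chart_inv c) (snd c p) v)"
  by (rule fd_chart_change(2)[OF assms(1,2) trans_differentiable[OF assms(2,3)]])

section \<open>Tangent vectors in charts\<close>

lemma tangent_trans:
  "v \<in> tangent_space N p \<Longrightarrow> c \<in> charts_at N p \<Longrightarrow> d \<in> charts_at N p \<Longrightarrow>
    v d = fd (snd d \<circ> chart_inv c) (snd c p) (v c)"
  unfolding tangent_space_def by blast

lemma tangent_outside: "v \<in> tangent_space N p \<Longrightarrow> c \<notin> charts_at N p \<Longrightarrow> v c = 0"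
  unfolding tangent_space_def by blast

lemma tangent_eqI:
  assumes "v \<in> tangent_space N p" "w \<in> tangent_space N p" "c \<in> charts_at N p" "v c = w c"
  shows "v = w"
proof
  fix d
  show "v d = w d"
  proof (cases "d \<in> charts_at N p")
    case True
    then show ?thesis
      using tangent_trans[OF assms(1,3) True] tangent_trans[OF assms(2,3) True] assms(4) by simp
  next
    case False
    then show ?thesis using assms(1,2) tangent_outside by metis
  qed
qed

text \<open>By the cocycle rule \<open>fd_trans_trans\<close>, the transformation law out of one
  reference chart \<open>c\<close> forces the law between any two charts.\<close>

lemma tangentI:
  assumes "c \<in> charts_at N p" "\<And>d. d \<notin> charts_at N p \<Longrightarrow> v d = 0"
    and "\<And>d. d \<in> charts_at N p \<Longrightarrow> v d = fd (snd d \<circ> chart_inv c) (snd c p) (v c)"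
  shows "v \<in> tangent_space N p"
  unfolding tangent_space_def using assms fd_trans_trans[OF assms(1)] by (smt (verit) mem_Collect_eq)

lemma tangent_exists:
  assumes "c \<in> charts_at N p"
  shows "\<exists>v\<in>tangent_space N p. v c = w"
proof -
  define v where "v = (\<lambda>d. if d \<in> charts_at N p then fd (snd d \<circ> chart_inv c) (snd c p) w else 0)"
  have c: "v c = w" using assms fd_trans_self by (simp add: v_def)
  have "v \<in> tangent_space N p"
  proof (rule tangentI[OF assms])
    show "v d = fd (snd d \<circ> chart_inv c) (snd c p) (v c)" if "d \<in> charts_at N p" for d
      unfolding c using that by (simp add: v_def)
  qed (simp add: v_def)
  with c show ?thesis by blast
qed

lemma tangent_spaceI:
  assumes "\<And>c. c \<notin> charts_at N p \<Longrightarrow> v c = 0"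
    and "\<And>c d. c \<in> charts_at N p \<Longrightarrow> d \<in> charts_at N p \<Longrightarrow>
      v d = fd (snd d \<circ> chart_inv c) (snd c p) (v c)"
  shows "v \<in> tangent_space N p"
  unfolding tangent_space_def using assms by blast

lemma tangent_zero: "0 \<in> tangent_space N p"
proof (rule tangent_spaceI)
  fix c d assume "c \<in> charts_at N p" "d \<in> charts_at N p"
  note lin = fd_linear[OF trans_differentiable[OF this]]
  show "0 d = fd (snd d \<circ> chart_inv c) (snd c p) (0 c)"
    using linear_0[OF lin] by simp
qed simp

lemma tangent_add:
  assumes v: "v \<in> tangent_space N p" and w: "w \<in> tangent_space N p"
  shows "v + w \<in> tangent_space N p"
proof (rule tangent_spaceI)
  show "(v + w) c = 0" if "c \<notin> charts_at N p" for c
    using tangent_outside[OF v that] tangent_outside[OF w that] by simp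
  fix c d assume cd: "c \<in> charts_at N p" "d \<in> charts_at N p"
  show "(v + w) d = fd (snd d \<circ> chart_inv c) (snd c p) ((v + w) c)"
    using tangent_trans[OF v cd] tangent_trans[OF w cd] linear_add[OF fd_linear[OF trans_differentiable[OF cd]]]
    by simp
qed

lemma tangent_scale:
  assumes v: "v \<in> tangent_space N p"
  shows "tscale r v \<in> tangent_space N p"
proof (rule tangent_spaceI)
  show "tscale r v c = 0" if "c \<notin> charts_at N p" for c
    using tangent_outside[OF v that] by (simp add: tscale_def)
  fix c d assume cd: "c \<in> charts_at N p" "d \<in> charts_at N p"
  show "tscale r v d = fd (snd d \<circ> chart_inv c) (snd c p) (tscale r v c)"
    using tangent_trans[OF v cd] linear_cmul[OF fd_linear[OF trans_differentiable[OF cd]]]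
    by (simp add: tscale_def)
qed

lemma tangent_uminus: "v \<in> tangent_space N p \<Longrightarrow> - v \<in> tangent_space N p"
  using tangent_scale[of v p "-1"] by (simp add: tscale_def fun_Compl_def)

lemma tangent_diff:
  "v \<in> tangent_space N p \<Longrightarrow> w \<in> tangent_space N p \<Longrightarrow> v - w \<in> tangent_space N p"
  using tangent_add[OF _ tangent_uminus] by fastforce

text \<open>\<open>tderiv\<close> is computed in some chosen chart. Passing to \<open>c\<close>
  changes the representation of \<open>g\<close> by the chain rule, and the transformation law of
  \<open>v\<close> absorbs the extra factor.\<close>

lemma tderiv_chart:
  assumes v: "v \<in> tangent_space N p" and c: "c \<in> charts_at N p"
    and g: "(g \<circ> chart_inv c) differentiable (at (snd c p))"
  shows "tderiv N p v g = fd (g \<circ> chart_inv c) (snd c p) (v c)"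
proof -
  define d where "d = (SOME c. c \<in> charts_at N p)"
  have d: "d \<in> charts_at N p" unfolding d_def using c by (rule someI)
  have "tderiv N p v g = fd (g \<circ> chart_inv d) (snd d p) (v d)"
    unfolding tderiv_def d_def by (simp add: Let_def)
  also have "\<dots> = fd (g \<circ> chart_inv c) (snd c p) (fd (snd c \<circ> chart_inv d) (snd d p) (v d))"
    by (rule fd_chart_change(2)[OF d c g])
  also have "fd (snd c \<circ> chart_inv d) (snd d p) (v d) = v c"
    using tangent_trans[OF v d c] by simp
  finally show ?thesis .
qed

lemma tderiv_coord:
  assumes "v \<in> tangent_space N p" "c \<in> charts_at N p"
  shows "tderiv N p v (snd c) = v c"
  using tderiv_chart[OF assms trans_differentiable] fd_trans_self assms(2) by simp

section \<open>Vector fields and the Lie bracket\<close>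

lemma smooth_vf_tangent: "smooth_vf N A \<Longrightarrow> c \<in> charts_at N p \<Longrightarrow> A p \<in> tangent_space N p"
  unfolding smooth_vf_def using charts_at_pts by metis

lemma smooth_vf_coords: "smooth_vf N A \<Longrightarrow> c \<in> N \<Longrightarrow> smooth_on (snd c ` fst c) (coords c A c)"
  unfolding smooth_vf_def by blast

lemma smooth_vf_differentiable:
  "smooth_vf N A \<Longrightarrow> c \<in> charts_at N p \<Longrightarrow> coords c A c differentiable (at (snd c p))"
  by (rule smooth_on_differentiable[OF smooth_vf_coords]) (auto simp: charts_at_iff)

lemma smooth_vfI:
  assumes "\<And>p. p \<in> pts N \<Longrightarrow> A p \<in> tangent_space N p"
    and "\<And>c. c \<in> N \<Longrightarrow> smooth_on (snd c ` fst c) (coords c A c)"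
  shows "smooth_vf N A"
  unfolding smooth_vf_def using assms by blast

lemma smooth_vf_tangent_pts: "smooth_vf N A \<Longrightarrow> p \<in> pts N \<Longrightarrow> A p \<in> tangent_space N p"
  unfolding smooth_vf_def by blast

lemma smooth_vf_add: "smooth_vf N A \<Longrightarrow> smooth_vf N B \<Longrightarrow> smooth_vf N (A + B)"
  by (rule smooth_vfI)
    (simp_all add: tangent_add smooth_vf_tangent_pts smooth_on_add image_open smooth_vf_coords)

lemma coords_trans:
  assumes "smooth_vf N A" "c \<in> N" "d \<in> N" "x \<in> snd c ` (fst c \<inter> fst d)"
  shows "coords d A d ((snd d \<circ> chart_inv c) x) = fd (snd d \<circ> chart_inv c) x (coords c A c x)"
proof -
  let ?p = "chart_inv c x"
  have p: "c \<in> charts_at N ?p" "d \<in> charts_at N ?p"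
    using chart_inv_overlap[OF assms(2,4)] assms(2,3) by (auto simp: charts_at_iff)
  have "snd c ?p = x" using snd_chart_inv[OF assms(4)] by simp
  then show ?thesis
    using tangent_trans[OF smooth_vf_tangent[OF assms(1) p(1)] p] trans_overlap(2)[OF assms(2-4)]
    by simp
qed

text \<open>The inner derivative of the chart map along \<open>B\<close> is the component of
  \<open>B\<close> throughout the chart domain, hence it may be replaced before the outer
  differentiation.\<close>

lemma bracket_coords:
  assumes A: "smooth_vf N A" and B: "smooth_vf N B" and c: "c \<in> charts_at N p"
  shows "lie_bracket N A B p c =
    fd (coords c B c) (snd c p) (A p c) - fd (coords c A c) (snd c p) (B p c)"
proof -
  have c': "c \<in> N" "p \<in> fst c" using c by (auto simp: charts_at_iff)
  have "tderiv N p (A p) (\<lambda>q. tderiv N q (B q) (snd c)) = fd (coords c B c) (snd c p) (A p c)"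
    if A: "smooth_vf N A" and B: "smooth_vf N B" for A B
  proof -
    have eq: "coords c B c x = ((\<lambda>q. tderiv N q (B q) (snd c)) \<circ> chart_inv c) x" if "x \<in> snd c ` fst c" for x
      using that c' B by (auto simp: tderiv_coord smooth_vf_tangent charts_at_iff chart_inv_snd)
    note O = image_open[OF c'(1)] imageI[OF c'(2), of "snd c"]
    note d = smooth_vf_differentiable[OF B c]
    have "tderiv N p (A p) (\<lambda>q. tderiv N q (B q) (snd c))
        = fd ((\<lambda>q. tderiv N q (B q) (snd c)) \<circ> chart_inv c) (snd c p) (A p c)"
      by (intro tderiv_chart smooth_vf_tangent[OF A c] c differentiable_cong_open[OF O eq d])
    also have "\<dots> = fd (coords c B c) (snd c p) (A p c)"
      by (rule fun_cong[OF fd_cong_open[OF O eq[symmetric]]])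
    finally show ?thesis .
  qed
  then show ?thesis using A B c by (simp add: lie_bracket_def)
qed

lemma bracket_coords_on:
  assumes A: "smooth_vf N A" and B: "smooth_vf N B" and c: "c \<in> N" and x: "x \<in> snd c ` fst c"
  shows "coords c (lie_bracket N A B) c x =
    fd (coords c B c) x (coords c A c x) - fd (coords c A c) x (coords c B c x)"
  using bracket_coords[OF A B, of c "chart_inv c x"] chart_inv_in[OF x] snd_chart_inv[OF x] c
  by (simp add: charts_at_iff)

text \<open>The second derivatives of the coordinate change cancel by symmetry.\<close>

lemma bracket_tangent:
  assumes A: "smooth_vf N A" and B: "smooth_vf N B" and p: "p \<in> pts N"
  shows "lie_bracket N A B p \<in> tangent_space N p"
proof -
  obtain c where c: "c \<in> charts_at N p" using p unfolding pts_iff by blast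
  show ?thesis
  proof (rule tangentI[OF c])
    show "lie_bracket N A B p d = 0" if "d \<notin> charts_at N p" for d
      using that by (simp add: lie_bracket_def)
    fix d assume d: "d \<in> charts_at N p"
    have cd: "c \<in> N" "d \<in> N" "p \<in> fst c" "p \<in> fst d" using c d by (auto simp: charts_at_iff)
    define \<tau> where "\<tau> = snd d \<circ> chart_inv c"
    let ?O = "snd c ` (fst c \<inter> fst d)"
    let ?x = "snd c p"
    have O: "open ?O" "?x \<in> ?O" using cd overlap_open by auto
    have \<tau>x: "snd d p = \<tau> ?x" using cd by (simp add: \<tau>_def chart_inv_snd)
    have \<tau>s: "smooth_on ?O \<tau>" unfolding \<tau>_def by (rule trans_smooth[OF cd(1,2)])
    have \<tau>d: "\<tau> differentiable (at ?x)" using smooth_on_differentiable[OF \<tau>s O(2)] .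
    \<comment> \<open>The transformation law \<open>coords_trans\<close> of \<open>B\<close>,
      differentiated along \<open>A\<close>. The first summand is the non-tensorial one.\<close>
    have key: "fd (coords d B d) (snd d p) (A p d)
        = fd (\<lambda>y. fd \<tau> y (B p c)) ?x (A p c) + fd \<tau> ?x (fd (coords c B c) ?x (A p c))"
      if A: "smooth_vf N A" and B: "smooth_vf N B" for A B
    proof -
      have Bx: "coords c B c ?x = B p c" using cd by (simp add: chart_inv_snd)
      have "fd (coords d B d) (snd d p) (A p d) = fd (coords d B d) (\<tau> ?x) (fd \<tau> ?x (A p c))"
        using tangent_trans[OF smooth_vf_tangent[OF A c] c d] by (simp add: \<tau>x flip: \<tau>_def)
      also have "\<dots> = fd (\<lambda>x. coords d B d (\<tau> x)) ?x (A p c)"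
        using fd_compose[OF \<tau>d smooth_vf_differentiable[OF B d, unfolded \<tau>x]] by simp
      also have "\<dots> = fd (\<lambda>x. fd \<tau> x (coords c B c x)) ?x (A p c)"
        using coords_trans[OF B cd(1,2)] fd_cong_open[OF O, of "\<lambda>x. coords d B d (\<tau> x)" "\<lambda>x. fd \<tau> x (coords c B c x)"]
        by (simp add: \<tau>_def)
      also have "\<dots> = fd (\<lambda>y. fd \<tau> y (B p c)) ?x (A p c) + fd \<tau> ?x (fd (coords c B c) ?x (A p c))"
        using fd_fd_apply(2)[OF O \<tau>s smooth_vf_differentiable[OF B c], of "A p c"] unfolding Bx .
      finally show ?thesis .
    qed
    show "lie_bracket N A B p d = fd (snd d \<circ> chart_inv c) (snd c p) (lie_bracket N A B p c)"
      using key[OF A B] key[OF B A] fd_fd_sym[OF O \<tau>s, of "A p c" "B p c"]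
      by (simp add: bracket_coords[OF A B c] bracket_coords[OF A B d] linear_diff[OF fd_linear[OF \<tau>d]]
          flip: \<tau>_def)
  qed
qed

lemma bracket_smooth_vf:
  assumes A: "smooth_vf N A" and B: "smooth_vf N B"
  shows "smooth_vf N (lie_bracket N A B)"
  unfolding smooth_vf_def
proof (intro conjI ballI)
  show "lie_bracket N A B p \<in> tangent_space N p" if "p \<in> pts N" for p
    using bracket_tangent[OF A B that] .
  fix c assume c: "c \<in> N"
  note O = image_open[OF c]
  note s = smooth_vf_coords[OF _ c]
  show "smooth_on (snd c ` fst c) (coords c (lie_bracket N A B) c)"
  proof (rule smooth_on_cong[OF O])
    show "smooth_on (snd c ` fst c)
        (\<lambda>x. fd (coords c B c) x (coords c A c x) - fd (coords c A c) x (coords c B c x))"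
      by (intro smooth_on_diff[OF O] smooth_on_fd_apply[OF O O] s A B smooth_on_ident O) auto
  qed (simp add: bracket_coords_on[OF A B c])
qed

lemma bracket_antisym: "lie_bracket N A B = - lie_bracket N B A"
  by (intro ext) (auto simp: lie_bracket_def)

lemma bracket_add_right:
  assumes A: "smooth_vf N A" and B: "smooth_vf N B" and B': "smooth_vf N B'"
  shows "lie_bracket N A (B + B') p = lie_bracket N A B p + lie_bracket N A B' p"
proof
  fix c
  show "lie_bracket N A (B + B') p c = (lie_bracket N A B p + lie_bracket N A B' p) c"
  proof (cases "c \<in> charts_at N p")
    case True
    note d = smooth_vf_differentiable[OF _ True]
    show ?thesis
      using fd_add[OF d[OF B] d[OF B']] linear_add[OF fd_linear[OF d[OF A]]]
      by (simp add: bracket_coords[OF A smooth_vf_add[OF B B'] True]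
          bracket_coords[OF A B True] bracket_coords[OF A B' True])
  qed (simp add: lie_bracket_def)
qed

lemma bracket_cong:
  assumes A: "smooth_vf N A" "smooth_vf N A'" "\<And>q. q \<in> pts N \<Longrightarrow> A q = A' q"
    and B: "smooth_vf N B" "smooth_vf N B'" "\<And>q. q \<in> pts N \<Longrightarrow> B q = B' q"
  shows "lie_bracket N A B p = lie_bracket N A' B' p"
proof
  fix c
  show "lie_bracket N A B p c = lie_bracket N A' B' p c"
  proof (cases "c \<in> charts_at N p")
    case True
    then have c: "c \<in> N" "p \<in> fst c" "p \<in> pts N" by (auto simp: charts_at_iff pts_def)
    have "fd (coords c A c) (snd c p) = fd (coords c A' c) (snd c p)"
      "fd (coords c B c) (snd c p) = fd (coords c B' c) (snd c p)"
      using c A(3) B(3) chart_inv_in[of _ c "fst c"]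
      by (intro fd_cong_open[OF image_open[OF c(1)]]; force simp: pts_def)+
    then show ?thesis
      using c A(3) B(3) by (simp add: bracket_coords[OF A(1) B(1) True] bracket_coords[OF A(2) B(2) True])
  qed (simp add: lie_bracket_def)
qed

text \<open>In a chart a double bracket consists of second derivatives of one field along two others
  and of nested first derivatives. The nested ones cancel in the cyclic sum as they stand, the
  second derivatives after their directions are exchanged by \<open>fd_fd_sym\<close>.\<close>

lemma jacobi:
  assumes A: "smooth_vf N A" and B: "smooth_vf N B" and C: "smooth_vf N C"
  shows "lie_bracket N A (lie_bracket N B C) p + lie_bracket N B (lie_bracket N C A) p
    + lie_bracket N C (lie_bracket N A B) p = 0"
proof
  fix c
  show "(lie_bracket N A (lie_bracket N B C) p + lie_bracket N B (lie_bracket N C A) p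
    + lie_bracket N C (lie_bracket N A B) p) c = 0 c"
  proof (cases "c \<in> charts_at N p")
    case True
    then have c: "c \<in> N" "p \<in> fst c" by (auto simp: charts_at_iff)
    note O = image_open[OF c(1)] imageI[OF c(2), of "snd c"]
    let ?x = "snd c p"
    let ?D2 = "\<lambda>B v w. fd (\<lambda>y. fd (coords c B c) y v) ?x w"
    note s = smooth_vf_coords[OF _ c(1)]
    note d = smooth_vf_differentiable[OF _ True]
    note lin = linear_diff[OF fd_linear[OF d]]
    have px: "coords c A c ?x = A p c" for A :: "'a \<Rightarrow> ('a, 'e) tvec" using c by (simp add: chart_inv_snd)
    have two: "lie_bracket N A (lie_bracket N B C) p c
      = ?D2 C (B p c) (A p c) + fd (coords c C c) ?x (fd (coords c B c) ?x (A p c))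
      - (?D2 B (C p c) (A p c) + fd (coords c B c) ?x (fd (coords c C c) ?x (A p c)))
      - (fd (coords c A c) ?x (fd (coords c C c) ?x (B p c)) - fd (coords c A c) ?x (fd (coords c B c) ?x (C p c)))"
      if A: "smooth_vf N A" and B: "smooth_vf N B" and C: "smooth_vf N C" for A B C
    proof -
      have "fd (coords c (lie_bracket N B C) c) ?x
        = fd (\<lambda>x. fd (coords c C c) x (coords c B c x) - fd (coords c B c) x (coords c C c x)) ?x"
        by (rule fd_cong_open[OF O bracket_coords_on[OF B C c(1)]])
      then have "fd (coords c (lie_bracket N B C) c) ?x (A p c)
        = fd (\<lambda>x. fd (coords c C c) x (coords c B c x)) ?x (A p c)
          - fd (\<lambda>x. fd (coords c B c) x (coords c C c x)) ?x (A p c)"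
        using fd_diff[OF fd_fd_apply(1)[OF O s[OF C] d[OF B]] fd_fd_apply(1)[OF O s[OF B] d[OF C]]] by simp
      also have "\<dots> = ?D2 C (B p c) (A p c) + fd (coords c C c) ?x (fd (coords c B c) ?x (A p c))
      - (?D2 B (C p c) (A p c) + fd (coords c B c) ?x (fd (coords c C c) ?x (A p c)))"
        using fd_fd_apply(2)[OF O s[OF C] d[OF B], of "A p c"] fd_fd_apply(2)[OF O s[OF B] d[OF C], of "A p c"]
        unfolding px by simp
      finally show ?thesis
        unfolding bracket_coords[OF A bracket_smooth_vf[OF B C] True] bracket_coords[OF B C True] lin[OF A]
        by simp
    qed
    show ?thesis
      using fd_fd_sym[OF O s[OF A], of "B p c" "C p c"] fd_fd_sym[OF O s[OF B], of "C p c" "A p c"]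
        fd_fd_sym[OF O s[OF C], of "A p c" "B p c"]
      by (simp add: two[OF A B C] two[OF B C A] two[OF C A B])
  qed (simp add: lie_bracket_def)
qed

end

text \<open>\<open>smooth_map\<close> only provides some charts around each point. Coordinate
  changes before and after \<open>F\<close> carry smoothness over to the prescribed charts, one
  neighbourhood at a time.\<close>

lemma smooth_map_chart:
  fixes \<A> :: "('a, 'e::euclidean_space) chart set" and \<B> :: "('b, 'f::euclidean_space) chart set"
  assumes \<A>: "smooth_atlas \<A>" and \<B>: "smooth_atlas \<B>" and F: "smooth_map \<A> \<B> F"
    and c: "c \<in> \<A>" and d: "d \<in> \<B>" and Fcd: "F ` fst c \<subseteq> fst d"
  shows "smooth_on (snd c ` fst c) (snd d \<circ> F \<circ> chart_inv c)"
proof (rule smooth_on_local)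
  interpret A: smooth_atlas \<A> by (rule \<A>)
  interpret B: smooth_atlas \<B> by (rule \<B>)
  fix x assume x: "x \<in> snd c ` fst c"
  let ?p = "chart_inv c x"
  have p: "?p \<in> fst c" "snd c ?p = x" "?p \<in> pts \<A>"
    using chart_inv_in[OF x] snd_chart_inv[OF x] c by (auto simp: pts_def)
  obtain c1 d1 W where *: "c1 \<in> charts_at \<A> ?p" "d1 \<in> charts_at \<B> (F ?p)" "open W" "snd c1 ?p \<in> W"
    "W \<subseteq> snd c1 ` fst c1" "F ` chart_inv c1 ` W \<subseteq> fst d1" "smooth_on W (snd d1 \<circ> F \<circ> chart_inv c1)"
    using F p(3) unfolding smooth_map_def by blast
  have c1: "c1 \<in> \<A>" "?p \<in> fst c1" and d1: "d1 \<in> \<B>"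
    using *(1,2) by (auto simp: charts_at_iff)
  let ?\<tau> = "snd c1 \<circ> chart_inv c" and ?O = "snd c ` (fst c \<inter> fst c1)"
  \<comment> \<open>The \<open>c\<close>-coordinates of those points of the overlap whose
    \<open>c1\<close>-coordinates fall into \<open>W\<close>, where the given local representation
    of \<open>F\<close> is smooth.\<close>
  define U where "U = ?\<tau> -` W \<inter> ?O"
  have O: "open ?O" "smooth_on ?O ?\<tau>" using A.overlap_open A.trans_smooth c c1(1) by auto
  have U: "open U" unfolding U_def
    using continuous_open_preimage[OF smooth_on_continuous[OF O(2)] O(1) *(3)] by (simp add: Int_commute)
  have xU: "x \<in> U" unfolding U_def using *(4) p c1 by (auto intro: image_eqI[of _ _ ?p])
  have U\<tau>: "?\<tau> ` U \<subseteq> W" and UO: "U \<subseteq> ?O" by (auto simp: U_def)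
  let ?G = "snd d1 \<circ> F \<circ> chart_inv c1"
  have inv: "chart_inv c1 (?\<tau> y) = chart_inv c y" "chart_inv c y \<in> fst c" if "y \<in> U" for y
    using that UO A.trans_overlap(2)[OF c c1(1)] A.chart_inv_overlap[OF c] by auto
  have Fd: "F (chart_inv c y) \<in> fst d \<inter> fst d1" if "y \<in> U" for y
    using that inv[OF that] U\<tau> *(6) Fcd by (metis IntI image_eqI subsetD)
  have "smooth_on U (\<lambda>y. (snd d \<circ> chart_inv d1) (?G (?\<tau> y)))"
  proof (rule smooth_on_compose[OF U B.overlap_open[OF d1 d] _ B.trans_smooth[OF d1 d]])
    show "(\<lambda>y. ?G (?\<tau> y)) ` U \<subseteq> snd d1 ` (fst d1 \<inter> fst d)"
      using inv Fd by auto
    show "smooth_on U (\<lambda>y. ?G (?\<tau> y))"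
      by (rule smooth_on_compose[OF U *(3) U\<tau> *(7) smooth_on_subset[OF O(2) UO]])
  qed
  then have "smooth_on U (snd d \<circ> F \<circ> chart_inv c)"
    by (rule smooth_on_cong[OF U, rotated]) (use inv Fd B.chart_inv_snd[OF d1] in auto)
  then show "\<exists>U. open U \<and> x \<in> U \<and> smooth_on U (snd d \<circ> F \<circ> chart_inv c)"
    using U xU by blast
qed

section \<open>The tangent bundle and the slit tangent bundle\<close>

text \<open>Charts of the tangent bundle (\<open>nz = False\<close>) and of the slit tangent bundle (\<open>nz = True\<close>).\<close>

definition bchart ::
  "('a, 'e::euclidean_space) chart set \<Rightarrow> bool \<Rightarrow> ('a, 'e) chart \<Rightarrow> (('a, 'e) tpoint, 'e \<times> 'e) chart" where
  "bchart N nz c =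
     ({(p, v). p \<in> fst c \<and> v \<in> tangent_space N p \<and> (nz \<longrightarrow> v \<noteq> 0)}, \<lambda>(p, v). (snd c p, v c))"

abbreviation tch :: "('a, 'e::euclidean_space) chart set \<Rightarrow> ('a, 'e) chart \<Rightarrow> (('a, 'e) tpoint, 'e \<times> 'e) chart" where
  "tch N \<equiv> bchart N False"

abbreviation sch :: "('a, 'e::euclidean_space) chart set \<Rightarrow> ('a, 'e) chart \<Rightarrow> (('a, 'e) tpoint, 'e \<times> 'e) chart" where
  "sch N \<equiv> bchart N True"

lemma tangent_atlas_eq: "tangent_atlas N = tch N ` N"
  by (simp add: tangent_atlas_def bchart_def)

lemma slit_atlas_eq: "slit_atlas N = sch N ` N"
  unfolding slit_atlas_def tangent_atlas_def image_image
  by (intro image_cong) (auto simp: bchart_def)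

lemma fst_bchart: "u \<in> fst (bchart N nz c) \<longleftrightarrow>
    fst u \<in> fst c \<and> snd u \<in> tangent_space N (fst u) \<and> (nz \<longrightarrow> snd u \<noteq> 0)"
  by (cases u) (simp add: bchart_def)

lemma snd_bchart [simp]: "snd (bchart N nz c) u = (snd c (fst u), snd u c)"
  by (cases u) (simp add: bchart_def)

lemma slit_iff: "u \<in> slit N \<longleftrightarrow> fst u \<in> pts N \<and> snd u \<in> tangent_space N (fst u) \<and> snd u \<noteq> 0"
proof -
  have "u \<in> slit N \<longleftrightarrow> (\<exists>c\<in>N. u \<in> fst (sch N c))" unfolding pts_def slit_atlas_eq by blast
  then show ?thesis unfolding fst_bchart pts_def by blast
qed

lemma sch_at: "u \<in> slit N \<Longrightarrow> c \<in> charts_at N (fst u) \<Longrightarrow> sch N c \<in> charts_at (slit_atlas N) u"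
  unfolding slit_iff charts_at_iff by (simp add: slit_atlas_eq fst_bchart)

lemma charts_at_slit:
  assumes "(C :: (('a, 'e::euclidean_space) tpoint, 'e \<times> 'e) chart) \<in> charts_at (slit_atlas N) u"
  obtains c where "C = sch N c" "c \<in> charts_at N (fst u)"
proof -
  have C: "C \<in> sch N ` N" "u \<in> fst C" using assms by (simp_all only: charts_at_iff slit_atlas_eq)
  from C(1) obtain c where c: "c \<in> N" "C = sch N c" by (rule imageE)
  with C(2) that show ?thesis by (simp add: fst_bchart charts_at_iff)
qed

lemma slit_chart_exists:
  assumes "u \<in> slit N"
  obtains c where "c \<in> charts_at N (fst u)"
proof -
  have "fst u \<in> pts N" using assms unfolding slit_iff by blast
  then show ?thesis using that unfolding pts_iff by blast
qed

text \<open>Reads off the derivative in a single direction from an affine formula along that line.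
  For a bundle transition in vertical directions this avoids the second derivatives of the
  coordinate change.\<close>

lemma fd_eq_along_line:
  assumes "f differentiable (at z)" and "\<epsilon> > 0"
    and "\<And>t. \<bar>t\<bar> < \<epsilon> \<Longrightarrow> f (z + t *\<^sub>R h) = a + t *\<^sub>R b"
  shows "fd f z h = b"
proof -
  have line: "((\<lambda>t. z + t *\<^sub>R h) has_derivative (\<lambda>s. s *\<^sub>R h)) (at 0)"
    by (auto intro!: derivative_eq_intros)
  have "(f has_derivative fd f z) (at (z + 0 *\<^sub>R h))"
    using fd_has_derivative[OF assms(1)] by simp
  from diff_chain_at[OF line this]
  have 1: "((\<lambda>t. f (z + t *\<^sub>R h)) has_derivative (\<lambda>s. fd f z (s *\<^sub>R h))) (at 0)"
    by (simp add: o_def)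
  have "((\<lambda>t. a + t *\<^sub>R b) has_derivative (\<lambda>s. s *\<^sub>R b)) (at 0)"
    by (auto intro!: derivative_eq_intros)
  then have "((\<lambda>t. f (z + t *\<^sub>R h)) has_derivative (\<lambda>s. s *\<^sub>R b)) (at 0)"
    by (rule has_derivative_transform_within_open[where s = "ball 0 \<epsilon>"])
      (use assms(2,3) in \<open>auto simp: dist_norm\<close>)
  from has_derivative_unique[OF 1 this] show ?thesis by (metis scaleR_one)
qed

context smooth_atlas
begin

section \<open>Atlases of the bundles\<close>

lemma bchart_inj: "c \<in> N \<Longrightarrow> inj_on (snd (bchart N nz c)) (fst (bchart N nz c))"
proof (rule inj_onI)
  fix u u' assume c: "c \<in> N" and u: "u \<in> fst (bchart N nz c)" "u' \<in> fst (bchart N nz c)"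
    and eq: "snd (bchart N nz c) u = snd (bchart N nz c) u'"
  have "fst u = fst u'" using chart_inj[OF c] u eq unfolding fst_bchart by (auto dest: inj_onD)
  moreover from this have "snd u = snd u'"
    using c u eq tangent_eqI[of "snd u" "fst u" "snd u'" c] unfolding fst_bchart
    by (simp add: charts_at_iff)
  ultimately show "u = u'" by (rule prod_eqI)
qed

text \<open>By \<open>tangent_eqI\<close> a tangent vector is nonzero exactly if its coordinate
  vector in one chart is, and by \<open>tangent_exists\<close> every coordinate vector occurs. So
  \<open>nz\<close> removes precisely the zero section in coordinates.\<close>

lemma bchart_overlap:
  assumes c: "c \<in> N" and d: "d \<in> N"
  shows "snd (bchart N nz c) ` (fst (bchart N nz c) \<inter> fst (bchart N nz d))
    = (snd c ` (fst c \<inter> fst d)) \<times> {y. nz \<longrightarrow> y \<noteq> 0}" (is "?L = ?R")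
proof (intro equalityI subsetI)
  fix z assume "z \<in> ?L"
  then obtain u where u: "u \<in> fst (bchart N nz c)" "u \<in> fst (bchart N nz d)" "z = (snd c (fst u), snd u c)"
    by auto
  have "nz \<longrightarrow> snd u c \<noteq> 0"
    using u tangent_eqI[OF _ tangent_zero, of "snd u" "fst u" c] c unfolding fst_bchart
    by (auto simp: charts_at_iff)
  then show "z \<in> ?R" using u by (auto simp: fst_bchart)
next
  fix z assume z: "z \<in> ?R"
  then obtain p where p: "p \<in> fst c" "p \<in> fst d" "fst z = snd c p" by auto
  obtain v where v: "v \<in> tangent_space N p" "v c = snd z"
    using tangent_exists[of c p "snd z"] c p by (auto simp: charts_at_iff)
  have "(p, v) \<in> fst (bchart N nz c) \<inter> fst (bchart N nz d)"
    using p v z by (auto simp: fst_bchart)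
  moreover have "z = snd (bchart N nz c) (p, v)" using p v by (simp add: prod_eq_iff)
  ultimately show "z \<in> ?L" by blast
qed

lemma bchart_image:
  assumes c: "c \<in> N"
  shows "snd (bchart N nz c) ` fst (bchart N nz c) = (snd c ` fst c) \<times> {y. nz \<longrightarrow> y \<noteq> 0}"
  using bchart_overlap[OF c c] by simp

lemma bchart_open:
  assumes c: "c \<in> N" and d: "d \<in> N"
  shows "open (snd (bchart N nz c) ` (fst (bchart N nz c) \<inter> fst (bchart N nz d)))"
proof -
  have "{y::'e. nz \<longrightarrow> y \<noteq> 0} = (if nz then - {0} else UNIV)" by auto
  then have "open {y::'e. nz \<longrightarrow> y \<noteq> 0}" by auto
  then show ?thesis unfolding bchart_overlap[OF c d] by (intro open_Times overlap_open c d)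
qed

lemma bchart_inv_snd:
  "c \<in> N \<Longrightarrow> u \<in> fst (bchart N nz c) \<Longrightarrow> chart_inv (bchart N nz c) (snd c (fst u), snd u c) = u"
  unfolding chart_inv_def using inv_into_f_f[OF bchart_inj, of c u nz] by simp

lemma bchart_trans:
  assumes c: "c \<in> N" and d: "d \<in> N"
    and z: "z \<in> snd (bchart N nz c) ` (fst (bchart N nz c) \<inter> fst (bchart N nz d))"
  shows "(snd (bchart N nz d) \<circ> chart_inv (bchart N nz c)) z =
    ((snd d \<circ> chart_inv c) (fst z), fd (snd d \<circ> chart_inv c) (fst z) (snd z))"
proof -
  obtain u where u: "u \<in> fst (bchart N nz c)" "u \<in> fst (bchart N nz d)" "z = (snd c (fst u), snd u c)"
    using z by auto
  have cd: "c \<in> charts_at N (fst u)" "d \<in> charts_at N (fst u)" "snd u \<in> tangent_space N (fst u)"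
    using u c d by (auto simp: charts_at_iff fst_bchart)
  have "chart_inv (bchart N nz c) z = u" unfolding u(3) by (rule bchart_inv_snd[OF c u(1)])
  then show ?thesis
    using u(3) cd chart_inv_snd[OF c, of "fst u"] tangent_trans[OF cd(3,1,2)]
    by (simp add: charts_at_iff)
qed

text \<open>A transition is the coordinate change together with its derivative on the fibres. For
  the base atlas this serves the tangent and the slit bundle; for the slit atlas it serves the
  tangent bundle on which smoothness of the connection is stated.\<close>

lemma bundle_atlas: "smooth_atlas (bchart N nz ` N)"
proof
  fix C assume "C \<in> bchart N nz ` N"
  then obtain c where c: "c \<in> N" "C = bchart N nz c" by blast
  show "inj_on (snd C) (fst C)" unfolding c(2) by (rule bchart_inj[OF c(1)])
  fix E assume "E \<in> bchart N nz ` N"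
  then obtain d where d: "d \<in> N" "E = bchart N nz d" by blast
  show O: "open (snd C ` (fst C \<inter> fst E))" unfolding c(2) d(2) by (rule bchart_open[OF c(1) d(1)])
  let ?\<tau> = "snd d \<circ> chart_inv c" and ?O = "snd c ` (fst c \<inter> fst d)"
  have sub: "fst ` (snd C ` (fst C \<inter> fst E)) \<subseteq> ?O"
    unfolding c(2) d(2) bchart_overlap[OF c(1) d(1)] by auto
  note \<tau> = overlap_open[OF c(1) d(1)] sub trans_smooth[OF c(1) d(1)]
  show "smooth_on (snd C ` (fst C \<inter> fst E)) (snd E \<circ> chart_inv C)"
  proof (rule smooth_on_cong[OF O])
    show "smooth_on (snd C ` (fst C \<inter> fst E)) (\<lambda>z. (?\<tau> (fst z), fd ?\<tau> (fst z) (snd z)))"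
      by (intro smooth_on_Pair[OF O] smooth_on_compose[OF O \<tau>] smooth_on_fd_apply[OF O \<tau>]
          smooth_on_fst[OF O] smooth_on_snd[OF O] smooth_on_ident[OF O])
    show "(?\<tau> (fst z), fd ?\<tau> (fst z) (snd z)) = (snd E \<circ> chart_inv C) z"
      if "z \<in> snd C ` (fst C \<inter> fst E)" for z
      using bchart_trans[OF c(1) d(1) that[unfolded c(2) d(2)]] unfolding c(2) d(2) by (rule sym)
  qed
qed

end

lemma smooth_manifold_atlas:
  assumes "smooth_manifold M \<A>"
  shows "smooth_atlas \<A>"
proof
  note * = assms[unfolded smooth_manifold_def]
  fix c assume c: "c \<in> \<A>"
  have cM: "openin M (fst c)" "open (snd c ` fst c)"
    "homeomorphic_map (subtopology M (fst c)) (top_of_set (snd c ` fst c)) (snd c)"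
    using * c by blast+
  have top: "topspace (subtopology M (fst c)) = fst c"
    using openin_subset[OF cM(1)] by auto
  show "inj_on (snd c) (fst c)"
    using homeomorphic_imp_injective_map[OF cM(3)] unfolding top .
  fix d assume d: "d \<in> \<A>"
  have "openin (subtopology M (fst c)) (fst c \<inter> fst d)"
    using * d by (auto simp: openin_subtopology_Int2)
  then have "openin (top_of_set (snd c ` fst c)) (snd c ` (fst c \<inter> fst d))"
    using homeomorphic_imp_open_map[OF cM(3)] unfolding open_map_def by blast
  then show "open (snd c ` (fst c \<inter> fst d))"
    using cM(2) by (rule openin_open_trans)
  show "smooth_on (snd c ` (fst c \<inter> fst d)) (snd d \<circ> chart_inv c)"
    using * c d by blast
qed

locale slit_bundle = smooth_atlas N for N :: "('a, 'e::euclidean_space) chart set"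
begin

sublocale S: smooth_atlas "slit_atlas N"
  unfolding slit_atlas_eq by (rule bundle_atlas)

lemma sch_in: "c \<in> N \<Longrightarrow> sch N c \<in> slit_atlas N"
  unfolding slit_atlas_eq by blast

lemmas sch_open = S.image_open[OF sch_in]

lemma sch_inv:
  assumes "z \<in> snd (sch N c) ` fst (sch N c)"
  shows "chart_inv (sch N c) z \<in> fst (sch N c)"
    and "snd c (fst (chart_inv (sch N c) z)) = fst z"
    and "snd (chart_inv (sch N c) z) c = snd z"
  using chart_inv_in[OF assms] snd_chart_inv[OF assms] by (auto simp: prod_eq_iff)

lemma sch_pts: "c \<in> N \<Longrightarrow> u \<in> fst (sch N c) \<Longrightarrow> u \<in> slit N"
  unfolding pts_def using sch_in by blast

lemma sch_charts_at: "c \<in> N \<Longrightarrow> u \<in> fst (sch N c) \<Longrightarrow> c \<in> charts_at N (fst u)"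
  by (simp add: fst_bchart charts_at_iff)

lemma slit_in_sch: "u \<in> slit N \<Longrightarrow> c \<in> charts_at N (fst u) \<Longrightarrow> c \<in> N \<and> u \<in> fst (sch N c)"
  by (simp add: fst_bchart charts_at_iff slit_iff)

lemma tangent_atlas: "smooth_atlas (tangent_atlas N)"
  unfolding tangent_atlas_eq by (rule bundle_atlas)

section \<open>Sections of the pullback bundle in coordinates\<close>

text \<open>Extracts the fibre component of a smooth map into the tangent bundle. It is used for
  sections over the slit bundle and for the bundle map given by the covariant differential of a
  section.\<close>

lemma bundle_map_smooth:
  assumes C: "C \<in> \<B>" "\<And>u. u \<in> fst C \<Longrightarrow> fst (F u) \<in> fst c \<and> snd (F u) \<in> tangent_space N (fst (F u))"
    and \<B>: "smooth_atlas \<B>" and F: "smooth_map \<B> (tangent_atlas N) F" and c: "c \<in> N"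
  shows "smooth_on (snd C ` fst C) (\<lambda>z. snd (F (chart_inv C z)) c)"
proof -
  have "smooth_on (snd C ` fst C) (snd (tch N c) \<circ> F \<circ> chart_inv C)"
    using C(2) c by (intro smooth_map_chart[OF \<B> tangent_atlas F C(1)]) (auto simp: tangent_atlas_eq fst_bchart)
  from smooth_on_snd[OF smooth_atlas.image_open[OF \<B> C(1)] this] show ?thesis by simp
qed

text \<open>With the charts \<open>sch N c\<close> and \<open>tch N c\<close> over the same base
  chart, the base part of a section is \<open>fst z\<close>, so its smoothness is that of its fibre
  components.\<close>

lemma pi_field_iff: "pi_field N X \<longleftrightarrow> (\<forall>u\<in>slit N. X u \<in> tangent_space N (fst u)) \<and>
  (\<forall>c\<in>N. smooth_on (snd (sch N c) ` fst (sch N c)) (coords c X (sch N c)))" (is "?l \<longleftrightarrow> ?r")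
proof
  assume l: ?l
  then have T: "X u \<in> tangent_space N (fst u)" if "u \<in> slit N" for u
    using that unfolding pi_field_def by blast
  have "smooth_on (snd (sch N c) ` fst (sch N c)) (\<lambda>z. snd ((\<lambda>u. (fst u, X u)) (chart_inv (sch N c) z)) c)"
    if c: "c \<in> N" for c
  proof (rule bundle_map_smooth[OF sch_in[OF c] _ S.smooth_atlas_axioms _ c])
    show "smooth_map (slit_atlas N) (tangent_atlas N) (\<lambda>u. (fst u, X u))"
      using l unfolding pi_field_def by blast
    show "fst (fst u, X u) \<in> fst c \<and> snd (fst u, X u) \<in> tangent_space N (fst (fst u, X u))"
      if "u \<in> fst (sch N c)" for u
      using that T[OF sch_pts[OF c that]] by (simp add: fst_bchart)
  qed
  then show ?r using T by simp
next
  assume r: ?r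
  show ?l unfolding pi_field_def smooth_map_def
  proof (intro conjI ballI)
    show T: "X u \<in> tangent_space N (fst u)" if "u \<in> slit N" for u using r that by blast
    fix u assume u: "u \<in> slit N"
    then obtain c where "c \<in> charts_at N (fst u)" by (rule slit_chart_exists)
    with u have c: "c \<in> N" "u \<in> fst (sch N c)" using slit_in_sch by blast+
    let ?O = "snd (sch N c) ` fst (sch N c)"
    note O = sch_open[OF c(1)]
    have "smooth_on ?O (snd (tch N c) \<circ> (\<lambda>u. (fst u, X u)) \<circ> chart_inv (sch N c))"
    proof (rule smooth_on_cong[OF O])
      show "smooth_on ?O (\<lambda>z. (fst z, coords c X (sch N c) z))"
        using r c(1) by (intro smooth_on_Pair[OF O] smooth_on_fst[OF O] smooth_on_ident[OF O]) blast
    qed (simp add: sch_inv)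
    moreover have "(\<lambda>u. (fst u, X u)) ` chart_inv (sch N c) ` ?O \<subseteq> fst (tch N c)"
    proof (rule image_subsetI)
      fix w assume "w \<in> chart_inv (sch N c) ` ?O"
      then have u: "w \<in> fst (sch N c)" using sch_inv(1) by blast
      then show "(fst w, X w) \<in> fst (tch N c)" using T[OF sch_pts[OF c(1) u]] by (simp add: fst_bchart)
    qed
    moreover have "sch N c \<in> charts_at (slit_atlas N) u" "tch N c \<in> charts_at (tangent_atlas N) (fst u, X u)"
      using c T[OF u] sch_in[OF c(1)] by (auto simp: charts_at_iff tangent_atlas_eq fst_bchart)
    moreover have "snd (sch N c) u \<in> ?O" using c by blast
    ultimately show "\<exists>C\<in>charts_at (slit_atlas N) u. \<exists>E\<in>charts_at (tangent_atlas N) (fst u, X u). \<exists>W.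
        open W \<and> snd C u \<in> W \<and> W \<subseteq> snd C ` fst C \<and>
        (\<lambda>u. (fst u, X u)) ` chart_inv C ` W \<subseteq> fst E \<and>
        smooth_on W (snd E \<circ> (\<lambda>u. (fst u, X u)) \<circ> chart_inv C)"
      using O by (intro bexI[of _ "sch N c"] bexI[of _ "tch N c"] exI[of _ ?O] conjI order_refl)
  qed
qed

lemma pi_fieldI:
  assumes "\<And>u. u \<in> slit N \<Longrightarrow> X u \<in> tangent_space N (fst u)"
    and "\<And>c. c \<in> N \<Longrightarrow> smooth_on (snd (sch N c) ` fst (sch N c)) (coords c X (sch N c))"
  shows "pi_field N X"
  unfolding pi_field_iff using assms by blast

lemma pi_field_tangent: "pi_field N X \<Longrightarrow> u \<in> slit N \<Longrightarrow> X u \<in> tangent_space N (fst u)"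
  unfolding pi_field_iff by blast

lemma pi_field_coords:
  "pi_field N X \<Longrightarrow> c \<in> N \<Longrightarrow> smooth_on (snd (sch N c) ` fst (sch N c)) (coords c X (sch N c))"
  unfolding pi_field_iff by blast

lemma pi_field_zero: "pi_field N 0"
  by (rule pi_fieldI) (simp_all add: tangent_zero smooth_on_const)

lemma pi_field_add: "pi_field N X \<Longrightarrow> pi_field N Y \<Longrightarrow> pi_field N (X + Y)"
  by (rule pi_fieldI)
    (simp_all add: tangent_add pi_field_tangent smooth_on_add sch_open pi_field_coords del: snd_bchart)

lemma pi_field_uminus: "pi_field N X \<Longrightarrow> pi_field N (- X)"
  by (rule pi_fieldI)
    (simp_all add: tangent_uminus pi_field_tangent smooth_on_uminus sch_open pi_field_coords del: snd_bchart)

lemma pi_field_diff: "pi_field N X \<Longrightarrow> pi_field N Y \<Longrightarrow> pi_field N (X - Y)"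
  using pi_field_add[OF _ pi_field_uminus] by fastforce

lemma pi_field_eta: "pi_field N eta"
proof (rule pi_fieldI)
  show "eta u \<in> tangent_space N (fst u)" if "u \<in> slit N" for u
    using that by (simp add: eta_def slit_iff)
  fix c assume c: "c \<in> N"
  note O = sch_open[OF c]
  show "smooth_on (snd (sch N c) ` fst (sch N c)) (coords c eta (sch N c))"
    by (rule smooth_on_cong[OF O _ smooth_on_snd[OF O smooth_on_ident[OF O]]]) (simp add: eta_def sch_inv)
qed

section \<open>Projection and vertical lift in coordinates\<close>

lemma fst_fd: "f differentiable (at x) \<Longrightarrow> fst (fd f x h) = fd (\<lambda>x. fst (f x)) x h"
  by (simp add: fd_bounded_linear[OF bounded_linear_fst])

text \<open>The transition (x, y) \<mapsto> (\<tau>(x), d\<tau>(x) y) has a block triangular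
  derivative: the base part of the image depends on the base part alone, and vertical vectors stay
  vertical and transform by d\<tau>. This makes the coordinate forms of \<open>rho\<close> and
  \<open>vlift\<close> consistent between charts.\<close>

lemma fst_fd_sch_trans:
  assumes u: "u \<in> slit N" and c: "c \<in> charts_at N (fst u)" and d: "d \<in> charts_at N (fst u)"
  shows "fst (fd (snd (sch N d) \<circ> chart_inv (sch N c)) (snd (sch N c) u) h)
      = fd (snd d \<circ> chart_inv c) (snd c (fst u)) (fst h)"
    and "fd (snd (sch N d) \<circ> chart_inv (sch N c)) (snd (sch N c) u) (0, w)
      = (0, fd (snd d \<circ> chart_inv c) (snd c (fst u)) w)"
proof -
  let ?T = "snd (sch N d) \<circ> chart_inv (sch N c)" and ?z = "snd (sch N c) u"
  let ?\<tau> = "snd d \<circ> chart_inv c" and ?x = "snd c (fst u)"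
  let ?O = "snd (sch N c) ` (fst (sch N c) \<inter> fst (sch N d))"
  have cd: "c \<in> N" "d \<in> N" "u \<in> fst (sch N c)" "u \<in> fst (sch N d)"
    using slit_in_sch u c d by blast+
  have O: "open ?O" "?z \<in> ?O" using bchart_open[OF cd(1,2)] cd by auto
  have Tz: "?T z = (?\<tau> (fst z), fd ?\<tau> (fst z) (snd z))" if "z \<in> ?O" for z
    by (rule bchart_trans[OF cd(1,2) that])
  have Td: "?T differentiable (at ?z)"
    by (rule S.trans_differentiable[OF sch_at[OF u c] sch_at[OF u d]])
  note \<tau>d = trans_differentiable[OF c d]
  have fstd: "fst differentiable (at ?z)" by (rule bounded_linear_imp_differentiable[OF bounded_linear_fst])
  have \<tau>d': "?\<tau> differentiable (at (fst ?z))" using \<tau>d by simp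
  have "fst (fd ?T ?z h) = fd (\<lambda>z. fst (?T z)) ?z h" by (rule fst_fd[OF Td])
  also have "fd (\<lambda>z. fst (?T z)) ?z = fd (\<lambda>z. ?\<tau> (fst z)) ?z"
    by (rule fd_cong_open[OF O]) (simp only: Tz fst_conv)
  also have "\<dots> h = fd ?\<tau> (fst ?z) (fd fst ?z h)"
    by (rule fun_cong[OF fd_compose[OF fstd \<tau>d']])
  also have "\<dots> = fd ?\<tau> ?x (fst h)"
    unfolding fd_eqI[OF bounded_linear_imp_has_derivative[OF bounded_linear_fst]] by simp
  finally show "fst (fd ?T ?z h) = fd ?\<tau> ?x (fst h)" .
  obtain e where e: "e > 0" "ball ?z e \<subseteq> ?O" using O openE by blast
  \<comment> \<open>Keeps the segment inside the ball where the transition formula holds; the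
    summand 1 covers \<open>w = 0\<close>.\<close>
  define \<epsilon> where "\<epsilon> = e / (norm w + 1)"
  have nw: "norm w + 1 > 0" by (simp add: add_nonneg_pos)
  have \<epsilon>: "\<epsilon> > 0" using e nw by (simp add: \<epsilon>_def)
  show "fd ?T ?z (0, w) = (0, fd ?\<tau> ?x w)"
  proof (rule fd_eq_along_line[OF Td \<epsilon>])
    fix t :: real assume t: "\<bar>t\<bar> < \<epsilon>"
    have "\<bar>t\<bar> * norm w \<le> \<bar>t\<bar> * (norm w + 1)" by (simp add: mult_left_mono)
    also have "\<dots> < e" using t nw by (simp add: \<epsilon>_def field_simps)
    finally have "\<bar>t\<bar> * norm w < e" .
    then have "?z + t *\<^sub>R (0, w) \<in> ball ?z e" by (simp add: dist_norm norm_Pair)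
    then have "?z + t *\<^sub>R (0, w) \<in> ?O" using e by blast
    \<comment> \<open>The base point is fixed along this line and the transition is linear in the
      fibre, hence affine in \<open>t\<close>.\<close>
    from Tz[OF this] show "?T (?z + t *\<^sub>R (0, w)) = (?\<tau> ?x, fd ?\<tau> ?x (snd u c)) + t *\<^sub>R (0, fd ?\<tau> ?x w)"
      by (simp add: linear_add[OF fd_linear[OF \<tau>d]] linear_cmul[OF fd_linear[OF \<tau>d]])
  qed
qed

lemma rho_coord:
  assumes u: "u \<in> slit N" and A: "A \<in> tangent_space (slit_atlas N) u" and c: "c \<in> charts_at N (fst u)"
  shows "rho N u A c = fst (A (sch N c))"
proof -
  have c': "c \<in> N" "u \<in> fst (sch N c)" using slit_in_sch u c by blast+
  let ?g = "(snd c \<circ> fst) \<circ> chart_inv (sch N c)"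
  let ?O = "snd (sch N c) ` fst (sch N c)"
  have O: "open ?O" "snd (sch N c) u \<in> ?O" using sch_open c' by auto
  have eq: "fst z = ?g z" if "z \<in> ?O" for z using sch_inv(2)[OF that] by simp
  have d: "?g differentiable (at (snd (sch N c) u))"
    by (rule differentiable_cong_open[OF O eq bounded_linear_imp_differentiable[OF bounded_linear_fst]])
  have "rho N u A c = tderiv (slit_atlas N) u A (snd c \<circ> fst)"
    using c by (simp add: rho_def differential_def)
  also have "\<dots> = fd ?g (snd (sch N c) u) (A (sch N c))"
    by (rule S.tderiv_chart[OF A sch_at[OF u c] d])
  also have "fd ?g (snd (sch N c) u) = fd fst (snd (sch N c) u)"
    by (rule fd_cong_open[OF O eq[symmetric]])
  also have "fd fst (snd (sch N c) u) = (fst :: 'e \<times> 'e \<Rightarrow> 'e)"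
    by (rule fd_eqI[OF bounded_linear_imp_has_derivative[OF bounded_linear_fst]])
  finally show ?thesis .
qed

lemma rho_outside: "c \<notin> charts_at N (fst u) \<Longrightarrow> rho N u A c = 0"
  by (simp add: rho_def differential_def)

lemma rho_tangent:
  assumes u: "u \<in> slit N" and A: "A \<in> tangent_space (slit_atlas N) u"
  shows "rho N u A \<in> tangent_space N (fst u)"
proof (rule tangent_spaceI)
  show "rho N u A c = 0" if "c \<notin> charts_at N (fst u)" for c
    by (rule rho_outside[OF that])
  fix c d assume c: "c \<in> charts_at N (fst u)" and d: "d \<in> charts_at N (fst u)"
  show "rho N u A d = fd (snd d \<circ> chart_inv c) (snd c (fst u)) (rho N u A c)"
    using S.tangent_trans[OF A sch_at[OF u c] sch_at[OF u d]] fst_fd_sch_trans(1)[OF u c d]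
    by (simp add: rho_coord[OF u A c] rho_coord[OF u A d])
qed

lemma rho_add:
  assumes u: "u \<in> slit N" and A: "A \<in> tangent_space (slit_atlas N) u" and B: "B \<in> tangent_space (slit_atlas N) u"
  shows "rho N u (A + B) = rho N u A + rho N u B"
proof
  fix c show "rho N u (A + B) c = (rho N u A + rho N u B) c"
    by (cases "c \<in> charts_at N (fst u)")
      (simp_all add: rho_outside rho_coord[OF u] A B S.tangent_add)
qed

lemma rho_uminus:
  assumes u: "u \<in> slit N" and A: "A \<in> tangent_space (slit_atlas N) u"
  shows "rho N u (- A) = - rho N u A"
proof
  fix c show "rho N u (- A) c = (- rho N u A) c"
    by (cases "c \<in> charts_at N (fst u)")
      (simp_all add: rho_outside rho_coord[OF u] A S.tangent_uminus)
qed

lemma rho_diff: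
  assumes u: "u \<in> slit N" and A: "A \<in> tangent_space (slit_atlas N) u" and B: "B \<in> tangent_space (slit_atlas N) u"
  shows "rho N u (A - B) = rho N u A - rho N u B"
  using rho_add[OF u A S.tangent_uminus[OF B]] rho_uminus[OF u B] by simp

text \<open>In the chart the curve is an affine line. \<open>snd_bchart\<close> holds for every
  pair, so this is true also for those \<open>t\<close> at which the curve leaves the slit
  bundle.\<close>

lemma vlift_coord:
  assumes u: "u \<in> slit N" and c: "c \<in> charts_at N (fst u)"
  shows "vlift N u v (sch N c) = (0, v c)"
proof -
  let ?\<sigma> = "\<lambda>t. (fst u, snd u + tscale t v)"
  have \<sigma>0: "?\<sigma> 0 = u" by (simp add: tscale_def prod_eq_iff fun_eq_iff)
  have "((\<lambda>t. (snd c (fst u), snd u c + t *\<^sub>R v c)) has_vector_derivative (0, v c)) (at 0)"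
    by (auto simp: has_vector_derivative_def intro!: derivative_eq_intros)
  moreover have "snd (sch N c) \<circ> ?\<sigma> = (\<lambda>t. (snd c (fst u), snd u c + t *\<^sub>R v c))"
    by (simp add: o_def tscale_def)
  ultimately have "vector_derivative (snd (sch N c) \<circ> ?\<sigma>) (at 0) = (0, v c)"
    by (simp add: vector_derivative_at)
  then show ?thesis unfolding vlift_def velocity_def \<sigma>0 using sch_at[OF u c] by simp
qed

lemma vlift_tangent:
  assumes u: "u \<in> slit N" and v: "v \<in> tangent_space N (fst u)"
  shows "vlift N u v \<in> tangent_space (slit_atlas N) u"
proof (rule S.tangent_spaceI)
  have \<sigma>0: "(fst u, snd u + tscale 0 v) = u" by (simp add: tscale_def prod_eq_iff fun_eq_iff)
  show "vlift N u v C = 0" if "C \<notin> charts_at (slit_atlas N) u" for C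
    unfolding vlift_def velocity_def \<sigma>0 using that by simp
  fix C E assume "C \<in> charts_at (slit_atlas N) u" "E \<in> charts_at (slit_atlas N) u"
  then obtain c d where c: "C = sch N c" "c \<in> charts_at N (fst u)" and d: "E = sch N d" "d \<in> charts_at N (fst u)"
    using charts_at_slit by metis
  show "vlift N u v E = fd (snd E \<circ> chart_inv C) (snd C u) (vlift N u v C)"
    unfolding c(1) d(1) vlift_coord[OF u c(2)] vlift_coord[OF u d(2)]
      fst_fd_sch_trans(2)[OF u c(2) d(2)] tangent_trans[OF v c(2) d(2)] ..
qed

lemma rho_vlift:
  assumes u: "u \<in> slit N" and v: "v \<in> tangent_space N (fst u)"
  shows "rho N u (vlift N u v) = 0"
proof
  fix c show "rho N u (vlift N u v) c = 0 c"
    by (cases "c \<in> charts_at N (fst u)")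
      (simp_all add: rho_outside rho_coord[OF u vlift_tangent[OF u v]] vlift_coord[OF u])
qed

lemma slit_vfI:
  assumes "\<And>u. u \<in> slit N \<Longrightarrow> A u \<in> tangent_space (slit_atlas N) u"
    and "\<And>c. c \<in> N \<Longrightarrow> smooth_on (snd (sch N c) ` fst (sch N c)) (coords (sch N c) A (sch N c))"
  shows "smooth_vf (slit_atlas N) A"
proof (rule S.smooth_vfI[OF assms(1)])
  fix C assume "C \<in> slit_atlas N"
  then obtain c where "c \<in> N" "C = sch N c" unfolding slit_atlas_eq by blast
  then show "smooth_on (snd C ` fst C) (coords C A C)" using assms(2) by blast
qed

lemma gamma_smooth:
  assumes X: "pi_field N X"
  shows "smooth_vf (slit_atlas N) (gamma_f N X)"
proof (rule slit_vfI)
  show "gamma_f N X u \<in> tangent_space (slit_atlas N) u" if "u \<in> slit N" for u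
    unfolding gamma_f_def by (rule vlift_tangent[OF that pi_field_tangent[OF X that]])
  fix c assume c: "c \<in> N"
  note O = sch_open[OF c]
  show "smooth_on (snd (sch N c) ` fst (sch N c)) (coords (sch N c) (gamma_f N X) (sch N c))"
  proof (rule smooth_on_cong[OF O _ smooth_on_Pair[OF O smooth_on_const pi_field_coords[OF X c]]])
    fix z assume "z \<in> snd (sch N c) ` fst (sch N c)"
    note u = sch_inv(1)[OF this]
    show "(0, coords c X (sch N c) z) = coords (sch N c) (gamma_f N X) (sch N c) z"
      unfolding gamma_f_def vlift_coord[OF sch_pts[OF c u] sch_charts_at[OF c u]] ..
  qed
qed

lemma vf_tangent: "smooth_vf (slit_atlas N) A \<Longrightarrow> u \<in> slit N \<Longrightarrow> A u \<in> tangent_space (slit_atlas N) u"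
  by (rule S.smooth_vf_tangent_pts)

lemma rho_f_coords:
  assumes A: "smooth_vf (slit_atlas N) A" and c: "c \<in> N" and z: "z \<in> snd (sch N c) ` fst (sch N c)"
  shows "coords c (rho_f N A) (sch N c) z = fst (coords (sch N c) A (sch N c) z)"
proof -
  note u = sch_inv(1)[OF z]
  show ?thesis unfolding rho_f_def
    by (rule rho_coord[OF sch_pts[OF c u] vf_tangent[OF A sch_pts[OF c u]] sch_charts_at[OF c u]])
qed

lemma rho_f_pi_field:
  assumes A: "smooth_vf (slit_atlas N) A"
  shows "pi_field N (rho_f N A)"
proof (rule pi_fieldI)
  show "rho_f N A u \<in> tangent_space N (fst u)" if "u \<in> slit N" for u
    unfolding rho_f_def by (rule rho_tangent[OF that vf_tangent[OF A that]])
  fix c assume c: "c \<in> N"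
  note O = sch_open[OF c]
  show "smooth_on (snd (sch N c) ` fst (sch N c)) (coords c (rho_f N A) (sch N c))"
    by (rule smooth_on_cong[OF O rho_f_coords[OF A c, symmetric]
          smooth_on_fst[OF O S.smooth_vf_coords[OF A sch_in[OF c]]]])
qed

lemma rho_gamma: "pi_field N X \<Longrightarrow> u \<in> slit N \<Longrightarrow> rho_f N (gamma_f N X) u = 0"
  unfolding rho_f_def gamma_f_def by (rule rho_vlift[OF _ pi_field_tangent])

section \<open>Projections of Lie brackets\<close>

text \<open>In the base part of a bracket only the base components of the two fields are
  differentiated. Thus \<rho>[A,B] is computable even if of \<open>A\<close> and \<open>B\<close>
  only the projections are known near \<open>u\<close>.\<close>

lemma rho_bracket_coord:
  assumes A: "smooth_vf (slit_atlas N) A" and B: "smooth_vf (slit_atlas N) B"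
    and u: "u \<in> slit N" and c: "c \<in> charts_at N (fst u)"
  shows "rho N u (lie_bracket (slit_atlas N) A B u) c =
    fd (coords c (rho_f N B) (sch N c)) (snd (sch N c) u) (A u (sch N c))
    - fd (coords c (rho_f N A) (sch N c)) (snd (sch N c) u) (B u (sch N c))"
proof -
  have c': "c \<in> N" "u \<in> fst (sch N c)" using slit_in_sch u c by blast+
  note C = sch_at[OF u c]
  have *: "fst (fd (coords (sch N c) A (sch N c)) (snd (sch N c) u) h)
      = fd (coords c (rho_f N A) (sch N c)) (snd (sch N c) u) h" if A: "smooth_vf (slit_atlas N) A" for A h
    using fd_cong_open[OF sch_open[OF c'(1)] imageI[OF c'(2)] rho_f_coords[OF A c'(1)]]
    by (simp only: fst_fd[OF S.smooth_vf_differentiable[OF A C]])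
  show ?thesis
    unfolding rho_coord[OF u vf_tangent[OF S.bracket_smooth_vf[OF A B] u] c] S.bracket_coords[OF A B C]
      fst_diff *[OF A] *[OF B] ..
qed

lemma coords_cong_fd:
  assumes u: "u \<in> slit N" and c: "c \<in> charts_at N (fst u)"
    and eq: "\<And>w. w \<in> slit N \<Longrightarrow> X w = Y w"
  shows "fd (coords c X (sch N c)) (snd (sch N c) u) = fd (coords c Y (sch N c)) (snd (sch N c) u)"
proof -
  have c': "c \<in> N" "u \<in> fst (sch N c)" using slit_in_sch u c by blast+
  show ?thesis
    by (rule fd_cong_open[OF sch_open[OF c'(1)] imageI[OF c'(2)]], subst eq)
      (rule sch_pts[OF c'(1) sch_inv(1)], assumption, rule refl)
qed

text \<open>Integrability of the vertical bundle: the base components to be differentiated vanish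
  identically.\<close>

lemma rho_bracket_vertical:
  assumes A: "smooth_vf (slit_atlas N) A" "\<And>w. w \<in> slit N \<Longrightarrow> rho_f N A w = 0"
    and B: "smooth_vf (slit_atlas N) B" "\<And>w. w \<in> slit N \<Longrightarrow> rho_f N B w = 0"
    and u: "u \<in> slit N"
  shows "rho N u (lie_bracket (slit_atlas N) A B u) = 0"
proof
  fix c
  show "rho N u (lie_bracket (slit_atlas N) A B u) c = 0 c"
  proof (cases "c \<in> charts_at N (fst u)")
    case True
    have "fd (coords c (rho_f N B) (sch N c)) (snd (sch N c) u) h = 0"
      if "\<And>w. w \<in> slit N \<Longrightarrow> rho_f N B w = 0" for B h
      using coords_cong_fd[OF u True, of "rho_f N B" 0] that by (simp del: snd_bchart)
    then show ?thesis using A B by (simp add: rho_bracket_coord[OF A(1) B(1) u True] del: snd_bchart)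
  qed (simp add: rho_outside)
qed

text \<open>A vector field projecting to \<open>\<eta>\<close> has base components \<open>y\<close> in the coordinates \<open>(x, y)\<close>.\<close>

lemma rho_bracket_gamma_eta:
  assumes X: "pi_field N X" and B: "smooth_vf (slit_atlas N) B" "\<And>w. w \<in> slit N \<Longrightarrow> rho_f N B w = eta w"
    and u: "u \<in> slit N"
  shows "rho N u (lie_bracket (slit_atlas N) (gamma_f N X) B u) = X u"
proof
  fix c
  show "rho N u (lie_bracket (slit_atlas N) (gamma_f N X) B u) c = X u c"
  proof (cases "c \<in> charts_at N (fst u)")
    case True
    have c': "c \<in> N" "u \<in> fst (sch N c)" using slit_in_sch u True by blast+
    have "fd (coords c (rho_f N (gamma_f N X)) (sch N c)) (snd (sch N c) u) h = 0" for h
      using coords_cong_fd[OF u True, of "rho_f N (gamma_f N X)" 0] rho_gamma[OF X] by (simp del: snd_bchart)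
    moreover have "fd (coords c (rho_f N B) (sch N c)) (snd (sch N c) u) h = snd h" for h
    proof -
      have "fd (coords c (rho_f N B) (sch N c)) (snd (sch N c) u) = fd (coords c eta (sch N c)) (snd (sch N c) u)"
        by (rule coords_cong_fd[OF u True B(2)])
      also have "\<dots> = fd snd (snd (sch N c) u)"
        by (rule fd_cong_open[OF sch_open[OF c'(1)] imageI[OF c'(2)]]) (simp add: eta_def sch_inv(3))
      also have "\<dots> = snd" by (rule fd_eqI[OF bounded_linear_imp_has_derivative[OF bounded_linear_snd]])
      finally show ?thesis by simp
    qed
    moreover have "gamma_f N X u (sch N c) = (0, X u c)"
      unfolding gamma_f_def by (rule vlift_coord[OF u True])
    ultimately show ?thesis
      by (simp add: rho_bracket_coord[OF gamma_smooth[OF X] B(1) u True] del: snd_bchart)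
  next
    case False
    then show ?thesis using pi_field_tangent[OF X u] by (simp add: rho_outside tangent_outside)
  qed
qed

end

section \<open>Regular connections\<close>

lemma smooth_on_vec:
  fixes f :: "'e::real_normed_vector \<Rightarrow> real ^ 'n"
  assumes "open S" "\<And>i. smooth_on S (\<lambda>x. f x $ i)"
  shows "smooth_on S f"
proof (rule smooth_on_cong[OF assms(1)])
  show "smooth_on S (\<lambda>x. \<Sum>i\<in>UNIV. (f x $ i) *\<^sub>R axis i 1)"
    by (intro smooth_on_sum smooth_on_scaleR assms smooth_on_const)
  show "(\<Sum>i\<in>UNIV. (f x $ i) *\<^sub>R axis i 1) = f x" for x
    using basis_expansion[of "f x"] by (simp add: scalar_mult_eq_scaleR)
qed

lemma smooth_on_vec_nth:
  fixes f :: "'e::real_normed_vector \<Rightarrow> real ^ 'n"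
  shows "open S \<Longrightarrow> smooth_on S f \<Longrightarrow> smooth_on S (\<lambda>x. f x $ i)"
  by (rule smooth_on_bounded_linear[OF _ bounded_linear_vec_nth])

lemma smooth_on_det:
  fixes A :: "'e::real_normed_vector \<Rightarrow> real ^ 'n ^ 'n"
  assumes "open S" "\<And>i j. smooth_on S (\<lambda>x. A x $ i $ j)"
  shows "smooth_on S (\<lambda>x. det (A x))"
  unfolding det_def
  by (intro smooth_on_sum smooth_on_mult smooth_on_prod smooth_on_const assms)

text \<open>Cramer's rule writes each component of \<open>y\<close> as a quotient of determinants,
  and these are polynomials in smooth entries.\<close>

lemma smooth_on_linear_solution:
  fixes A :: "'e::real_normed_vector \<Rightarrow> real ^ 'n ^ 'n"
  assumes S: "open S" and A: "\<And>i j. smooth_on S (\<lambda>x. A x $ i $ j)" and b: "smooth_on S b"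
    and nz: "\<And>x. x \<in> S \<Longrightarrow> det (A x) \<noteq> 0" and eq: "\<And>x. x \<in> S \<Longrightarrow> A x *v y x = b x"
  shows "smooth_on S y"
proof (rule smooth_on_vec[OF S])
  fix k
  show "smooth_on S (\<lambda>x. y x $ k)"
  proof (rule smooth_on_cong[OF S])
    show "smooth_on S (\<lambda>x. det (\<chi> i j. if j = k then b x $ i else A x $ i $ j) * inverse (det (A x)))"
    proof (intro smooth_on_mult[OF S] smooth_on_inverse[OF S] smooth_on_det[OF S] nz A)
      show "smooth_on S (\<lambda>x. (\<chi> i j. if j = k then b x $ i else A x $ i $ j) $ i $ j)" for i j
        by (cases "j = k") (simp_all add: A smooth_on_vec_nth[OF S b])
    qed
    show "det (\<chi> i j. if j = k then b x $ i else A x $ i $ j) * inverse (det (A x)) = y x $ k"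
      if "x \<in> S" for x
      using cramer[OF nz[OF that], of "y x" "b x"] eq[OF that] by (simp add: divide_inverse)
  qed
qed

text \<open>The model space is \<open>real ^ 'n\<close>, so that matrices and determinants are at
  hand for the smoothness of the horizontal lift.\<close>

locale regular_conn = slit_bundle N for N :: "('a, real ^ 'n) chart set" +
  fixes D :: "('a, real ^ 'n) conn"
  assumes regular: "regular_connection N D"
begin

abbreviation tsp where "tsp \<equiv> tangent_space (slit_atlas N)"
abbreviation vf where "vf \<equiv> smooth_vf (slit_atlas N)"
abbreviation pf where "pf \<equiv> pi_field N"
abbreviation brk where "brk \<equiv> lie_bracket (slit_atlas N)"
abbreviation "\<rho> \<equiv> rho_f N"
abbreviation "\<gamma> \<equiv> gamma_f N"
abbreviation "\<beta> \<equiv> beta_f N D"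
abbreviation "cv \<equiv> cov D"
abbreviation "tor \<equiv> torsion N D"
abbreviation "curv \<equiv> curvature N D"

section \<open>Pointwise rules for the connection\<close>

lemma linear_conn: "linear_connection N D"
  using regular unfolding regular_connection_def by blast

lemma conn_tangent:
  "pf X \<Longrightarrow> u \<in> slit N \<Longrightarrow> A \<in> tsp u \<Longrightarrow> D u A X \<in> tangent_space N (fst u)"
  using linear_conn unfolding linear_connection_def by blast

lemma conn_add_vec:
  "pf X \<Longrightarrow> u \<in> slit N \<Longrightarrow> A \<in> tsp u \<Longrightarrow> B \<in> tsp u \<Longrightarrow> D u (A + B) X = D u A X + D u B X"
  using linear_conn unfolding linear_connection_def by blast

lemma conn_scale_vec:
  "pf X \<Longrightarrow> u \<in> slit N \<Longrightarrow> A \<in> tsp u \<Longrightarrow> D u (tscale r A) X = tscale r (D u A X)"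
  using linear_conn unfolding linear_connection_def by blast

lemma conn_add:
  "pf X \<Longrightarrow> pf Y \<Longrightarrow> u \<in> slit N \<Longrightarrow> A \<in> tsp u \<Longrightarrow> D u A (X + Y) = D u A X + D u A Y"
  using linear_conn unfolding linear_connection_def by blast

lemma conn_leibniz:
  "pf X \<Longrightarrow> u \<in> slit N \<Longrightarrow> A \<in> tsp u \<Longrightarrow> smooth_fun (slit_atlas N) f \<Longrightarrow>
    D u A (\<lambda>w. tscale (f w) (X w)) = tscale (tderiv (slit_atlas N) u A f) (X u) + tscale (f u) (D u A X)"
  using linear_conn unfolding linear_connection_def by blast

lemma conn_smooth_map:
  "pf X \<Longrightarrow> smooth_map (tangent_atlas (slit_atlas N)) (tangent_atlas N) (\<lambda>(u, A). (fst u, D u A X))"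
  using linear_conn unfolding linear_connection_def by blast

lemma conn_zero_vec: "pf X \<Longrightarrow> u \<in> slit N \<Longrightarrow> D u 0 X = 0"
  using conn_add_vec[of X u 0 0] S.tangent_zero by simp

lemma conn_uminus_vec: "pf X \<Longrightarrow> u \<in> slit N \<Longrightarrow> A \<in> tsp u \<Longrightarrow> D u (- A) X = - D u A X"
  using conn_add_vec[of X u A "- A"] S.tangent_uminus conn_zero_vec by (simp add: add_eq_0_iff)

lemma conn_diff_vec:
  "pf X \<Longrightarrow> u \<in> slit N \<Longrightarrow> A \<in> tsp u \<Longrightarrow> B \<in> tsp u \<Longrightarrow> D u (A - B) X = D u A X - D u B X"
  using conn_add_vec[of X u A "- B"] S.tangent_uminus conn_uminus_vec by simp

lemma conn_zero: "u \<in> slit N \<Longrightarrow> A \<in> tsp u \<Longrightarrow> D u A 0 = 0"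
  using conn_add[of 0 0 u A] pi_field_zero by simp

lemma conn_uminus: "pf X \<Longrightarrow> u \<in> slit N \<Longrightarrow> A \<in> tsp u \<Longrightarrow> D u A (- X) = - D u A X"
  using conn_add[of X "- X" u A] pi_field_uminus conn_zero by (simp add: add_eq_0_iff)

lemma conn_diff:
  "pf X \<Longrightarrow> pf Y \<Longrightarrow> u \<in> slit N \<Longrightarrow> A \<in> tsp u \<Longrightarrow> D u A (X - Y) = D u A X - D u A Y"
  using conn_add[of X "- Y" u A] pi_field_uminus conn_uminus by simp

text \<open>Sections are total functions, and a section vanishing on the slit bundle is its own product
  with the indicator function of the complement, which is smooth with derivative \<open>0\<close>.\<close>

lemma conn_eq_zero:
  assumes X: "pf X" and X0: "\<And>w. w \<in> slit N \<Longrightarrow> X w = 0" and u: "u \<in> slit N" and A: "A \<in> tsp u"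
  shows "D u A X = 0"
proof -
  define f where "f = (\<lambda>w. if w \<in> slit N then 0 else 1 :: real)"
  have f0: "(f \<circ> chart_inv C) z = 0" if "C \<in> slit_atlas N" "z \<in> snd C ` fst C" for C z
    using chart_inv_in[OF that(2)] that(1) by (auto simp: f_def pts_def)
  have sf: "smooth_fun (slit_atlas N) f"
    unfolding smooth_fun_def smooth_map_def
  proof (intro ballI)
    fix p assume "p \<in> slit N"
    then obtain C where C: "C \<in> charts_at (slit_atlas N) p" unfolding pts_iff by blast
    then have C': "C \<in> slit_atlas N" "p \<in> fst C" by (auto simp: charts_at_iff)
    let ?O = "snd C ` fst C"
    have "smooth_on ?O (snd (UNIV :: real set, id) \<circ> f \<circ> chart_inv C)"
      by (rule smooth_on_cong[OF S.image_open[OF C'(1)] _ smooth_on_const[of _ 0]])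
        (use f0[OF C'(1)] in simp)
    then show "\<exists>c\<in>charts_at (slit_atlas N) p. \<exists>d\<in>charts_at {(UNIV, id)} (f p). \<exists>W. open W \<and> snd c p \<in> W \<and>
        W \<subseteq> snd c ` fst c \<and> f ` chart_inv c ` W \<subseteq> fst d \<and> smooth_on W (snd d \<circ> f \<circ> chart_inv c)"
      using C C' S.image_open[OF C'(1)]
      by (intro bexI[of _ C] bexI[of _ "(UNIV, id)"] exI[of _ ?O]) (auto simp: charts_at_iff)
  qed
  have td: "tderiv (slit_atlas N) u A f = 0"
  proof -
    obtain C where C: "C \<in> charts_at (slit_atlas N) u" using u unfolding pts_iff by blast
    then have C': "C \<in> slit_atlas N" "u \<in> fst C" by (auto simp: charts_at_iff)
    note O = S.image_open[OF C'(1)] imageI[OF C'(2), of "snd C"]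
    have "(f \<circ> chart_inv C) differentiable (at (snd C u))"
      by (rule differentiable_cong_open[OF O, of "\<lambda>z. 0"]) (use f0[OF C'(1)] in auto)
    from S.tderiv_chart[OF A C this] show ?thesis
      using fd_cong_open[OF O, of "f \<circ> chart_inv C" "\<lambda>z. 0"] f0[OF C'(1)] by simp
  qed
  have eq: "(\<lambda>w. tscale (f w) (X w)) = X"
    using X0 by (auto simp: f_def tscale_def fun_eq_iff)
  have fu: "f u = 0" using u by (simp add: f_def)
  have t0: "tscale 0 v = 0" for v :: "('a, real ^ 'n) tvec" by (simp add: tscale_def zero_fun_def)
  show ?thesis using conn_leibniz[OF X u A sf] unfolding eq td fu t0 by simp
qed

text \<open>The difference of the two sections vanishes on the slit bundle, so
  \<open>conn_eq_zero\<close> applies. This is the basic licence to rewrite under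
  \<open>D\<close>.\<close>

lemma conn_cong:
  assumes "pf X" "pf Y" "\<And>w. w \<in> slit N \<Longrightarrow> X w = Y w" "u \<in> slit N" "A \<in> tsp u"
  shows "D u A X = D u A Y"
  using conn_eq_zero[OF pi_field_diff[OF assms(1,2)] _ assms(4,5)] conn_diff[OF assms(1,2,4,5)] assms(3)
  by simp

lemma double_chart_inv:
  assumes c: "c \<in> N" and u: "u \<in> fst (sch N c)" and A: "A \<in> tsp u"
  shows "chart_inv (tch (slit_atlas N) (sch N c)) (snd (sch N c) u, A (sch N c)) = (u, A)"
  using S.bchart_inv_snd[OF sch_in[OF c], of "(u, A)" False] u A by (simp add: fst_bchart[where nz = False])

text \<open>Smoothness jointly in the slit point and in the vector \<open>A\<close>. The second
  factor is \<open>UNIV\<close> because \<open>A\<close> ranges over all tangent vectors of the slit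
  bundle, zero included.\<close>

lemma conn_coord_smooth:
  assumes X: "pf X" and c: "c \<in> N"
  shows "smooth_on ((snd (sch N c) ` fst (sch N c)) \<times> UNIV)
    (\<lambda>w. case chart_inv (tch (slit_atlas N) (sch N c)) w of (u, A) \<Rightarrow> D u A X c)"
proof -
  let ?C = "tch (slit_atlas N) (sch N c)"
  have "smooth_on (snd ?C ` fst ?C) (\<lambda>w. snd ((\<lambda>(u, A). (fst u, D u A X)) (chart_inv ?C w)) c)"
  proof (rule bundle_map_smooth[OF _ _ _ conn_smooth_map[OF X] c])
    show "?C \<in> tangent_atlas (slit_atlas N)" using sch_in[OF c] by (simp add: tangent_atlas_eq)
    show "smooth_atlas (tangent_atlas (slit_atlas N))"
      unfolding tangent_atlas_eq by (rule S.bundle_atlas)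
    fix w assume "w \<in> fst ?C"
    then have w: "fst w \<in> fst (sch N c)" "snd w \<in> tsp (fst w)" unfolding fst_bchart[where nz = False] by auto
    show "fst (case w of (u, A) \<Rightarrow> (fst u, D u A X)) \<in> fst c \<and>
      snd (case w of (u, A) \<Rightarrow> (fst u, D u A X)) \<in> tangent_space N (fst (case w of (u, A) \<Rightarrow> (fst u, D u A X)))"
      using w conn_tangent[OF X sch_pts[OF c w(1)] w(2)] by (cases w) (simp add: fst_bchart)
  qed
  moreover have "snd ?C ` fst ?C = (snd (sch N c) ` fst (sch N c)) \<times> UNIV"
    using S.bchart_image[OF sch_in[OF c], of False] by simp
  ultimately show ?thesis by (simp add: case_prod_beta)
qed

text \<open>In coordinates the derivative is the joint function of \<open>conn_coord_smooth\<close>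
  composed with the graph of the components of \<open>A\<close>.\<close>

lemma cov_pi_field:
  assumes A: "vf A" and X: "pf X"
  shows "pf (cv A X)"
proof (rule pi_fieldI)
  show "cv A X u \<in> tangent_space N (fst u)" if "u \<in> slit N" for u
    unfolding cov_def by (rule conn_tangent[OF X that vf_tangent[OF A that]])
  fix c assume c: "c \<in> N"
  let ?O = "snd (sch N c) ` fst (sch N c)"
  note O = sch_open[OF c]
  show "smooth_on ?O (coords c (cv A X) (sch N c))"
  proof (rule smooth_on_cong[OF O])
    show "smooth_on ?O (\<lambda>z. case chart_inv (tch (slit_atlas N) (sch N c)) (z, coords (sch N c) A (sch N c) z)
        of (u, A) \<Rightarrow> D u A X c)"
      by (rule smooth_on_compose[OF O _ _ conn_coord_smooth[OF X c]])
        (use O S.smooth_vf_coords[OF A sch_in[OF c]] in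
          \<open>auto intro!: open_Times smooth_on_Pair smooth_on_ident simp del: snd_bchart\<close>)
    fix z assume z: "z \<in> ?O"
    note u = sch_inv(1)[OF z]
    have "snd (sch N c) (chart_inv (sch N c) z) = z" using snd_chart_inv[OF z] by blast
    then show "(case chart_inv (tch (slit_atlas N) (sch N c)) (z, coords (sch N c) A (sch N c) z)
        of (u, A) \<Rightarrow> D u A X c) = coords c (cv A X) (sch N c) z"
      using double_chart_inv[OF c u vf_tangent[OF A sch_pts[OF c u]]] by (simp add: cov_def del: snd_bchart)
  qed
qed

section \<open>Horizontal lifts\<close>

lemma vertical_horizontal_zero:
  assumes u: "u \<in> slit N" and A: "A \<in> tsp u" "rho N u A = 0" "D u A eta = 0"
  shows "A = 0"
proof -
  have "A \<in> vert_space N u \<inter> hor_space N D u" using A by (simp add: vert_space_def hor_space_def)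
  then show ?thesis using regular u unfolding regular_connection_def by blast
qed

lemma hor_unique:
  assumes u: "u \<in> slit N" and A: "A \<in> hor_space N D u" and B: "B \<in> hor_space N D u"
    and eq: "rho N u A = rho N u B"
  shows "A = B"
proof -
  have T: "A \<in> tsp u" "B \<in> tsp u" and z: "D u A eta = 0" "D u B eta = 0"
    using A B by (auto simp: hor_space_def)
  have "A - B = 0"
    by (rule vertical_horizontal_zero[OF u S.tangent_diff[OF T]])
      (simp_all add: rho_diff[OF u T] conn_diff_vec[OF pi_field_eta u T] eq z)
  then show ?thesis by simp
qed

text \<open>Take any tangent vector over \<open>v\<close> and drop its vertical part: regularity
  leaves a horizontal vector with the same projection.\<close>

lemma hor_exists:
  assumes u: "u \<in> slit N" and v: "v \<in> tangent_space N (fst u)"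
  shows "v \<in> rho N u ` hor_space N D u"
proof -
  obtain c where c: "c \<in> charts_at N (fst u)" using u by (rule slit_chart_exists)
  obtain A where A: "A \<in> tsp u" "A (sch N c) = (v c, 0)"
    using S.tangent_exists[OF sch_at[OF u c]] by blast
  have rA: "rho N u A = v"
    by (rule tangent_eqI[OF rho_tangent[OF u A(1)] v c]) (simp add: rho_coord[OF u A(1) c] A(2))
  have "A \<in> {A + B |A B. A \<in> vert_space N u \<and> B \<in> hor_space N D u}"
    using A(1) regular u unfolding regular_connection_def by blast
  then obtain V H where VH: "A = V + H" "V \<in> vert_space N u" "H \<in> hor_space N D u" by blast
  then have "rho N u A = rho N u H"
    using rho_add[OF u, of V H] by (simp add: vert_space_def hor_space_def)
  then show ?thesis using rA VH(3) by blast
qed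

lemma hlift:
  assumes "u \<in> slit N" "v \<in> tangent_space N (fst u)"
  shows "hlift N D u v \<in> tsp u" "D u (hlift N D u v) eta = 0" "rho N u (hlift N D u v) = v"
  using inv_into_into[OF hor_exists[OF assms]] f_inv_into_f[OF hor_exists[OF assms]]
  by (auto simp: hlift_def hor_space_def)

lemma hlift_eqI:
  assumes u: "u \<in> slit N" and A: "A \<in> tsp u" "D u A eta = 0"
  shows "hlift N D u (rho N u A) = A"
proof -
  note h = hlift[OF u rho_tangent[OF u A(1)]]
  show ?thesis by (rule hor_unique[OF u _ _ h(3)]) (use h A in \<open>auto simp: hor_space_def\<close>)
qed

text \<open>In coordinates, \<open>D\<eta>\<close> is invertible on vertical vectors, and the vertical part of \<open>\<beta>X\<close> is the
  solution of a linear system with smooth coefficients.\<close>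

lemma beta_smooth:
  assumes X: "pf X"
  shows "vf (\<beta> X)"
proof (rule slit_vfI)
  show T: "\<beta> X u \<in> tsp u" if "u \<in> slit N" for u
    unfolding beta_f_def by (rule hlift[OF that pi_field_tangent[OF X that]])
  fix c assume c: "c \<in> N"
  let ?O = "snd (sch N c) ` fst (sch N c)"
  let ?C = "tch (slit_atlas N) (sch N c)"
  note O = sch_open[OF c]
  define G where "G w = (case chart_inv ?C w of (u, A) \<Rightarrow> D u A eta c)" for w
  have G: "smooth_on (?O \<times> UNIV) G" unfolding G_def by (rule conn_coord_smooth[OF pi_field_eta c])
  have Gs: "smooth_on ?O (\<lambda>z. G (z, f z))" if "smooth_on ?O f" for f
    by (rule smooth_on_compose[OF O _ _ G])
      (use O that in \<open>auto intro!: open_Times smooth_on_Pair smooth_on_ident simp del: snd_bchart\<close>)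
  have G_eq: "G (z, A (sch N c)) = D (chart_inv (sch N c) z) A eta c"
    if z: "z \<in> ?O" and A: "A \<in> tsp (chart_inv (sch N c) z)" for z A
  proof -
    have "snd (sch N c) (chart_inv (sch N c) z) = z" using snd_chart_inv[OF z] by blast
    then show ?thesis
      using double_chart_inv[OF c sch_inv(1)[OF z] A] by (simp add: G_def del: snd_bchart)
  qed
  \<comment> \<open>Every coordinate vector comes from a tangent vector, which carries the linearity
    of \<open>D\<close> over to \<open>G\<close>.\<close>
  have ex: "\<exists>A\<in>tsp (chart_inv (sch N c) z). A (sch N c) = a" if z: "z \<in> ?O" for z a
    using S.tangent_exists[OF sch_at[OF sch_pts[OF c sch_inv(1)[OF z]] sch_charts_at[OF c sch_inv(1)[OF z]]]] .
  have G_add: "G (z, a + b) = G (z, a) + G (z, b)" if z: "z \<in> ?O" for z a b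
  proof -
    note u = sch_pts[OF c sch_inv(1)[OF z]]
    obtain A B where AB: "A \<in> tsp (chart_inv (sch N c) z)" "A (sch N c) = a"
      "B \<in> tsp (chart_inv (sch N c) z)" "B (sch N c) = b" using ex[OF z] by metis
    show ?thesis
      using G_eq[OF z AB(1)] G_eq[OF z AB(3)] G_eq[OF z S.tangent_add[OF AB(1,3)]]
        conn_add_vec[OF pi_field_eta u AB(1,3)] AB by simp
  qed
  have G_scale: "G (z, r *\<^sub>R a) = r *\<^sub>R G (z, a)" if z: "z \<in> ?O" for z a r
  proof -
    note u = sch_pts[OF c sch_inv(1)[OF z]]
    obtain A where A: "A \<in> tsp (chart_inv (sch N c) z)" "A (sch N c) = a" using ex[OF z] by metis
    show ?thesis
      using G_eq[OF z A(1)] G_eq[OF z S.tangent_scale[OF A(1), of r]]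
        conn_scale_vec[OF pi_field_eta u A(1), of r] A by (simp add: tscale_def)
  qed
  \<comment> \<open>The action of D\<eta> on vertical vectors. Its kernel is the intersection of the
    vertical and the horizontal space, which is trivial by regularity.\<close>
  define L where "L z y = G (z, (0, y))" for z y
  have linL: "linear (L z)" if z: "z \<in> ?O" for z
    unfolding L_def using G_add[OF z, of "(0, _)" "(0, _)"] G_scale[OF z, of _ "(0, _)"]
    by (intro linearI) (simp_all del: snd_bchart)
  have injL: "inj (L z)" if z: "z \<in> ?O" for z
    unfolding linear_injective_0[OF linL[OF z]]
  proof (intro allI impI)
    fix y assume y: "L z y = 0"
    note u = sch_pts[OF c sch_inv(1)[OF z]]
    note cu = sch_charts_at[OF c sch_inv(1)[OF z]]
    obtain A where A: "A \<in> tsp (chart_inv (sch N c) z)" "A (sch N c) = (0, y)" using ex[OF z] by metis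
    have "rho N (chart_inv (sch N c) z) A = 0"
      by (rule tangent_eqI[OF rho_tangent[OF u A(1)] tangent_zero cu]) (simp add: rho_coord[OF u A(1) cu] A(2))
    moreover have "D (chart_inv (sch N c) z) A eta = 0"
      by (rule tangent_eqI[OF conn_tangent[OF pi_field_eta u A(1)] tangent_zero cu])
        (use G_eq[OF z A(1)] y A(2) in \<open>simp add: L_def\<close>)
    ultimately have "A = 0" using vertical_horizontal_zero[OF u A(1)] by blast
    then show "y = 0" using A(2) by (simp add: zero_prod_def)
  qed
  let ?b = "coords (sch N c) (\<beta> X) (sch N c)"
  have fst_b: "fst (?b z) = coords c X (sch N c) z" if z: "z \<in> ?O" for z
  proof -
    note u = sch_pts[OF c sch_inv(1)[OF z]]
    note cu = sch_charts_at[OF c sch_inv(1)[OF z]]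
    show ?thesis
      using rho_coord[OF u T[OF u] cu] hlift(3)[OF u pi_field_tangent[OF X u]] by (simp add: beta_f_def)
  qed
  \<comment> \<open>The lift has the known base part \<open>X\<close> and is annihilated by D\<eta>.
    Moving the contribution of the base part to the right leaves the system for the vertical
    part.\<close>
  have eq: "matrix (L z) *v snd (?b z) = - G (z, (coords c X (sch N c) z, 0))" if z: "z \<in> ?O" for z
  proof -
    note u = sch_pts[OF c sch_inv(1)[OF z]]
    have "matrix (L z) *v snd (?b z) = L z (snd (?b z))"
      using matrix_works[of "L z"] linL[OF z] by (simp add: linear_matrix_vector_mul_eq)
    moreover have "G (z, ?b z) = 0"
      using G_eq[OF z T[OF u]] hlift(2)[OF u pi_field_tangent[OF X u]] by (simp add: beta_f_def)
    moreover have "?b z = (coords c X (sch N c) z, 0) + (0, snd (?b z))"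
      using fst_b[OF z] by (simp add: prod_eq_iff)
    ultimately show ?thesis
      using G_add[OF z, of "(coords c X (sch N c) z, 0)" "(0, snd (?b z))"]
      by (simp add: L_def eq_neg_iff_add_eq_0 add.commute del: snd_bchart)
  qed
  have "smooth_on ?O (\<lambda>z. snd (?b z))"
  proof (rule smooth_on_linear_solution[OF O _ _ _ eq])
    show "smooth_on ?O (\<lambda>z. matrix (L z) $ i $ j)" for i j
      unfolding matrix_def L_def by (simp add: smooth_on_vec_nth[OF O Gs[OF smooth_on_const]] del: snd_bchart)
    show "smooth_on ?O (\<lambda>z. - G (z, (coords c X (sch N c) z, 0)))"
      by (intro smooth_on_uminus[OF O] Gs smooth_on_Pair[OF O] smooth_on_const pi_field_coords[OF X c])
    show "det (matrix (L z)) \<noteq> 0" if "z \<in> ?O" for z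
      using det_nz_iff_inj[OF linL[OF that]] injL[OF that] by blast
  qed
  from smooth_on_Pair[OF O pi_field_coords[OF X c] this]
  show "smooth_on ?O ?b"
    by (rule smooth_on_cong[OF O, rotated]) (use fst_b in \<open>simp add: prod_eq_iff del: snd_bchart\<close>)
qed

lemma rho_beta: "pf X \<Longrightarrow> u \<in> slit N \<Longrightarrow> \<rho> (\<beta> X) u = X u"
  unfolding rho_f_def beta_f_def by (rule hlift[OF _ pi_field_tangent])

lemma cov_beta_eta: "pf X \<Longrightarrow> u \<in> slit N \<Longrightarrow> D u (\<beta> X u) eta = 0"
  unfolding beta_f_def by (rule hlift[OF _ pi_field_tangent])

text \<open>The sum of the lifts is horizontal and has the right projection;
  \<open>hlift_eqI\<close> identifies it as the lift.\<close>

lemma beta_add: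
  assumes X: "pf X" and Y: "pf Y" and u: "u \<in> slit N"
  shows "\<beta> (X + Y) u = \<beta> X u + \<beta> Y u"
proof -
  note t = vf_tangent[OF beta_smooth[OF X] u] vf_tangent[OF beta_smooth[OF Y] u]
  have "rho N u (\<beta> X u + \<beta> Y u) = (X + Y) u"
    using rho_add[OF u t] rho_beta[OF X u] rho_beta[OF Y u] by (simp add: rho_f_def)
  moreover have "D u (\<beta> X u + \<beta> Y u) eta = 0"
    using conn_add_vec[OF pi_field_eta u t] by (simp add: cov_beta_eta X Y u)
  ultimately show ?thesis
    using hlift_eqI[OF u S.tangent_add[OF t]] by (simp add: beta_f_def)
qed

lemma gamma_add:
  assumes X: "pf X" and Y: "pf Y" and u: "u \<in> slit N"
  shows "\<gamma> (X + Y) u = \<gamma> X u + \<gamma> Y u"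
proof -
  obtain c where c: "c \<in> charts_at N (fst u)" using u by (rule slit_chart_exists)
  note t = vf_tangent[OF gamma_smooth u]
  show ?thesis
    by (rule S.tangent_eqI[OF t[OF pi_field_add[OF X Y]] S.tangent_add[OF t[OF X] t[OF Y]] sch_at[OF u c]])
      (simp add: gamma_f_def vlift_coord[OF u c])
qed

end

section \<open>Torsion and the first Bianchi identity\<close>

context regular_conn
begin

lemma tor_apply: "tor A B u = D u (A u) (\<rho> B) - D u (B u) (\<rho> A) - \<rho> (brk A B) u"
  by (simp add: torsion_def cov_def)

lemma curv_apply:
  "curv A B X u = - D u (A u) (cv B X) + D u (B u) (cv A X) + D u (brk A B u) X"
  by (simp add: curvature_def cov_def)

lemma tor_pi_field: "vf A \<Longrightarrow> vf B \<Longrightarrow> pf (tor A B)"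
  unfolding torsion_def
  by (intro pi_field_diff cov_pi_field rho_f_pi_field S.bracket_smooth_vf)

lemma tor_antisym:
  assumes A: "vf A" and B: "vf B" and u: "u \<in> slit N"
  shows "tor A B u = - tor B A u"
proof -
  have "\<rho> (brk A B) u = - \<rho> (brk B A) u"
    unfolding rho_f_def using rho_uminus[OF u vf_tangent[OF S.bracket_smooth_vf[OF B A] u]]
    by (subst S.bracket_antisym) simp
  then show ?thesis by (simp add: tor_apply)
qed

lemma rho_f_add: "vf A \<Longrightarrow> vf B \<Longrightarrow> u \<in> slit N \<Longrightarrow> \<rho> (A + B) u = \<rho> A u + \<rho> B u"
  unfolding rho_f_def by (simp add: rho_add vf_tangent)

lemma tor_add_right:
  assumes A: "vf A" and B: "vf B" and C: "vf C" and u: "u \<in> slit N"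
  shows "tor A (B + C) u = tor A B u + tor A C u"
proof -
  note t = vf_tangent[OF _ u]
  have "D u (A u) (\<rho> (B + C)) = D u (A u) (\<rho> B + \<rho> C)"
    by (intro conn_cong rho_f_pi_field S.smooth_vf_add pi_field_add t u A B C)
      (simp add: rho_f_add B C)
  also have "\<dots> = D u (A u) (\<rho> B) + D u (A u) (\<rho> C)"
    by (intro conn_add rho_f_pi_field t u A B C)
  finally have 1: "D u (A u) (\<rho> (B + C)) = D u (A u) (\<rho> B) + D u (A u) (\<rho> C)" .
  have 2: "D u ((B + C) u) (\<rho> A) = D u (B u) (\<rho> A) + D u (C u) (\<rho> A)"
    using conn_add_vec[OF rho_f_pi_field[OF A] u t[OF B] t[OF C]] by simp
  have 3: "\<rho> (brk A (B + C)) u = \<rho> (brk A B) u + \<rho> (brk A C) u"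
    unfolding rho_f_def S.bracket_add_right[OF A B C]
    by (intro rho_add t u S.bracket_smooth_vf A B C)
  show ?thesis unfolding tor_apply 1 2 3 by (simp add: algebra_simps)
qed

text \<open>Lets a field be replaced by one known to agree with it on the slit bundle, as with
  \<open>\<beta> (X + Y)\<close> and the sum of the two lifts.\<close>

lemma tor_cong:
  assumes A: "vf A" "vf A'" "\<And>w. w \<in> slit N \<Longrightarrow> A w = A' w"
    and B: "vf B" "vf B'" "\<And>w. w \<in> slit N \<Longrightarrow> B w = B' w" and u: "u \<in> slit N"
  shows "tor A B u = tor A' B' u"
proof -
  have "D u (A' u) (\<rho> B) = D u (A' u) (\<rho> B')" "D u (B' u) (\<rho> A) = D u (B' u) (\<rho> A')"
    by (intro conn_cong rho_f_pi_field vf_tangent[OF _ u] u A B; simp add: rho_f_def A(3) B(3))+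
  moreover have "\<rho> (brk A B) u = \<rho> (brk A' B') u"
    using S.bracket_cong[OF A B, of u] by (simp add: rho_f_def)
  ultimately show ?thesis unfolding tor_apply A(3)[OF u] B(3)[OF u] by simp
qed

lemma curv_cong:
  assumes A: "vf A" and B: "vf B" and X: "pf X" "pf Y" "\<And>w. w \<in> slit N \<Longrightarrow> X w = Y w"
    and u: "u \<in> slit N"
  shows "curv A B X u = curv A B Y u"
proof -
  have c: "cv A X w = cv A Y w" if "vf A" "w \<in> slit N" for A w
    unfolding cov_def by (intro conn_cong X vf_tangent that)
  have "D u (A u) (cv B X) = D u (A u) (cv B Y)" "D u (B u) (cv A X) = D u (B u) (cv A Y)"
    "D u (brk A B u) X = D u (brk A B u) Y"
    by (intro conn_cong cov_pi_field X c vf_tangent[OF _ u] S.bracket_smooth_vf A B u; assumption)+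
  then show ?thesis by (simp add: curv_apply)
qed

lemma curv_zero:
  assumes A: "vf A" and B: "vf B" and X: "pf X" "\<And>w. w \<in> slit N \<Longrightarrow> X w = 0" and u: "u \<in> slit N"
  shows "curv A B X u = 0"
proof -
  have c: "cv A 0 w = 0" if "vf A" "w \<in> slit N" for A w
    unfolding cov_def by (intro conn_zero vf_tangent that)
  have "curv A B X u = curv A B 0 u"
    using X by (intro curv_cong A B u pi_field_zero) simp_all
  also have "\<dots> = 0"
    unfolding curv_apply
    using conn_eq_zero[OF cov_pi_field[OF B pi_field_zero] c[OF B] u vf_tangent[OF A u]]
      conn_eq_zero[OF cov_pi_field[OF A pi_field_zero] c[OF A] u vf_tangent[OF B u]]
      conn_zero[OF u vf_tangent[OF S.bracket_smooth_vf[OF A B] u]]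
    by simp
  finally show ?thesis .
qed

text \<open>After expansion the iterated derivatives cancel between curvature and derivatives of the
  torsion, the derivatives along brackets between curvature and torsions of brackets, and the
  derivatives of \<rho>[B,C] between the two kinds of torsion terms. What remains is \<rho> of the
  Jacobi sum.\<close>

lemma first_bianchi:
  assumes A: "vf A" and B: "vf B" and C: "vf C" and u: "u \<in> slit N"
  shows "curv A B (\<rho> C) u + curv B C (\<rho> A) u + curv C A (\<rho> B) u
    + D u (A u) (tor B C) + D u (B u) (tor C A) + D u (C u) (tor A B)
    + tor A (brk B C) u + tor B (brk C A) u + tor C (brk A B) u = 0"
proof -
  note t = vf_tangent[OF _ u]
  have D_tor: "D u (A u) (tor B C) = D u (A u) (cv B (\<rho> C)) - D u (A u) (cv C (\<rho> B)) - D u (A u) (\<rho> (brk B C))"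
    if A: "vf A" and B: "vf B" and C: "vf C" for A B C
  proof -
    note p = cov_pi_field[OF B rho_f_pi_field[OF C]] cov_pi_field[OF C rho_f_pi_field[OF B]]
    show ?thesis
      unfolding torsion_def
        conn_diff[OF pi_field_diff[OF p] rho_f_pi_field[OF S.bracket_smooth_vf[OF B C]] u t[OF A]]
        conn_diff[OF p u t[OF A]] ..
  qed
  note b = S.bracket_smooth_vf
  have "\<rho> (brk A (brk B C)) u + \<rho> (brk B (brk C A)) u + \<rho> (brk C (brk A B)) u
    = rho N u (brk A (brk B C) u + brk B (brk C A) u + brk C (brk A B) u)"
    unfolding rho_f_def by (simp add: rho_add u t b A B C S.tangent_add)
  also have "\<dots> = rho N u (0 + 0)" unfolding S.jacobi[OF A B C] by simp
  also have "\<dots> = 0" using rho_diff[OF u S.tangent_zero S.tangent_zero] by simp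
  finally have J: "\<rho> (brk A (brk B C)) u + \<rho> (brk B (brk C A)) u + \<rho> (brk C (brk A B)) u = 0" .
  \<comment> \<open>The letters a, b, c stand for the terms of the three curvatures, d for D_A
    \<rho>[B,C] and its cyclic companions, j for \<rho> of the double brackets.\<close>
  have cancel: "(- a1 + a2 + a3) + (- b1 + b2 + b3) + (- c1 + c2 + c3)
      + (a1 - c2 - d1) + (b1 - a2 - d2) + (c1 - b2 - d3)
      + (d1 - b3 - j1) + (d2 - c3 - j2) + (d3 - a3 - j3) = 0"
    if "j1 + j2 + j3 = 0" for a1 a2 a3 b1 b2 b3 c1 c2 c3 d1 d2 d3 j1 j2 j3 :: "('a, real ^ 'n) tvec"
  proof -
    have "(- a1 + a2 + a3) + (- b1 + b2 + b3) + (- c1 + c2 + c3)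
      + (a1 - c2 - d1) + (b1 - a2 - d2) + (c1 - b2 - d3)
      + (d1 - b3 - j1) + (d2 - c3 - j2) + (d3 - a3 - j3) = - (j1 + j2 + j3)"
      by (simp add: algebra_simps)
    with that show ?thesis by simp
  qed
  show ?thesis
    unfolding curv_apply D_tor[OF A B C] D_tor[OF B C A] D_tor[OF C A B] tor_apply by (rule cancel[OF J])
qed

end

section \<open>Connections with \<open>T(X, \<eta>) = 0\<close>\<close>

locale eta_conn = regular_conn N D
  for N :: "('a, real ^ 'n) chart set" and D +
  assumes T_eta: "pi_field N W \<Longrightarrow> u \<in> slit N \<Longrightarrow> T_tor N D W eta u = 0"
begin

abbreviation "T \<equiv> T_tor N D"
abbreviation "Q \<equiv> Q_tor N D"

lemma T_eq: "T X Y = tor (\<gamma> X) (\<beta> Y)"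
  by (simp add: T_tor_def)

lemma Q_eq: "Q X Y = tor (\<beta> X) (\<beta> Y)"
  by (simp add: Q_tor_def)

lemma T_pi_field: "pf X \<Longrightarrow> pf Y \<Longrightarrow> pf (T X Y)"
  unfolding T_eq by (intro tor_pi_field gamma_smooth beta_smooth)

lemma Q_pi_field: "pf X \<Longrightarrow> pf Y \<Longrightarrow> pf (Q X Y)"
  unfolding Q_eq by (intro tor_pi_field beta_smooth)

lemma gamma_cong: "X u = Y u \<Longrightarrow> \<gamma> X u = \<gamma> Y u"
  by (simp add: gamma_f_def)

lemma beta_cong: "X u = Y u \<Longrightarrow> \<beta> X u = \<beta> Y u"
  by (simp add: beta_f_def)

lemma T_cong:
  assumes "pf X" "pf X'" "\<And>w. w \<in> slit N \<Longrightarrow> X w = X' w"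
    and "pf Y" "pf Y'" "\<And>w. w \<in> slit N \<Longrightarrow> Y w = Y' w" and "u \<in> slit N"
  shows "T X Y u = T X' Y' u"
  unfolding T_eq by (intro tor_cong gamma_smooth beta_smooth gamma_cong beta_cong assms)

lemma Q_cong:
  assumes "pf X" "pf X'" "\<And>w. w \<in> slit N \<Longrightarrow> X w = X' w"
    and "pf Y" "pf Y'" "\<And>w. w \<in> slit N \<Longrightarrow> Y w = Y' w" and "u \<in> slit N"
  shows "Q X Y u = Q X' Y' u"
  unfolding Q_eq by (intro tor_cong beta_smooth beta_cong assms)

lemma Q_antisym: "pf X \<Longrightarrow> pf Y \<Longrightarrow> u \<in> slit N \<Longrightarrow> Q X Y u = - Q Y X u"
  unfolding Q_eq by (intro tor_antisym beta_smooth)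

section \<open>Additivity of the torsion tensors\<close>

lemma tor_beta_add:
  assumes A: "vf A" and X: "pf X" and Y: "pf Y" and u: "u \<in> slit N"
  shows "tor A (\<beta> (X + Y)) u = tor A (\<beta> X) u + tor A (\<beta> Y) u"
proof -
  have "tor A (\<beta> (X + Y)) u = tor A (\<beta> X + \<beta> Y) u"
    by (intro tor_cong A beta_smooth pi_field_add S.smooth_vf_add X Y u)
      (simp_all add: beta_add X Y)
  also have "\<dots> = tor A (\<beta> X) u + tor A (\<beta> Y) u"
    by (intro tor_add_right A beta_smooth X Y u)
  finally show ?thesis .
qed

lemma tor_gamma_add:
  assumes A: "vf A" and X: "pf X" and Y: "pf Y" and u: "u \<in> slit N"
  shows "tor A (\<gamma> (X + Y)) u = tor A (\<gamma> X) u + tor A (\<gamma> Y) u"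
proof -
  have "tor A (\<gamma> (X + Y)) u = tor A (\<gamma> X + \<gamma> Y) u"
    by (intro tor_cong A gamma_smooth pi_field_add S.smooth_vf_add X Y u)
      (simp_all add: gamma_add X Y)
  also have "\<dots> = tor A (\<gamma> X) u + tor A (\<gamma> Y) u"
    by (intro tor_add_right A gamma_smooth X Y u)
  finally show ?thesis .
qed

lemma T_add_right: "pf X \<Longrightarrow> pf Y \<Longrightarrow> pf Z \<Longrightarrow> u \<in> slit N \<Longrightarrow> T X (Y + Z) u = T X Y u + T X Z u"
  unfolding T_eq by (rule tor_beta_add[OF gamma_smooth])

text \<open>Antisymmetry of the full torsion moves the vertical argument to the second place, where
  additivity is already available.\<close>

lemma T_add_left:
  "pf X \<Longrightarrow> pf Y \<Longrightarrow> pf Z \<Longrightarrow> u \<in> slit N \<Longrightarrow> T (X + Y) Z u = T X Z u + T Y Z u"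
  unfolding T_eq using tor_gamma_add[of "\<beta> Z" X Y u]
  by (simp add: tor_antisym[of "\<gamma> _" "\<beta> Z"] gamma_smooth beta_smooth pi_field_add)

lemma Q_add_right: "pf X \<Longrightarrow> pf Y \<Longrightarrow> pf Z \<Longrightarrow> u \<in> slit N \<Longrightarrow> Q X (Y + Z) u = Q X Y u + Q X Z u"
  unfolding Q_eq by (rule tor_beta_add[OF beta_smooth])

lemma T_diff_right: "pf X \<Longrightarrow> pf Y \<Longrightarrow> pf Z \<Longrightarrow> u \<in> slit N \<Longrightarrow> T X (Y - Z) u = T X Y u - T X Z u"
  using T_add_right[of X "Y - Z" Z u] pi_field_diff by (simp add: eq_diff_eq)

lemma T_diff_left: "pf X \<Longrightarrow> pf Y \<Longrightarrow> pf Z \<Longrightarrow> u \<in> slit N \<Longrightarrow> T (X - Y) Z u = T X Z u - T Y Z u"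
  using T_add_left[of "X - Y" Y Z u] pi_field_diff by (simp add: eq_diff_eq)

lemma Q_diff_right: "pf X \<Longrightarrow> pf Y \<Longrightarrow> pf Z \<Longrightarrow> u \<in> slit N \<Longrightarrow> Q X (Y - Z) u = Q X Y u - Q X Z u"
  using Q_add_right[of X "Y - Z" Z u] pi_field_diff by (simp add: eq_diff_eq)

section \<open>Splitting of fields and of the torsion\<close>

text \<open>In T(X,\<eta>) the field \<open>\<gamma> X\<close> projects to 0 and
  \<open>\<beta> eta\<close> to \<eta>, so the torsion reduces to the derivative of \<eta> along
  \<open>\<gamma> X\<close> minus \<open>X\<close>. The hypothesis enters here and is used
  afterwards through this identity.\<close>

lemma cov_gamma_eta:
  assumes X: "pf X" and u: "u \<in> slit N"
  shows "D u (\<gamma> X u) eta = X u"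
proof -
  note g = gamma_smooth[OF X] and b = beta_smooth[OF pi_field_eta]
  have r: "\<rho> (\<beta> eta) w = eta w" if "w \<in> slit N" for w by (rule rho_beta[OF pi_field_eta that])
  have "0 = D u (\<gamma> X u) (\<rho> (\<beta> eta)) - D u (\<beta> eta u) (\<rho> (\<gamma> X)) - \<rho> (brk (\<gamma> X) (\<beta> eta)) u"
    using T_eta[OF X u] by (simp add: T_eq tor_apply)
  moreover have "D u (\<gamma> X u) (\<rho> (\<beta> eta)) = D u (\<gamma> X u) eta"
    by (intro conn_cong rho_f_pi_field b pi_field_eta r u vf_tangent[OF g])
  moreover have "D u (\<beta> eta u) (\<rho> (\<gamma> X)) = 0"
    by (intro conn_eq_zero rho_f_pi_field g rho_gamma X u vf_tangent[OF b])
  moreover have "\<rho> (brk (\<gamma> X) (\<beta> eta)) u = X u"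
    unfolding rho_f_def by (rule rho_bracket_gamma_eta[OF X b r u])
  ultimately show ?thesis by simp
qed

text \<open>The vertical field \<open>A - \<beta> (\<rho> A) - \<gamma> (D\<^sub>A \<eta>)\<close> is annihilated by \<open>D \<eta>\<close>, hence zero.\<close>

lemma vf_decomp:
  assumes A: "vf A" and u: "u \<in> slit N"
  shows "A u = (\<gamma> (cv A eta) + \<beta> (\<rho> A)) u"
proof -
  let ?V = "\<gamma> (cv A eta)" and ?H = "\<beta> (\<rho> A)"
  note V = cov_pi_field[OF A pi_field_eta] and H = rho_f_pi_field[OF A]
  note t = vf_tangent[OF A u] vf_tangent[OF gamma_smooth[OF V] u] vf_tangent[OF beta_smooth[OF H] u]
  note VH = S.tangent_add[OF t(2,3)]
  have "A u - (?V u + ?H u) = 0"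
  proof (rule vertical_horizontal_zero[OF u S.tangent_diff[OF t(1) VH]])
    show "rho N u (A u - (?V u + ?H u)) = 0"
    proof -
      have "rho N u (?V u) = 0" using rho_gamma[OF V u] by (simp only: rho_f_def)
      moreover have "rho N u (?H u) = \<rho> A u"
        unfolding beta_f_def by (rule hlift(3)[OF u pi_field_tangent[OF H u]])
      moreover have "rho N u (A u) = \<rho> A u" by (simp add: rho_f_def)
      ultimately show ?thesis by (simp only: rho_diff[OF u t(1) VH] rho_add[OF u t(2,3)]) simp
    qed
    show "D u (A u - (?V u + ?H u)) eta = 0"
    proof -
      have "D u (A u) eta = cv A eta u" by (simp add: cov_def)
      then show ?thesis
        by (simp only: conn_diff_vec[OF pi_field_eta u t(1) VH] conn_add_vec[OF pi_field_eta u t(2,3)]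
            cov_gamma_eta[OF V u] cov_beta_eta[OF H u]) simp
    qed
  qed
  then show ?thesis by simp
qed

lemma tor_decomp:
  assumes A: "vf A" and B: "vf B" and u: "u \<in> slit N"
  shows "tor A B u = tor A (\<gamma> (cv B eta)) u + tor A (\<beta> (\<rho> B)) u"
proof -
  note g = gamma_smooth[OF cov_pi_field[OF B pi_field_eta]] and b = beta_smooth[OF rho_f_pi_field[OF B]]
  have "tor A B u = tor A (\<gamma> (cv B eta) + \<beta> (\<rho> B)) u"
    by (intro tor_cong A B S.smooth_vf_add g b vf_decomp u refl)
  also have "\<dots> = tor A (\<gamma> (cv B eta)) u + tor A (\<beta> (\<rho> B)) u"
    by (rule tor_add_right[OF A g b u])
  finally show ?thesis .
qed

lemma conn_rho_beta: "vf A \<Longrightarrow> pf X \<Longrightarrow> u \<in> slit N \<Longrightarrow> D u (A u) (\<rho> (\<beta> X)) = D u (A u) X"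
  by (intro conn_cong rho_f_pi_field beta_smooth rho_beta vf_tangent)

lemma conn_rho_gamma: "vf A \<Longrightarrow> pf X \<Longrightarrow> u \<in> slit N \<Longrightarrow> D u (A u) (\<rho> (\<gamma> X)) = 0"
  by (intro conn_eq_zero rho_f_pi_field gamma_smooth rho_gamma vf_tangent)

text \<open>Both fields project to 0, and so does their bracket by integrability of the vertical
  bundle.\<close>

lemma tor_vertical:
  assumes X: "pf X" and Y: "pf Y" and u: "u \<in> slit N"
  shows "tor (\<gamma> X) (\<gamma> Y) u = 0"
proof -
  note g = gamma_smooth[OF X] gamma_smooth[OF Y]
  have "D u (\<gamma> X u) (\<rho> (\<gamma> Y)) = 0" "D u (\<gamma> Y u) (\<rho> (\<gamma> X)) = 0"
    by (simp_all add: conn_rho_gamma g X Y u)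
  moreover have "\<rho> (brk (\<gamma> X) (\<gamma> Y)) u = 0"
    unfolding rho_f_def by (intro rho_bracket_vertical g rho_gamma X Y u)
  ultimately show ?thesis by (simp add: tor_apply)
qed

text \<open>The vertical part of \<open>B\<close> contributes nothing by
  \<open>tor_vertical\<close>. \<open>Y\<close> is any representative of \<rho>B on the slit bundle,
  so that formulas for projected brackets can be inserted directly.\<close>

lemma tor_gamma:
  assumes X: "pf X" and B: "vf B" and Y: "pf Y" "\<And>w. w \<in> slit N \<Longrightarrow> \<rho> B w = Y w" and u: "u \<in> slit N"
  shows "tor (\<gamma> X) B u = T X Y u"
  using tor_decomp[OF gamma_smooth[OF X] B u] tor_vertical[OF X cov_pi_field[OF B pi_field_eta] u]
    T_cong[OF X X refl rho_f_pi_field[OF B] Y u] by (simp add: T_eq)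

text \<open>The horizontal part of \<open>B\<close> gives the Q-term; its vertical part, the lift of
  the derivative of \<eta> along \<open>B\<close>, gives the T-term with a minus sign, because T
  takes the vertical argument first. \<open>Y\<close> and \<open>Z\<close> represent the two parts
  on the slit bundle.\<close>

lemma tor_beta:
  assumes X: "pf X" and B: "vf B" and Y: "pf Y" "\<And>w. w \<in> slit N \<Longrightarrow> \<rho> B w = Y w"
    and Z: "pf Z" "\<And>w. w \<in> slit N \<Longrightarrow> cv B eta w = Z w" and u: "u \<in> slit N"
  shows "tor (\<beta> X) B u = - T Z X u + Q X Y u"
  using tor_decomp[OF beta_smooth[OF X] B u]
    T_cong[OF cov_pi_field[OF B pi_field_eta] Z X X refl u]
    Q_cong[OF X X refl rho_f_pi_field[OF B] Y u]
    tor_antisym[OF beta_smooth[OF X] gamma_smooth[OF cov_pi_field[OF B pi_field_eta]] u]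
  by (simp add: T_eq Q_eq)

lemma curv_rho_beta:
  assumes A: "vf A" and B: "vf B" and X: "pf X" and u: "u \<in> slit N"
  shows "curv A B (\<rho> (\<beta> X)) u = curv A B X u"
  by (intro curv_cong A B rho_f_pi_field beta_smooth X rho_beta u)

lemma curv_rho_gamma:
  assumes A: "vf A" and B: "vf B" and X: "pf X" and u: "u \<in> slit N"
  shows "curv A B (\<rho> (\<gamma> X)) u = 0"
  by (intro curv_zero A B rho_f_pi_field gamma_smooth X rho_gamma u)

lemma conn_tor_antisym:
  assumes "vf A" "vf B" "vf C" "u \<in> slit N"
  shows "D u (A u) (tor B C) = - D u (A u) (tor C B)"
proof -
  have "D u (A u) (tor B C) = D u (A u) (- tor C B)"
    by (intro conn_cong tor_pi_field pi_field_uminus vf_tangent assms) (simp add: tor_antisym[of B C] assms)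
  then show ?thesis by (simp add: conn_uminus tor_pi_field vf_tangent assms)
qed

section \<open>Horizontal and vertical parts of brackets of lifts\<close>

lemma rho_bracket_gamma_gamma:
  "pf X \<Longrightarrow> pf Y \<Longrightarrow> u \<in> slit N \<Longrightarrow> \<rho> (brk (\<gamma> X) (\<gamma> Y)) u = 0"
  unfolding rho_f_def by (intro rho_bracket_vertical gamma_smooth rho_gamma)

text \<open>The definition of the torsion solved for the bracket; the derivative of
  \<rho>(\<gamma>X) vanishes.\<close>

lemma rho_bracket_gamma_beta:
  assumes "pf X" "pf Y" "u \<in> slit N"
  shows "\<rho> (brk (\<gamma> X) (\<beta> Y)) u = (cv (\<gamma> X) Y - T X Y) u"
  by (simp add: T_eq tor_apply cov_def conn_rho_beta conn_rho_gamma gamma_smooth beta_smooth assms)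

lemma rho_bracket_beta_beta:
  assumes "pf X" "pf Y" "u \<in> slit N"
  shows "\<rho> (brk (\<beta> X) (\<beta> Y)) u = (cv (\<beta> X) Y - cv (\<beta> Y) X - Q X Y) u"
  by (simp add: Q_eq tor_apply cov_def conn_rho_beta beta_smooth assms)

text \<open>The curvature applied to \<eta>, solved for its bracket term. By
  \<open>cov_gamma_eta\<close> the second derivatives of \<eta> turn into first derivatives of
  \<open>X\<close> and \<open>Y\<close>.\<close>

lemma S_hat_bracket:
  assumes X: "pf X" and Y: "pf Y" and u: "u \<in> slit N"
  shows "cv (brk (\<gamma> X) (\<gamma> Y)) eta u = (S_hat N D X Y + cv (\<gamma> X) Y - cv (\<gamma> Y) X) u"
proof -
  note g = gamma_smooth[OF X] gamma_smooth[OF Y]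
  have "D u (\<gamma> X u) (cv (\<gamma> Y) eta) = D u (\<gamma> X u) Y" "D u (\<gamma> Y u) (cv (\<gamma> X) eta) = D u (\<gamma> Y u) X"
    by (intro conn_cong cov_pi_field g pi_field_eta X Y u vf_tangent[OF g(1)] vf_tangent[OF g(2)];
        simp add: cov_def cov_gamma_eta X Y)+
  then show ?thesis by (simp add: S_hat_def S_curv_def curv_apply cov_def)
qed

text \<open>As for \<open>S_hat_bracket\<close>, but \<eta> is parallel along
  \<open>\<beta> X\<close>, so only the derivative of \<open>Y\<close> survives.\<close>

lemma P_hat_bracket:
  assumes X: "pf X" and Y: "pf Y" and u: "u \<in> slit N"
  shows "cv (brk (\<beta> X) (\<gamma> Y)) eta u = (P_hat N D X Y + cv (\<beta> X) Y) u"
proof -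
  note b = beta_smooth[OF X] and g = gamma_smooth[OF Y]
  have "D u (\<beta> X u) (cv (\<gamma> Y) eta) = D u (\<beta> X u) Y"
    by (intro conn_cong cov_pi_field g pi_field_eta Y u vf_tangent[OF b]) (simp add: cov_def cov_gamma_eta Y)
  moreover have "D u (\<gamma> Y u) (cv (\<beta> X) eta) = 0"
    by (intro conn_eq_zero cov_pi_field b pi_field_eta u vf_tangent[OF g]) (simp add: cov_def cov_beta_eta X)
  ultimately show ?thesis by (simp add: P_hat_def P_curv_def curv_apply cov_def)
qed

text \<open>Here \<eta> is parallel along both fields, so both second derivatives vanish.\<close>

lemma R_hat_bracket:
  assumes X: "pf X" and Y: "pf Y" and u: "u \<in> slit N"
  shows "cv (brk (\<beta> X) (\<beta> Y)) eta u = R_hat N D X Y u"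
proof -
  note b = beta_smooth[OF X] beta_smooth[OF Y]
  have "D u (\<beta> X u) (cv (\<beta> Y) eta) = 0" "D u (\<beta> Y u) (cv (\<beta> X) eta) = 0"
    by (intro conn_eq_zero cov_pi_field b pi_field_eta u vf_tangent[OF b(1)] vf_tangent[OF b(2)];
        simp add: cov_def cov_beta_eta X Y)+
  then show ?thesis by (simp add: R_hat_def R_curv_def curv_apply cov_def)
qed

lemma curv_pi_field:
  assumes "vf A" "vf B" "pf X"
  shows "pf (curv A B X)"
proof -
  have "pf (- cv A (cv B X) + cv B (cv A X) + cv (brk A B) X)"
    by (intro pi_field_add pi_field_uminus cov_pi_field S.bracket_smooth_vf assms)
  then show ?thesis by (simp add: curvature_def)
qed

lemma hat_pi_field:
  assumes "pf X" "pf Y"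
  shows "pf (S_hat N D X Y)" "pf (P_hat N D X Y)" "pf (R_hat N D X Y)"
  unfolding S_hat_def S_curv_def P_hat_def P_curv_def R_hat_def R_curv_def
  by (intro curv_pi_field gamma_smooth beta_smooth assms pi_field_eta)+

lemma vf_bracket_swap:
  assumes A: "vf A" and B: "vf B" and u: "u \<in> slit N"
  shows "\<rho> (brk B A) u = - \<rho> (brk A B) u" and "pf X \<Longrightarrow> cv (brk B A) X u = - cv (brk A B) X u"
  using rho_uminus[OF u vf_tangent[OF S.bracket_smooth_vf[OF A B] u]]
    conn_uminus_vec[OF _ u vf_tangent[OF S.bracket_smooth_vf[OF A B] u], of X]
  by (simp_all add: rho_f_def cov_def S.bracket_antisym[of B A])

lemma T_uminus_left: "pf X \<Longrightarrow> pf Y \<Longrightarrow> u \<in> slit N \<Longrightarrow> T (- X) Y u = - T X Y u"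
  using T_add_left[of X "- X" Y u] T_diff_left[of X X Y u] pi_field_uminus[of X]
  by (simp add: eq_neg_iff_add_eq_0 add.commute)

section \<open>The three identities\<close>

text \<open>The Bianchi identity for \<open>\<gamma> X\<close>, \<open>\<gamma> Y\<close>,
  \<open>\<beta> Z\<close>. Curvatures acting on the projections of vertical lifts vanish, so only S
  survives. The torsions of brackets supply the terms that complete derivatives of values of T to
  derivatives of T, the quadratic terms, and the term with \<open>S_hat\<close> from the vertical
  part of [\<gamma>X,\<gamma>Y].\<close>

lemma S_curv_formula:
  assumes X: "pf X" and Y: "pf Y" and Z: "pf Z" and u: "u \<in> slit N"
  shows "S_curv N D X Y Z u = (cov2 D (\<gamma> Y) T X Z - cov2 D (\<gamma> X) T Y Z
    + T X (T Y Z) - T Y (T X Z) + T (S_hat N D X Y) Z) u"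
proof -
  note gX = gamma_smooth[OF X] and gY = gamma_smooth[OF Y] and bZ = beta_smooth[OF Z]
  note brk = S.bracket_smooth_vf
  note p = T_pi_field[OF X Z] T_pi_field[OF Y Z] cov_pi_field[OF gX Z] cov_pi_field[OF gY Z]
    cov_pi_field[OF gX Y] cov_pi_field[OF gY X] hat_pi_field(1)[OF X Y]
  let ?DXZ = "cv (\<gamma> X) Z" and ?DYZ = "cv (\<gamma> Y) Z" and ?DXY = "cv (\<gamma> X) Y" and ?DYX = "cv (\<gamma> Y) X"
  have "tor (\<gamma> X) (brk (\<gamma> Y) (\<beta> Z)) u = T X (?DYZ - T Y Z) u"
    by (rule tor_gamma[OF X brk[OF gY bZ] pi_field_diff[OF p(4,2)] rho_bracket_gamma_beta[OF Y Z] u])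
  then have 1: "tor (\<gamma> X) (brk (\<gamma> Y) (\<beta> Z)) u = T X ?DYZ u - T X (T Y Z) u"
    unfolding T_diff_right[OF X p(4,2) u] .
  have "tor (\<gamma> Y) (brk (\<beta> Z) (\<gamma> X)) u = T Y (T X Z - ?DXZ) u"
    by (rule tor_gamma[OF Y brk[OF bZ gX] pi_field_diff[OF p(1,3)] _ u])
      (simp add: vf_bracket_swap(1)[OF gX bZ] rho_bracket_gamma_beta X Z)
  then have 2: "tor (\<gamma> Y) (brk (\<beta> Z) (\<gamma> X)) u = - T Y ?DXZ u + T Y (T X Z) u"
    using T_diff_right[OF Y p(1,3) u] by simp
  have "tor (\<beta> Z) (brk (\<gamma> X) (\<gamma> Y)) u = - T (S_hat N D X Y + ?DXY - ?DYX) Z u + Q Z 0 u"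
    by (rule tor_beta[OF Z brk[OF gX gY] pi_field_zero _ pi_field_diff[OF pi_field_add[OF p(7,5)] p(6)]
          S_hat_bracket[OF X Y] u]) (simp add: rho_bracket_gamma_gamma X Y)
  \<comment> \<open>The instance Q(Z, Z - Z) of additivity.\<close>
  moreover have "Q Z 0 u = 0" using Q_diff_right[OF Z Z Z u] by simp
  ultimately have 3: "tor (\<beta> Z) (brk (\<gamma> X) (\<gamma> Y)) u
      = - T (S_hat N D X Y) Z u - T ?DXY Z u + T ?DYX Z u"
    using T_diff_left[OF pi_field_add[OF p(7,5)] p(6) Z u] T_add_left[OF p(7,5) Z u] by simp
  have 4: "D u (\<gamma> Y u) (tor (\<beta> Z) (\<gamma> X)) = - D u (\<gamma> Y u) (T X Z)"
    using conn_tor_antisym[OF gY bZ gX u] by (simp add: T_eq)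
  have 5: "D u (\<beta> Z u) (tor (\<gamma> X) (\<gamma> Y)) = 0"
    by (intro conn_eq_zero tor_pi_field gX gY tor_vertical X Y u vf_tangent[OF bZ])
  have "S_curv N D X Y Z u + D u (\<gamma> X u) (T Y Z) - D u (\<gamma> Y u) (T X Z)
      + (T X ?DYZ u - T X (T Y Z) u) + (- T Y ?DXZ u + T Y (T X Z) u)
      + (- T (S_hat N D X Y) Z u - T ?DXY Z u + T ?DYX Z u) = 0"
    using first_bianchi[OF gX gY bZ u]
    unfolding curv_rho_beta[OF gX gY Z u] curv_rho_gamma[OF gY bZ X u] curv_rho_gamma[OF bZ gX Y u]
      1 2 3 4 5 by (simp add: S_curv_def T_eq)
  then show ?thesis by (simp add: cov2_def cov_def algebra_simps)
qed

text \<open>The Bianchi identity for \<open>\<beta> X\<close>, \<open>\<gamma> Y\<close>,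
  \<open>\<beta> Z\<close>. The curvature acting on \<rho>(\<gamma>Y) vanishes, and the other two
  give P(X,Y)Z and, after exchanging arguments, -P(Z,Y)X.\<close>

lemma P_curv_antisymmetrization:
  assumes X: "pf X" and Y: "pf Y" and Z: "pf Z" and u: "u \<in> slit N"
  shows "(P_curv N D X Y Z - P_curv N D Z Y X) u =
    (cov2 D (\<beta> Z) T Y X - cov2 D (\<beta> X) T Y Z + cov2 D (\<gamma> Y) Q X Z
     - T Y (Q X Z) - T (P_hat N D Z Y) X + T (P_hat N D X Y) Z - Q Z (T Y X) + Q X (T Y Z)) u"
proof -
  note bX = beta_smooth[OF X] and gY = gamma_smooth[OF Y] and bZ = beta_smooth[OF Z]
  note brk = S.bracket_smooth_vf
  note p = T_pi_field[OF Y X] T_pi_field[OF Y Z] Q_pi_field[OF X Z] Q_pi_field[OF Z X]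
    cov_pi_field[OF gY Z] cov_pi_field[OF gY X] cov_pi_field[OF bX Y] cov_pi_field[OF bZ Y]
    cov_pi_field[OF bZ X] cov_pi_field[OF bX Z] hat_pi_field(2)[OF X Y] hat_pi_field(2)[OF Z Y]
  let ?YZ = "cv (\<gamma> Y) Z" and ?YX = "cv (\<gamma> Y) X" and ?XY = "cv (\<beta> X) Y" and ?ZY = "cv (\<beta> Z) Y"
    and ?ZX = "cv (\<beta> Z) X" and ?XZ = "cv (\<beta> X) Z"
  \<comment> \<open>P takes the horizontal argument first, so the bracket is reversed before
    \<open>P_hat_bracket\<close> applies.\<close>
  have V: "cv (brk (\<gamma> Y) (\<beta> Z)) eta w = (- (P_hat N D Z Y + ?ZY)) w" if "w \<in> slit N" for w
    using vf_bracket_swap(2)[OF bZ gY that pi_field_eta] P_hat_bracket[OF Z Y that] by simp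
  have "tor (\<beta> X) (brk (\<gamma> Y) (\<beta> Z)) u = - T (- (P_hat N D Z Y + ?ZY)) X u + Q X (?YZ - T Y Z) u"
    by (rule tor_beta[OF X brk[OF gY bZ] pi_field_diff[OF p(5,2)] rho_bracket_gamma_beta[OF Y Z]
          pi_field_uminus[OF pi_field_add[OF p(12,8)]] V u])
  then have 1: "tor (\<beta> X) (brk (\<gamma> Y) (\<beta> Z)) u
      = T (P_hat N D Z Y) X u + T ?ZY X u + Q X ?YZ u - Q X (T Y Z) u"
    using T_uminus_left[OF pi_field_add[OF p(12,8)] X u] T_add_left[OF p(12,8) X u]
      Q_diff_right[OF X p(5,2) u] by simp
  have "tor (\<gamma> Y) (brk (\<beta> Z) (\<beta> X)) u = T Y (?ZX - ?XZ - Q Z X) u"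
    by (rule tor_gamma[OF Y brk[OF bZ bX] pi_field_diff[OF pi_field_diff[OF p(9,10)] p(4)]
          rho_bracket_beta_beta[OF Z X] u])
  moreover have "T Y (Q Z X) u = T Y (- Q X Z) u"
    by (rule T_cong[OF Y Y refl p(4) pi_field_uminus[OF p(3)] _ u]) (simp add: Q_antisym[of Z X] X Z)
  \<comment> \<open>The negative is written as a difference so that \<open>T_diff_right\<close>
    applies; the value of T(Y,0) is its instance T(Y, Y - Y).\<close>
  moreover have "T Y (0 - Q X Z) u = - T Y (Q X Z) u"
    using T_diff_right[OF Y pi_field_zero p(3) u] T_diff_right[OF Y Y Y u] by simp
  ultimately have 2: "tor (\<gamma> Y) (brk (\<beta> Z) (\<beta> X)) u = T Y ?ZX u - T Y ?XZ u + T Y (Q X Z) u"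
    using T_diff_right[OF Y pi_field_diff[OF p(9,10)] p(4) u] T_diff_right[OF Y p(9,10) u] by simp
  have "tor (\<beta> Z) (brk (\<beta> X) (\<gamma> Y)) u = - T (P_hat N D X Y + ?XY) Z u + Q Z (T Y X - ?YX) u"
    by (rule tor_beta[OF Z brk[OF bX gY] pi_field_diff[OF p(1,6)] _ pi_field_add[OF p(11,7)]
          P_hat_bracket[OF X Y] u])
      (simp add: vf_bracket_swap(1)[OF gY bX] rho_bracket_gamma_beta X Y)
  then have 3: "tor (\<beta> Z) (brk (\<beta> X) (\<gamma> Y)) u
      = - T (P_hat N D X Y) Z u - T ?XY Z u + Q Z (T Y X) u - Q Z ?YX u"
    using T_add_left[OF p(11,7) Z u] Q_diff_right[OF Z p(1,6) u] by simp
  have 4: "D u (\<gamma> Y u) (tor (\<beta> Z) (\<beta> X)) = - D u (\<gamma> Y u) (Q X Z)"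
    using conn_tor_antisym[OF gY bZ bX u] by (simp add: Q_eq)
  have 5: "D u (\<beta> Z u) (tor (\<beta> X) (\<gamma> Y)) = - D u (\<beta> Z u) (T Y X)"
    using conn_tor_antisym[OF bZ bX gY u] by (simp add: T_eq)
  have 6: "curv (\<gamma> Y) (\<beta> Z) X u = - P_curv N D Z Y X u"
    using vf_bracket_swap(2)[OF gY bZ u X] by (simp add: P_curv_def curv_apply cov_def)
  have "P_curv N D X Y Z u - P_curv N D Z Y X u + D u (\<beta> X u) (T Y Z) - D u (\<gamma> Y u) (Q X Z)
      - D u (\<beta> Z u) (T Y X)
      + (T (P_hat N D Z Y) X u + T ?ZY X u + Q X ?YZ u - Q X (T Y Z) u)
      + (T Y ?ZX u - T Y ?XZ u + T Y (Q X Z) u)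
      + (- T (P_hat N D X Y) Z u - T ?XY Z u + Q Z (T Y X) u - Q Z ?YX u) = 0"
    using first_bianchi[OF bX gY bZ u]
    unfolding curv_rho_beta[OF bX gY Z u] curv_rho_beta[OF gY bZ X u] curv_rho_gamma[OF bZ bX Y u]
      1 2 3 4 5 6 by (simp add: P_curv_def T_eq)
  then show ?thesis
    \<comment> \<open>Brings the derivative of \<open>X\<close> along \<open>\<gamma> Y\<close> into
      the first argument of Q, where it stands in the derivative of Q.\<close>
    using Q_antisym[OF Z p(6) u] by (simp add: cov2_def cov_def algebra_simps)
qed

text \<open>The Bianchi identity for three horizontal lifts: every curvature term survives, and the
  vertical parts of the brackets contribute the terms with \<open>R_hat\<close>.\<close>

lemma R_curv_cyclic:
  assumes X: "pf X" and Y: "pf Y" and Z: "pf Z" and u: "u \<in> slit N"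
  shows "cyclic_sum (\<lambda>X Y Z. R_curv N D X Y Z - T (R_hat N D X Y) Z) X Y Z u =
    cyclic_sum (\<lambda>X Y Z. Q X (Q Y Z) - cov2 D (\<beta> X) Q Y Z) X Y Z u"
proof -
  \<comment> \<open>One of the two derivative terms is moved to the first argument of Q by
    antisymmetry, so that both kinds of correction terms in the derivative of Q appear.\<close>
  have t: "tor (\<beta> X) (brk (\<beta> Y) (\<beta> Z)) u = - T (R_hat N D Y Z) X u
      - Q (cv (\<beta> Y) Z) X u - Q X (cv (\<beta> Z) Y) u - Q X (Q Y Z) u"
    if X: "pf X" and Y: "pf Y" and Z: "pf Z" for X Y Z
  proof -
    note b = beta_smooth[OF Y] beta_smooth[OF Z]
    note p = cov_pi_field[OF b(1) Z] cov_pi_field[OF b(2) Y] Q_pi_field[OF Y Z]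
    have "tor (\<beta> X) (brk (\<beta> Y) (\<beta> Z)) u
        = - T (R_hat N D Y Z) X u + Q X (cv (\<beta> Y) Z - cv (\<beta> Z) Y - Q Y Z) u"
      by (rule tor_beta[OF X S.bracket_smooth_vf[OF b] pi_field_diff[OF pi_field_diff[OF p(1,2)] p(3)]
            rho_bracket_beta_beta[OF Y Z] hat_pi_field(3)[OF Y Z] R_hat_bracket[OF Y Z] u])
    then show ?thesis
      using Q_diff_right[OF X pi_field_diff[OF p(1,2)] p(3) u] Q_diff_right[OF X p(1,2) u]
        Q_antisym[OF X p(1) u] by simp
  qed
  note b = beta_smooth[OF X] beta_smooth[OF Y] beta_smooth[OF Z]
  note B = first_bianchi[OF b u, unfolded curv_rho_beta[OF b(1,2) Z u] curv_rho_beta[OF b(2,3) X u]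
      curv_rho_beta[OF b(3,1) Y u] t[OF X Y Z] t[OF Y Z X] t[OF Z X Y], folded R_curv_def Q_eq]
  \<comment> \<open>Equal indices belong to the same cyclic position in the claim. The torsion of
    one lift with a bracket mixes positions, so the identity closes only after summation over all
    three.\<close>
  have cancel: "(r1 - t1) + (r2 - t2) + (r3 - t3) =
      (q1 - (d1 - e1 - f1)) + (q2 - (d2 - e2 - f2)) + (q3 - (d3 - e3 - f3))"
    if "r1 + r2 + r3 + d1 + d2 + d3 + (- t2 - e2 - f3 - q1) + (- t3 - e3 - f1 - q2) + (- t1 - e1 - f2 - q3) = 0"
    for r1 r2 r3 t1 t2 t3 q1 q2 q3 d1 d2 d3 e1 e2 e3 f1 f2 f3 :: "('a, real ^ 'n) tvec"
    using that by (simp add: algebra_simps)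
  have app: "(F + G) u = F u + G u" "(F - G) u = F u - G u" for F G :: "('a, real ^ 'n) psec"
    by simp_all
  have cv: "cv A F u = D u (A u) F" for A F by (simp add: cov_def)
  show ?thesis
    unfolding cyclic_sum_def cov2_def app cv by (rule cancel) (use B in simp)
qed

end

theorem proposition2p5:
  fixes M :: "'a topology"
    and \<A> :: "('a, real ^ 'n) chart set"
    and D :: "('a, real ^ 'n) conn"
    and X Y Z :: "('a, real ^ 'n) psec"
  assumes "smooth_manifold M \<A>"
    and "regular_connection \<A> D"
    and "\<And>W u. pi_field \<A> W \<Longrightarrow> u \<in> slit \<A> \<Longrightarrow> T_tor \<A> D W eta u = 0"
    and "pi_field \<A> X" "pi_field \<A> Y" "pi_field \<A> Z"
  shows
    "(\<forall>u\<in>slit \<A>.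
        S_curv \<A> D X Y Z u =
        (cov2 D (gamma_f \<A> Y) (T_tor \<A> D) X Z
         - cov2 D (gamma_f \<A> X) (T_tor \<A> D) Y Z
         + T_tor \<A> D X (T_tor \<A> D Y Z)
         - T_tor \<A> D Y (T_tor \<A> D X Z)
         + T_tor \<A> D (S_hat \<A> D X Y) Z) u) \<and>
     (\<forall>u\<in>slit \<A>.
        (P_curv \<A> D X Y Z - P_curv \<A> D Z Y X) u =
        (cov2 D (beta_f \<A> D Z) (T_tor \<A> D) Y X
         - cov2 D (beta_f \<A> D X) (T_tor \<A> D) Y Z
         + cov2 D (gamma_f \<A> Y) (Q_tor \<A> D) X Z
         - T_tor \<A> D Y (Q_tor \<A> D X Z)
         - T_tor \<A> D (P_hat \<A> D Z Y) X
         + T_tor \<A> D (P_hat \<A> D X Y) Z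
         - Q_tor \<A> D Z (T_tor \<A> D Y X)
         + Q_tor \<A> D X (T_tor \<A> D Y Z)) u) \<and>
     (\<forall>u\<in>slit \<A>.
        cyclic_sum (\<lambda>X Y Z. R_curv \<A> D X Y Z - T_tor \<A> D (R_hat \<A> D X Y) Z) X Y Z u =
        cyclic_sum (\<lambda>X Y Z. Q_tor \<A> D X (Q_tor \<A> D Y Z)
                             - cov2 D (beta_f \<A> D X) (Q_tor \<A> D) Y Z) X Y Z u)"
proof -
  interpret smooth_atlas \<A> by (rule smooth_manifold_atlas[OF assms(1)])
  interpret eta_conn \<A> D by unfold_locales (rule assms(2), rule assms(3))
  show ?thesis using S_curv_formula P_curv_antisymmetrization R_curv_cyclic assms(4-6) by blast
qed

end
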